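(* Let $p$ be an odd prime and let $G$ be a periodic GGS-group over the $p$-adic tree. Then the quotient $G/\mathrm{st}_G(n)$ is a Beauville group if $p\ge 5$ and $n\ge 2$, or if $p=3$ and $n\ge 3$.
   Context: The $p$-adic tree $\mathcal{T}$ is the rooted tree whose vertices are the words over $X=\{1,\dots,p\}$ (the free monoid $X^*$), with root the empty word, where the children of a vertex $v$ are the words $vx$, $x\in X$; level $n$ consists of the words of length $n$. $\mathrm{Aut}\,\mathcal{T}$ is the group of bijections of the vertices preserving incidence (so fixing the root and preserving levels), acting on the right. $\mathrm{st}(n)$ is the subgroup of $\mathrm{Aut}\,\mathcal{T}$ fixing all vertices of level $n$, and for $G\le \mathrm{Aut}\,\mathcal{T}$, $\mathrm{st}_G(n)=\mathrm{st}(n)\cap G$. The map $\psi:\mathrm{st}(1)\to \mathrm{Aut}\,\mathcal{T}\times\overset{p}{\cdots}\times \mathrm{Aut}\,\mathcal{T}$, $g\mapsto(g_1,\dots,g_p)$, is the isomorphism where $g_i$ is the automorphism of $\mathcal{T}$ induced by $g$ on the subtree hanging from the vertex $i$. GGS-group: let $a\in\mathrm{Aut}\,\mathcal{T}$ be the rooted automorphism permuting rigidly the $p$ subtrees hanging from the root according to the permutation $(1\,2\,\dots\,p)$ (it has order $p$). Given a non-zero vector $\mathbf{e}=(e_1,\dots,e_{p-1})\in\mathbb{F}_p^{p-1}$, define $b\in\mathrm{st}(1)$ recursively by $\psi(b)=(a^{e_1},\dots,a^{e_{p-1}},b)$. The GGS-group with defining vector $\mathbf{e}$ is $G=\langle a,b\rangle$.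 A group is periodic if all its elements have finite order. Beauville group: a finite $2$-generator group $H$ is a Beauville group if there are two pairs $\{x_1,y_1\}$, $\{x_2,y_2\}$, each generating $H$, with $\Sigma(x_1,y_1)\cap\Sigma(x_2,y_2)=1$, where $\Sigma(x_i,y_i)=\bigcup_{g\in H}\big(\langle x_i\rangle^g\cup\langle y_i\rangle^g\cup\langle x_iy_i\rangle^g\big)$. *)

theory Defs
  imports "HOL-Algebra.Coset" "HOL-Algebra.Generated_Groups" "HOL-Number_Theory.Residues"
begin

section \<open>The \<open>p\<close>-adic tree and its automorphism group\<close>

text \<open>The children of \<open>v\<close> are the words \<open>v @ [x]\<close>, so the subtree hanging from the first-level vertex
  \<open>[i]\<close> consists of the words \<open>i # w\<close>.\<close>

definition vertices :: "nat \<Rightarrow> nat list set" where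
  "vertices p = lists {1..p}"

definition incident :: "nat list \<Rightarrow> nat list \<Rightarrow> bool" where
  "incident u v \<longleftrightarrow> (\<exists>x. v = u @ [x]) \<or> (\<exists>x. u = v @ [x])"

definition tree_automorphisms :: "nat \<Rightarrow> (nat list \<Rightarrow> nat list) set" where
  "tree_automorphisms p =
     {f \<in> extensional (vertices p). bij_betw f (vertices p) (vertices p) \<and>
        (\<forall>u\<in>vertices p. \<forall>v\<in>vertices p. incident (f u) (f v) \<longleftrightarrow> incident u v)}"

text \<open>Automorphisms act on the right: \<open>f \<otimes> g\<close> is \<open>f\<close> followed by \<open>g\<close>. This is the opposite
  of the convention of \<open>BijGroup\<close>.\<close>

definition aut_tree :: "nat \<Rightarrow> (nat list \<Rightarrow> nat list) monoid" where
  "aut_tree p = \<lparr>carrier = tree_automorphisms p,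
                monoid.mult = (\<lambda>f g. compose (vertices p) g f),
                one = (\<lambda>v\<in>vertices p. v)\<rparr>"

definition level_stabilizer :: "nat \<Rightarrow> nat \<Rightarrow> (nat list \<Rightarrow> nat list) set" where
  "level_stabilizer p n =
     {g \<in> carrier (aut_tree p). \<forall>v\<in>vertices p. length v = n \<longrightarrow> g v = v}"

text \<open>For \<open>g\<close> fixing the first level, \<open>psi p g i\<close> is the \<open>i\<close>-th component of \<open>\<psi>(g)\<close>.\<close>

definition psi :: "nat \<Rightarrow> (nat list \<Rightarrow> nat list) \<Rightarrow> nat \<Rightarrow> nat list \<Rightarrow> nat list" where
  "psi p g i = (\<lambda>w\<in>vertices p. tl (g (i # w)))"


section \<open>GGS-groups\<close>

fun rooted_cycle :: "nat \<Rightarrow> nat list \<Rightarrow> nat list" where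
  "rooted_cycle p [] = []"
| "rooted_cycle p (x # w) = (if x = p then 1 else Suc x) # w"

definition ggs_a :: "nat \<Rightarrow> nat list \<Rightarrow> nat list" where
  "ggs_a p = restrict (rooted_cycle p) (vertices p)"

fun directed :: "nat \<Rightarrow> (nat \<Rightarrow> int) \<Rightarrow> nat list \<Rightarrow> nat list" where
  "directed p e [] = []"
| "directed p e (i # w) =
     i # (if i = p then directed p e w else (ggs_a p [^]\<^bsub>aut_tree p\<^esub> e i) w)"

text \<open>The unique element of the first level stabilizer with
  \<open>\<psi>(b) = (a\<^bsup>e 1\<^esup>, \<dots>, a\<^bsup>e (p-1)\<^esup>, b)\<close>; see the lemma \<open>ggs_b_iff\<close> below.\<close>

definition ggs_b :: "nat \<Rightarrow> (nat \<Rightarrow> int) \<Rightarrow> nat list \<Rightarrow> nat list" where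
  "ggs_b p e = restrict (directed p e) (vertices p)"

definition ggs_group :: "nat \<Rightarrow> (nat \<Rightarrow> int) \<Rightarrow> (nat list \<Rightarrow> nat list) monoid" where
  "ggs_group p e = (aut_tree p)\<lparr>carrier := generate (aut_tree p) {ggs_a p, ggs_b p e}\<rparr>"

definition level_stabilizer_in ::
    "nat \<Rightarrow> (nat list \<Rightarrow> nat list) monoid \<Rightarrow> nat \<Rightarrow> (nat list \<Rightarrow> nat list) set" where
  "level_stabilizer_in p G n = level_stabilizer p n \<inter> carrier G"


section \<open>Periodic groups and Beauville groups\<close>

definition periodic_group :: "('a, 'b) monoid_scheme \<Rightarrow> bool" where
  "periodic_group G \<longleftrightarrow>
     group G \<and> (\<forall>x\<in>carrier G. \<exists>k::nat. k > 0 \<and> x [^]\<^bsub>G\<^esub> k = \<one>\<^bsub>G\<^esub>)"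

definition conj_set :: "('a, 'b) monoid_scheme \<Rightarrow> 'a set \<Rightarrow> 'a \<Rightarrow> 'a set" where
  "conj_set H S g = {inv\<^bsub>H\<^esub> g \<otimes>\<^bsub>H\<^esub> s \<otimes>\<^bsub>H\<^esub> g | s. s \<in> S}"

definition Sigma_set :: "('a, 'b) monoid_scheme \<Rightarrow> 'a \<Rightarrow> 'a \<Rightarrow> 'a set" where
  "Sigma_set H x y =
     (\<Union>g\<in>carrier H. conj_set H (generate H {x}) g \<union> conj_set H (generate H {y}) g \<union>
        conj_set H (generate H {x \<otimes>\<^bsub>H\<^esub> y}) g)"

definition beauville_group :: "('a, 'b) monoid_scheme \<Rightarrow> bool" where
  "beauville_group H \<longleftrightarrow> group H \<and> finite (carrier H) \<and>
     (\<exists>x\<^sub>1\<in>carrier H. \<exists>y\<^sub>1\<in>carrier H. \<exists>x\<^sub>2\<in>carrier H. \<exists>y\<^sub>2\<in>carrier H.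
        generate H {x\<^sub>1, y\<^sub>1} = carrier H \<and> generate H {x\<^sub>2, y\<^sub>2} = carrier H \<and>
        Sigma_set H x\<^sub>1 y\<^sub>1 \<inter> Sigma_set H x\<^sub>2 y\<^sub>2 = {\<one>\<^bsub>H\<^esub>})"


section \<open>The generators are tree automorphisms\<close>

lemma vertices_Nil [simp]: "[] \<in> vertices p"
  by (simp add: vertices_def)

lemma vertices_Cons [simp]: "x # w \<in> vertices p \<longleftrightarrow> x \<in> {1..p} \<and> w \<in> vertices p"
  by (auto simp: vertices_def)

lemma vertices_append [simp]: "u @ v \<in> vertices p \<longleftrightarrow> u \<in> vertices p \<and> v \<in> vertices p"
  by (auto simp: vertices_def)

lemma carrier_aut_tree [simp]: "carrier (aut_tree p) = tree_automorphisms p"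
  by (simp add: aut_tree_def)

lemma mult_aut_tree: "f \<otimes>\<^bsub>aut_tree p\<^esub> g = compose (vertices p) g f"
  by (simp add: aut_tree_def)

lemma one_aut_tree: "\<one>\<^bsub>aut_tree p\<^esub> = (\<lambda>v\<in>vertices p. v)"
  by (simp add: aut_tree_def)

lemma tree_automorphism_closed:
  "f \<in> tree_automorphisms p \<Longrightarrow> v \<in> vertices p \<Longrightarrow> f v \<in> vertices p"
  by (auto simp: tree_automorphisms_def bij_betw_def)

lemma incident_simps [simp]:
  "\<not> incident [] []"
  "incident [] (x # w) \<longleftrightarrow> w = []"
  "incident (x # w) [] \<longleftrightarrow> w = []"
  "incident (x # u) (y # v) \<longleftrightarrow> x = y \<and> incident u v"
  by (auto simp: incident_def)

lemma group_aut_tree: "group (aut_tree p)"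
proof (rule groupI)
  fix f g
  assume f: "f \<in> carrier (aut_tree p)" and g: "g \<in> carrier (aut_tree p)"
  show "f \<otimes>\<^bsub>aut_tree p\<^esub> g \<in> carrier (aut_tree p)"
    using f g
    by (auto simp: mult_aut_tree tree_automorphisms_def compose_eq bij_betw_apply
             intro: bij_betw_compose)
next
  show "\<one>\<^bsub>aut_tree p\<^esub> \<in> carrier (aut_tree p)"
    by (auto simp: one_aut_tree tree_automorphisms_def bij_betw_def)
next
  fix f g h
  assume "f \<in> carrier (aut_tree p)" "g \<in> carrier (aut_tree p)" "h \<in> carrier (aut_tree p)"
  then show "f \<otimes>\<^bsub>aut_tree p\<^esub> g \<otimes>\<^bsub>aut_tree p\<^esub> h = f \<otimes>\<^bsub>aut_tree p\<^esub> (g \<otimes>\<^bsub>aut_tree p\<^esub> h)"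
    by (auto simp: mult_aut_tree compose_def fun_eq_iff tree_automorphism_closed)
next
  fix f
  assume "f \<in> carrier (aut_tree p)"
  then show "\<one>\<^bsub>aut_tree p\<^esub> \<otimes>\<^bsub>aut_tree p\<^esub> f = f"
    by (auto simp: mult_aut_tree one_aut_tree compose_def fun_eq_iff tree_automorphisms_def
        extensional_def)
next
  fix f
  assume f: "f \<in> carrier (aut_tree p)"
  define g where "g = restrict (inv_into (vertices p) f) (vertices p)"
  have bij: "bij_betw f (vertices p) (vertices p)"
    using f by (simp add: tree_automorphisms_def)
  have fg: "f (g v) = v" "g v \<in> vertices p" if "v \<in> vertices p" for v
    using that bij by (simp_all add: g_def bij_betw_inv_into_right bij_betw_def inv_into_into)
  have "bij_betw g (vertices p) (vertices p)"
    unfolding g_def using bij_betw_inv_into[OF bij] by (simp cong: bij_betw_cong)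
  moreover have "incident (g u) (g v) \<longleftrightarrow> incident u v"
    if "u \<in> vertices p" "v \<in> vertices p" for u v
  proof -
    have "incident (f (g u)) (f (g v)) \<longleftrightarrow> incident (g u) (g v)"
      using f fg(2)[OF that(1)] fg(2)[OF that(2)] by (simp add: tree_automorphisms_def)
    then show ?thesis
      by (simp add: fg(1) that)
  qed
  ultimately have "g \<in> tree_automorphisms p"
    by (auto simp: tree_automorphisms_def g_def)
  moreover have "g \<otimes>\<^bsub>aut_tree p\<^esub> f = \<one>\<^bsub>aut_tree p\<^esub>"
    using fg by (auto simp: mult_aut_tree one_aut_tree compose_def fun_eq_iff)
  ultimately show "\<exists>g\<in>carrier (aut_tree p). g \<otimes>\<^bsub>aut_tree p\<^esub> f = \<one>\<^bsub>aut_tree p\<^esub>"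
    by auto
qed

lemma card_neighbours_root: "card {v \<in> vertices p. incident [] v} = p"
proof -
  have "{v \<in> vertices p. incident [] v} = (\<lambda>x. [x]) ` {1..p}"
    by (auto simp: incident_def)
  then show ?thesis
    by (simp add: card_image inj_on_def)
qed

lemma card_neighbours_not_root:
  assumes "u \<in> vertices p" "u \<noteq> []"
  shows "card {v \<in> vertices p. incident u v} = Suc p"
proof -
  obtain u' x where u: "u = u' @ [x]"
    using assms(2) by (metis append_butlast_last_id)
  have "{v \<in> vertices p. incident u v} = insert u' ((\<lambda>x. u @ [x]) ` {1..p})"
    using assms u by (auto simp: incident_def)
  moreover have "u' \<notin> (\<lambda>x. u @ [x]) ` {1..p}"
    using u by auto
  ultimately show ?thesis
    by (simp add: card_image inj_on_def)
qed

lemma tree_automorphism_root: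
  assumes f: "f \<in> tree_automorphisms p"
  shows "f [] = []"
proof (rule ccontr)
  assume "f [] \<noteq> []"
  then have "card {v \<in> vertices p. incident (f []) v} = Suc p"
    using card_neighbours_not_root tree_automorphism_closed[OF f] by simp
  moreover have "bij_betw f {v \<in> vertices p. incident [] v} {v \<in> vertices p. incident (f []) v}"
  proof (rule bij_betw_imageI)
    have bij: "bij_betw f (vertices p) (vertices p)"
      using f by (simp add: tree_automorphisms_def)
    have inc: "incident (f []) (f v) \<longleftrightarrow> incident [] v" if "v \<in> vertices p" for v
      using f that by (simp add: tree_automorphisms_def)
    show "inj_on f {v \<in> vertices p. incident [] v}"
      using bij by (auto simp: bij_betw_def intro: inj_on_subset)
    have "f ` {v \<in> vertices p. incident [] v} = {v \<in> f ` vertices p. incident (f []) v}"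
      using inc by blast
    then show "f ` {v \<in> vertices p. incident [] v} = {v \<in> vertices p. incident (f []) v}"
      using bij by (simp add: bij_betw_def)
  qed
  ultimately show False
    using bij_betw_same_card card_neighbours_root by fastforce
qed

lemma ggs_a_aut: "ggs_a p \<in> tree_automorphisms p"
proof -
  have "rooted_cycle p v \<in> vertices p" if "v \<in> vertices p" for v
    using that by (cases v) auto
  moreover have "v \<in> rooted_cycle p ` vertices p" if "v \<in> vertices p" for v
  proof (cases v)
    case Nil
    then show ?thesis by (intro image_eqI[of _ _ "[]"]) auto
  next
    case (Cons x w)
    with that show ?thesis
      by (intro image_eqI[of _ _ "(if x = 1 then p else x - 1) # w"]) auto
  qed
  moreover have "inj_on (rooted_cycle p) (vertices p)"
  proof (rule inj_onI)
    fix u v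
    assume uv: "u \<in> vertices p" "v \<in> vertices p" "rooted_cycle p u = rooted_cycle p v"
    show "u = v"
    proof (cases u)
      case Nil
      with uv(3) show ?thesis by (cases v) simp_all
    next
      case (Cons x w)
      with uv(3) obtain y where v: "v = y # w"
        and eq: "(if x = p then 1 else Suc x) = (if y = p then 1 else Suc y)"
        by (cases v) simp_all
      have "x \<ge> 1" "y \<ge> 1"
        using uv(1,2) Cons v by simp_all
      with eq have "x = y"
        by presburger
      then show ?thesis
        by (simp add: Cons v)
    qed
  qed
  moreover have "incident (rooted_cycle p u) (rooted_cycle p v) \<longleftrightarrow> incident u v"
    if "u \<in> vertices p" "v \<in> vertices p" for u v
  proof (cases u)
    case Nil
    then show ?thesis by (cases v) simp_all
  next
    case (Cons x u')
    show ?thesis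
    proof (cases v)
      case Nil
      with Cons show ?thesis by simp
    next
      case (Cons y v')
      have "x \<ge> 1" "y \<ge> 1"
        using that \<open>u = x # u'\<close> Cons by simp_all
      then have "(if x = p then 1 else Suc x) = (if y = p then 1 else Suc y) \<longleftrightarrow> x = y"
        by presburger
      then show ?thesis
        using \<open>u = x # u'\<close> Cons by (simp only: rooted_cycle.simps incident_simps)
    qed
  qed
  ultimately show ?thesis
    by (auto simp: tree_automorphisms_def ggs_a_def bij_betw_def)
qed

lemma ggs_a_pow_aut: "ggs_a p [^]\<^bsub>aut_tree p\<^esub> (k::int) \<in> tree_automorphisms p"
  using group.int_pow_closed[OF group_aut_tree] ggs_a_aut by (metis carrier_aut_tree)

lemma ggs_b_aut: "ggs_b p e \<in> tree_automorphisms p"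
proof -
  let ?a = "\<lambda>i. ggs_a p [^]\<^bsub>aut_tree p\<^esub> e i"
  have a: "?a i w \<in> vertices p" if "w \<in> vertices p" for i w
    using tree_automorphism_closed[OF ggs_a_pow_aut that] .
  have inj_a: "?a i u = ?a i v \<longleftrightarrow> u = v" if "u \<in> vertices p" "v \<in> vertices p" for i u v
    using ggs_a_pow_aut[of p "e i"] that by (auto simp: tree_automorphisms_def bij_betw_def inj_on_def)
  have inc_a: "incident (?a i u) (?a i v) \<longleftrightarrow> incident u v"
    if "u \<in> vertices p" "v \<in> vertices p" for i u v
    using ggs_a_pow_aut[of p "e i"] that by (auto simp: tree_automorphisms_def)
  have root_a: "?a i u = [] \<longleftrightarrow> u = []" if "u \<in> vertices p" for i u
    using inj_a[OF that vertices_Nil] tree_automorphism_root[OF ggs_a_pow_aut] by metis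
  have root: "directed p e u = [] \<longleftrightarrow> u = []" for u
    by (cases u) auto
  have closed: "directed p e v \<in> vertices p" if "v \<in> vertices p" for v
    using that by (induction v) (auto simp: a)
  have surj: "v \<in> directed p e ` vertices p" if "v \<in> vertices p" for v
    using that
  proof (induction v)
    case Nil
    show ?case by (intro image_eqI[of _ _ "[]"]) auto
  next
    case (Cons i w)
    then have i: "i \<in> {1..p}" and w: "w \<in> vertices p" by auto
    show ?case
    proof (cases "i = p")
      case True
      obtain u where "u \<in> vertices p" "w = directed p e u"
        using Cons.IH[OF w] by auto
      then show ?thesis
        using True i by (intro image_eqI[of _ _ "i # u"]) auto
    next
      case False
      have "w \<in> ?a i ` vertices p"
        using ggs_a_pow_aut[of p "e i"] w by (simp add: tree_automorphisms_def bij_betw_def)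
      then obtain u where "u \<in> vertices p" "w = ?a i u"
        by auto
      then show ?thesis
        using False i by (intro image_eqI[of _ _ "i # u"]) auto
    qed
  qed
  have inj: "u = v"
    if "u \<in> vertices p" "v \<in> vertices p" "directed p e u = directed p e v" for u v
    using that
  proof (induction u arbitrary: v)
    case Nil
    then show ?case using root[of v] by auto
  next
    case (Cons i u)
    then show ?case by (cases v) (auto simp: inj_a split: if_splits)
  qed
  have inc: "incident (directed p e u) (directed p e v) \<longleftrightarrow> incident u v"
    if "u \<in> vertices p" "v \<in> vertices p" for u v
    using that
  proof (induction u arbitrary: v)
    case Nil
    then show ?case by (cases v) (auto simp: root root_a)
  next
    case (Cons i u)
    then show ?case by (cases v) (auto simp: root root_a inc_a)
  qed
  show ?thesis
    using closed surj inj inc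
    by (auto simp: tree_automorphisms_def ggs_b_def bij_betw_def inj_on_def)
qed

lemma ggs_b_iff:
  assumes p: "p > 0"
  shows "b = ggs_b p e \<longleftrightarrow>
     b \<in> level_stabilizer p 1 \<and>
     (\<forall>i\<in>{1..<p}. psi p b i = ggs_a p [^]\<^bsub>aut_tree p\<^esub> e i) \<and> psi p b p = b"
    (is "_ \<longleftrightarrow> ?R")
proof
  assume b: "b = ggs_b p e"
  have b_app: "b v = directed p e v" if "v \<in> vertices p" for v
    using that b by (simp add: ggs_b_def)
  have a_ext: "ggs_a p [^]\<^bsub>aut_tree p\<^esub> e i \<in> extensional (vertices p)" for i
    using ggs_a_pow_aut[of p "e i"] by (simp add: tree_automorphisms_def)
  have "b v = v" if v: "v \<in> vertices p" "length v = 1" for v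
  proof -
    obtain i where "v = [i]"
      using v(2) by (auto simp: length_Suc_conv)
    then show ?thesis
      using v tree_automorphism_root[OF ggs_a_pow_aut] by (simp add: b_app)
  qed
  then have "b \<in> level_stabilizer p 1"
    using ggs_b_aut[of p e] by (simp add: level_stabilizer_def flip: b)
  moreover have "psi p b i = ggs_a p [^]\<^bsub>aut_tree p\<^esub> e i" if "i \<in> {1..<p}" for i
  proof (rule extensionalityI[of _ "vertices p"])
    show "psi p b i \<in> extensional (vertices p)"
      by (simp add: psi_def)
    show "(ggs_a p [^]\<^bsub>aut_tree p\<^esub> e i) \<in> extensional (vertices p)"
      by (rule a_ext)
    show "psi p b i w = (ggs_a p [^]\<^bsub>aut_tree p\<^esub> e i) w" if "w \<in> vertices p" for w
      using that \<open>i \<in> {1..<p}\<close> by (simp add: psi_def b_app)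
  qed
  moreover have "psi p b p = b"
  proof (rule extensionalityI[of _ "vertices p"])
    show "psi p b p \<in> extensional (vertices p)"
      by (simp add: psi_def)
    show "b \<in> extensional (vertices p)"
      using b by (simp add: ggs_b_def)
    show "psi p b p w = b w" if "w \<in> vertices p" for w
      using that p by (simp add: psi_def b_app)
  qed
  ultimately show ?R by blast
next
  assume R: ?R
  then have aut: "b \<in> tree_automorphisms p"
    by (simp add: level_stabilizer_def)
  have first: "b (i # w) = i # tl (b (i # w))" if "i # w \<in> vertices p" for i w
    using that
  proof (induction w rule: rev_induct)
    case Nil
    then have "b [i] = [i]"
      using R by (auto simp: level_stabilizer_def)
    then show ?case by simp
  next
    case (snoc x w)
    have v: "i # w \<in> vertices p" "i # w @ [x] \<in> vertices p"
      using snoc.prems by auto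
    have "incident (i # w) (i # w @ [x])"
      by (auto simp: incident_def)
    then have inc: "incident (b (i # w)) (b (i # w @ [x]))"
      using aut v unfolding tree_automorphisms_def by blast
    have "b (i # w @ [x]) \<noteq> []"
    proof
      assume *: "b (i # w @ [x]) = []"
      have "inj_on b (vertices p)"
        using aut by (auto simp: tree_automorphisms_def bij_betw_def)
      then have "i # w @ [x] = []"
        using * v tree_automorphism_root[OF aut] by (metis inj_onD vertices_Nil)
      then show False by simp
    qed
    then obtain j t where jt: "b (i # w @ [x]) = j # t"
      by (cases "b (i # w @ [x])") auto
    from inc snoc.IH[OF v(1)] jt have "incident (i # tl (b (i # w))) (j # t)"
      by metis
    then show ?case using jt by simp
  qed
  have eq: "b v = directed p e v" if "v \<in> vertices p" for v
    using that
  proof (induction v)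
    case Nil
    then show ?case using tree_automorphism_root[OF aut] by simp
  next
    case (Cons i w)
    then have w: "w \<in> vertices p" and i: "i \<in> {1..p}" by auto
    have "tl (b (i # w)) = psi p b i w"
      using w by (simp add: psi_def)
    also have "\<dots> = tl (directed p e (i # w))"
      using R i Cons.IH[OF w] by auto
    finally show ?case
      using first[OF Cons.prems] by simp
  qed
  have "b \<in> extensional (vertices p)"
    using aut by (simp add: tree_automorphisms_def)
  then show "b = ggs_b p e"
    using eq by (intro extensionalityI[of _ "vertices p"]) (auto simp: ggs_b_def)
qed

end

theory Submission
  imports Defs
begin

text \<open>
  An element \<open>x\<close> of a GGS-group \<open>G\<close> is described by its shift \<open>rho x\<close> of the first level, an
  integer modulo \<open>p\<close>, and by its \<open>p\<close> sections, which lie in \<open>G\<close> again. Coordinates on the first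
  level are integers modulo \<open>p\<close>, so a vector with entries in \<open>\<int>/p\<close> is an element of the group ring
  of a cyclic group of order \<open>p\<close>, which is the truncated polynomial ring in \<open>T = \<sigma> - 1\<close> for the
  shift \<open>\<sigma>\<close>. The order of vanishing at \<open>T = 0\<close> is read off from the moments \<open>\<Sum>k. k\<^sup>i v k\<close>
  (\<open>moment_shift_leading\<close>, \<open>moment_shift_subleading\<close>).

  Periodicity forces the entries of the defining vector \<open>e\<close> to sum to \<open>0\<close>: otherwise a section of
  \<open>(a\<^sup>t b)\<^sup>p\<close> is conjugate to another element of the same kind, and \<open>a b\<close> has infinite order
  (\<open>infinite_order\<close>). So the first non-zero moment of \<open>e\<close> has some degree \<open>deg > 0\<close>. For every \<open>x\<close>
  in \<open>G\<close> the vector of the shifts of its sections has vanishing moments below \<open>deg\<close>, and the moments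
  of degree \<open>deg\<close> and \<open>deg + 1\<close>, called \<open>beta x\<close> and \<open>gamma x\<close>, make \<open>x \<mapsto> (rho x, beta x, gamma x)\<close> a
  homomorphism onto a Heisenberg group modulo \<open>p\<close>. Its first two coordinates are those of the
  abelianization, with \<open>a\<close> and \<open>b\<close> on the two axes.

  The elements \<open>a\<close> and \<open>b\<close> have order \<open>p\<close>, and \<open>a b\<close> has order dividing \<open>p\<^sup>2\<close>. If \<open>rho x\<close> is non-zero,
  all sections of \<open>x\<^sup>p\<close> have shift \<open>0\<close> and the same \<open>beta\<close>, namely \<open>beta x\<close>. The vector of their values
  \<open>gamma\<close> has a leading moment \<open>theta\<close> that conjugation cannot change and that is a fixed non-zero
  multiple of \<open>(beta x)\<^sup>2 / rho x\<close> (\<open>p_power_flat\<close>, \<open>theta_conj\<close>). Comparing the linear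
  quantity \<open>beta x\<close> with this quadratic one shows that conjugates of \<open>\<langle>x\<^sup>p\<rangle>\<close> and of \<open>\<langle>y\<^sup>p\<rangle>\<close> meet
  trivially, modulo the stabilizer of level 3, when \<open>x\<close> and \<open>y\<close> have different slopes
  \<open>beta / rho\<close> (\<open>p_power_separation\<close>).

  One triple is always \<open>a\<close>, \<open>b\<close>, \<open>a b\<close>. For \<open>p \<ge> 5\<close> the second one consists of \<open>a b\<^sup>2\<close>, \<open>a b\<^sup>4\<close> and their
  product, of slopes 2, 4 and 3 in units of \<open>beta b\<close>. All six elements lie on different lines of
  the abelianization, so common elements could only be \<open>p\<close>-th powers, and slopes separate these.
  On level 2 the \<open>p\<close>-th powers of these elements act trivially.

  For \<open>p = 3\<close> there are only four lines and the triples must share two of them. With \<open>c = a b\<^sup>2\<close> the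
  second triple is \<open>c\<^sup>3 a\<close>, \<open>b\<^sup>2 c\<^sup>3\<close> and \<open>c\<^sup>7\<close>, and it generates since \<open>c\<close> is a power of \<open>c\<^sup>7\<close>.
  The elements \<open>c\<^sup>3 a\<close> and \<open>a\<close> share a line, but the first has a non-trivial cube on level 3; \<open>b\<^sup>2 c\<^sup>3\<close>
  and \<open>b\<close> share a line, but the values \<open>beta\<close> on their sections are distributed differently.
\<close>


section \<open>Moments of functions on the integers modulo a prime\<close>

definition mod_periodic :: "nat \<Rightarrow> (int \<Rightarrow> int) \<Rightarrow> bool" where
  "mod_periodic p v \<longleftrightarrow> (\<forall>k l. [k = l] (mod int p) \<longrightarrow> [v k = v l] (mod int p))"

definition moment :: "nat \<Rightarrow> nat \<Rightarrow> (int \<Rightarrow> int) \<Rightarrow> int" where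
  "moment p i v = (\<Sum>k\<in>{0..<int p}. k ^ i * v k)"

lemma mod_periodicD: "mod_periodic p v \<Longrightarrow> [k = l] (mod int p) \<Longrightarrow> [v k = v l] (mod int p)"
  by (simp add: mod_periodic_def)

lemma moment_cong:
  assumes "\<And>k. [v k = w k] (mod int p)"
  shows "[moment p i v = moment p i w] (mod int p)"
  unfolding moment_def by (intro cong_sum cong_mult cong_refl assms)

lemma moment_add: "moment p i (\<lambda>k. v k + w k) = moment p i v + moment p i w"
  by (simp add: moment_def sum.distrib distrib_left)

lemma moment_scale: "moment p i (\<lambda>k. c * v k) = c * moment p i v"
  by (simp add: moment_def sum_distrib_left mult_ac)

lemma moment_0: "moment p 0 v = (\<Sum>k\<in>{0..<int p}. v k)"
  by (simp add: moment_def)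

text \<open>An arithmetic progression whose step is prime to \<open>p\<close> runs through all residues. This computes
  sums along the orbits of an element that shifts the first level.\<close>

lemma affine_bij_mod:
  assumes "coprime s (int p)" "p > 0"
  shows "bij_betw (\<lambda>j. (k + j * s) mod int p) {0..<int p} {0..<int p}"
proof -
  have "inj_on (\<lambda>j. (k + j * s) mod int p) {0..<int p}"
  proof (rule inj_onI)
    fix i j assume ij: "i \<in> {0..<int p}" "j \<in> {0..<int p}" "(k + i * s) mod int p = (k + j * s) mod int p"
    then have "[k + i * s = k + j * s] (mod int p)"
      by (simp add: cong_def)
    then have "[i * s = j * s] (mod int p)"
      by (simp add: cong_add_lcancel)
    then have "[i = j] (mod int p)"
      using assms(1) by (simp add: cong_mult_rcancel)
    then show "i = j"
      using ij by (simp add: cong_def)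
  qed
  moreover have "(\<lambda>j. (k + j * s) mod int p) ` {0..<int p} \<subseteq> {0..<int p}"
    using assms(2) by auto
  ultimately show ?thesis
    by (simp add: bij_betw_def card_image card_subset_eq)
qed

lemma sum_affine:
  assumes "mod_periodic p v" "coprime s (int p)" "p > 0"
  shows "[(\<Sum>j\<in>{0..<int p}. v (k + j * s)) = (\<Sum>j\<in>{0..<int p}. v j)] (mod int p)"
proof -
  have "[(\<Sum>j\<in>{0..<int p}. v (k + j * s)) = (\<Sum>j\<in>{0..<int p}. v ((k + j * s) mod int p))] (mod int p)"
    by (intro cong_sum mod_periodicD[OF assms(1)]) (simp add: cong_def)
  also have "(\<Sum>j\<in>{0..<int p}. v ((k + j * s) mod int p)) = (\<Sum>j\<in>{0..<int p}. v j)"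
    by (rule sum.reindex_bij_betw[OF affine_bij_mod[OF assms(2,3)]])
  finally show ?thesis .
qed

lemma sum_shift:
  assumes "mod_periodic p v" "p > 0"
  shows "[(\<Sum>j\<in>{0..<int p}. v (j + r)) = (\<Sum>j\<in>{0..<int p}. v j)] (mod int p)"
  using sum_affine[of p v 1 r] assms by (simp add: add.commute)

lemma moment_shift_binomial:
  assumes v: "mod_periodic p v" and p: "p > 0"
  shows "[moment p n (\<lambda>k. v (k + r)) =
    (\<Sum>j\<le>n. int (n choose j) * (- r) ^ (n - j) * moment p j v)] (mod int p)"
proof -
  let ?f = "\<lambda>k. (k - r) ^ n * v k"
  have "mod_periodic p ?f"
    using v by (auto simp: mod_periodic_def intro!: cong_mult cong_pow cong_diff)
  from sum_shift[OF this p, of r]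
  have "[moment p n (\<lambda>k. v (k + r)) = (\<Sum>k\<in>{0..<int p}. ?f k)] (mod int p)"
    by (simp add: moment_def)
  also have "(\<Sum>k\<in>{0..<int p}. ?f k)
      = (\<Sum>k\<in>{0..<int p}. \<Sum>j\<le>n. int (n choose j) * (- r) ^ (n - j) * (k ^ j * v k))"
  proof (rule sum.cong[OF refl])
    fix k :: int
    have "(k - r) ^ n = (\<Sum>j\<le>n. int (n choose j) * k ^ j * (- r) ^ (n - j))"
      using binomial_ring[of k "- r" n] by simp
    then show "?f k = (\<Sum>j\<le>n. int (n choose j) * (- r) ^ (n - j) * (k ^ j * v k))"
      by (simp add: sum_distrib_left sum_distrib_right mult_ac)
  qed
  also have "\<dots> = (\<Sum>j\<le>n. int (n choose j) * (- r) ^ (n - j) * moment p j v)"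
    unfolding moment_def by (subst sum.swap) (simp add: sum_distrib_left)
  finally show ?thesis .
qed

lemma sum_cong_0:
  assumes "\<And>j. j \<in> A \<Longrightarrow> [f j = 0] (mod m)"
  shows "[(\<Sum>j\<in>A. c j * f j) = (0::int)] (mod m)"
proof -
  have "[(\<Sum>j\<in>A. c j * f j) = (\<Sum>j\<in>A. c j * 0)] (mod m)"
    by (intro cong_sum cong_mult cong_refl assms)
  then show ?thesis by simp
qed

text \<open>The shift acts on the moments by a unitriangular matrix: by the binomial formula the moment of
  degree \<open>n\<close> changes by multiples of the lower ones. So the first non-zero moment is invariant,
  and the next one changes by a multiple of it.\<close>

lemma moment_shift_leading:
  assumes v: "mod_periodic p v" and p: "p > 0" and z: "\<And>j. j < i \<Longrightarrow> [moment p j v = 0] (mod int p)"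
  shows "[moment p i (\<lambda>k. v (k + r)) = moment p i v] (mod int p)"
proof -
  let ?S = "\<Sum>j<i. int (i choose j) * (- r) ^ (i - j) * moment p j v"
  have "[moment p i (\<lambda>k. v (k + r)) = ?S + moment p i v] (mod int p)"
    using moment_shift_binomial[OF v p, of i r] by (simp add: lessThan_Suc_atMost[symmetric])
  also have "[?S + moment p i v = 0 + moment p i v] (mod int p)"
    by (intro cong_add cong_refl sum_cong_0 z) simp
  finally show ?thesis by simp
qed

lemma moment_shift_subleading:
  assumes v: "mod_periodic p v" and p: "p > 0" and z: "\<And>j. j < i \<Longrightarrow> [moment p j v = 0] (mod int p)"
  shows "[moment p (Suc i) (\<lambda>k. v (k + r)) = moment p (Suc i) v - int (Suc i) * r * moment p i v] (mod int p)"
proof -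
  let ?S = "\<Sum>j<i. int (Suc i choose j) * (- r) ^ (Suc i - j) * moment p j v"
  let ?T = "moment p (Suc i) v - int (Suc i) * r * moment p i v"
  have eq: "(\<Sum>j\<le>Suc i. int (Suc i choose j) * (- r) ^ (Suc i - j) * moment p j v) = ?S + ?T"
    by (simp add: lessThan_Suc_atMost[symmetric] del: binomial_Suc_Suc)
  have "[moment p (Suc i) (\<lambda>k. v (k + r)) = ?S + ?T] (mod int p)"
    using moment_shift_binomial[OF v p, of "Suc i" r] by (simp only: eq)
  also have "[?S + ?T = 0 + ?T] (mod int p)"
    by (intro cong_add cong_refl sum_cong_0 z) simp
  finally show ?thesis by simp
qed

lemma fermat_int:
  assumes "Factorial_Ring.prime p" "\<not> int p dvd x"
  shows "[x ^ (p - 1) = 1] (mod int p)"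
proof -
  define y where "y = nat (x mod int p)"
  have p: "p > 0" using assms(1) prime_gt_0_nat by blast
  have y: "int y = x mod int p"
    using p by (simp add: y_def)
  have "\<not> p dvd y"
    using assms(2) y by (metis dvd_mod_iff int_dvd_int_iff dvd_refl)
  then have "[y ^ (p - 1) = 1] (mod p)"
    using assms(1) by (rule fermat_theorem[rotated])
  then have "[int y ^ (p - 1) = 1] (mod int p)"
    using cong_int_iff[of "y ^ (p - 1)" 1 p] by simp
  moreover have "[int y = x] (mod int p)"
    by (simp add: y)
  ultimately show ?thesis
    by (meson cong_pow cong_sym cong_trans)
qed

text \<open>The indicator function of \<open>k\<^sub>0\<close> modulo \<open>p\<close> is the polynomial \<open>1 - (k - k\<^sub>0)\<^bsup>p-1\<^esup>\<close>, so
  the moments of degree at most \<open>p - 1\<close> determine a function. If only the last of them is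
  non-zero, the function is constant.\<close>

lemma moment_nonzero_exists:
  assumes p: "Factorial_Ring.prime p" and v: "mod_periodic p v"
    and v0: "v 0 = 0" and nz: "\<not> int p dvd v k"
  shows "\<exists>i \<le> p - 2. \<not> [moment p i v = 0] (mod int p)"
proof (rule ccontr)
  assume "\<not> ?thesis"
  then have z: "[moment p i v = 0] (mod int p)" if "i < p - 1" for i
    using that by auto
  have p2: "p \<ge> 2" using p prime_ge_2_nat by blast
  have const: "[v r = - moment p (p - 1) v] (mod int p)" for r
  proof -
    have 1: "[moment p (p - 1) (\<lambda>k. v (k + r)) = moment p (p - 1) v] (mod int p)"
      using moment_shift_leading[OF v] z p2 by simp
    have 2: "[moment p (p - 1) (\<lambda>k. v (k + r)) =
        (\<Sum>k\<in>{0..<int p}. v (k + r) - (if k = 0 then v r else 0))] (mod int p)"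
      unfolding moment_def
    proof (rule cong_sum)
      fix k assume k: "k \<in> {0..<int p}"
      show "[k ^ (p - 1) * v (k + r) = v (k + r) - (if k = 0 then v r else 0)] (mod int p)"
      proof (cases "k = 0")
        case True
        then show ?thesis using p2 by (simp add: power_0_left)
      next
        case False
        then have "\<not> int p dvd k"
          using k by (auto dest: zdvd_imp_le)
        then have "[k ^ (p - 1) * v (k + r) = 1 * v (k + r)] (mod int p)"
          by (intro cong_mult fermat_int p) auto
        then show ?thesis using False by simp
      qed
    qed
    have 3: "(\<Sum>k\<in>{0..<int p}. v (k + r) - (if k = 0 then v r else 0))
        = (\<Sum>k\<in>{0..<int p}. v (k + r)) - v r"
      using p2 by (simp add: sum_subtractf)
    have 4: "[(\<Sum>k\<in>{0..<int p}. v (k + r)) = 0] (mod int p)"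
      using cong_trans[OF sum_shift[OF v] z[of 0, unfolded moment_0]] p2 by simp
    have "[moment p (p - 1) v = (\<Sum>k\<in>{0..<int p}. v (k + r)) - v r] (mod int p)"
      using cong_trans[OF cong_sym[OF 1] 2] by (simp only: 3)
    from cong_trans[OF this cong_diff[OF 4 cong_refl]]
    have "[moment p (p - 1) v = - v r] (mod int p)"
      by simp
    then show ?thesis
      by (simp add: cong_iff_dvd_diff add.commute)
  qed
  have "[v k = v 0] (mod int p)"
    by (rule cong_trans[OF const cong_sym[OF const]])
  with nz v0 show False
    by (simp add: cong_0_iff)
qed

section \<open>Groups with sections\<close>

text \<open>The abstract form of a group acting on the \<open>p\<close>-adic tree by powers of the \<open>p\<close>-cycle at every
  vertex: \<open>x\<close> moves the vertex \<open>k\<close> of the first level to \<open>k + rho x\<close>, and acts as \<open>sec x k\<close> from the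
  subtree below \<open>k\<close> to the one below \<open>k + rho x\<close>. The vertices of the first level are indexed by
  integers modulo \<open>p\<close>, so that this addition needs no reduction.\<close>

locale group_with_sections = group G for G :: "('a, 'b) monoid_scheme" (structure) +
  fixes p :: nat and rho :: "'a \<Rightarrow> int" and sec :: "'a \<Rightarrow> int \<Rightarrow> 'a"
  assumes prime_p: "Factorial_Ring.prime p"
    and rho_mult: "\<lbrakk>x \<in> carrier G; y \<in> carrier G\<rbrakk> \<Longrightarrow> [rho (x \<otimes> y) = rho x + rho y] (mod int p)"
    and sec_closed [simp]: "x \<in> carrier G \<Longrightarrow> sec x k \<in> carrier G"
    and sec_mult: "\<lbrakk>x \<in> carrier G; y \<in> carrier G\<rbrakk> \<Longrightarrow> sec (x \<otimes> y) k = sec x k \<otimes> sec y (k + rho x)"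
    and sec_cong: "[k = l] (mod int p) \<Longrightarrow> sec x k = sec x l"
begin

lemma p_pos: "p > 0"
  using prime_p prime_gt_0_nat by blast

lemma coprime_p: "\<not> [s = 0] (mod int p) \<Longrightarrow> coprime s (int p)"
  using prime_p by (metis cong_0_iff coprime_commute prime_imp_coprime_int prime_int_nat_transfer
      prime_nat_int_transfer)

lemma cong_mult_0_iff: "[x * y = 0] (mod int p) \<longleftrightarrow> [x = 0] (mod int p) \<or> [y = 0] (mod int p)"
  using prime_p by (simp add: cong_0_iff prime_dvd_mult_iff)

lemma rho_one: "[rho \<one> = 0] (mod int p)"
proof -
  have "[rho \<one> + 0 = rho \<one> + rho \<one>] (mod int p)"
    using rho_mult[of \<one> \<one>] by simp
  then have "[0 = rho \<one>] (mod int p)"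
    by (simp only: cong_add_lcancel)
  then show ?thesis by (rule cong_sym)
qed

lemma sec_one [simp]: "sec \<one> k = \<one>"
proof -
  have "sec \<one> k = sec \<one> k \<otimes> sec \<one> (k + rho \<one>)"
    using sec_mult[of \<one> \<one> k] by simp
  moreover have "sec \<one> (k + rho \<one>) = sec \<one> k"
    using rho_one by (intro sec_cong) (metis add.right_neutral cong_add_lcancel)
  ultimately have "sec \<one> k \<otimes> sec \<one> k = sec \<one> k"
    by simp
  then show ?thesis
    using l_cancel_one by simp
qed

lemma rho_inv: "x \<in> carrier G \<Longrightarrow> [rho (inv x) = - rho x] (mod int p)"
proof -
  assume x: "x \<in> carrier G"
  have "[rho x + rho (inv x) = 0] (mod int p)"
    using cong_trans[OF cong_sym[OF rho_mult[OF x inv_closed[OF x]]]] rho_one x by simp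
  then have "[rho x + rho (inv x) - rho x = 0 - rho x] (mod int p)"
    by (rule cong_diff) simp
  then show ?thesis by simp
qed

lemma sec_inv: "x \<in> carrier G \<Longrightarrow> sec (inv x) (k + rho x) = inv (sec x k)"
proof -
  assume x: "x \<in> carrier G"
  have "sec x k \<otimes> sec (inv x) (k + rho x) = \<one>"
    using sec_mult[OF x inv_closed[OF x], of k] x by simp
  then show ?thesis
    using x by (metis inv_closed inv_equality inv_inv sec_closed)
qed

lemma rho_pow: "x \<in> carrier G \<Longrightarrow> [rho (x [^] (n::nat)) = int n * rho x] (mod int p)"
proof (induction n)
  case 0
  then show ?case using rho_one by simp
next
  case (Suc n)
  have "[rho (x [^] n \<otimes> x) = rho (x [^] n) + rho x] (mod int p)"
    using Suc.prems by (intro rho_mult) auto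
  also have "[rho (x [^] n) + rho x = int n * rho x + rho x] (mod int p)"
    using Suc by (intro cong_add) auto
  finally show ?case by (simp add: algebra_simps)
qed

lemma sec_shift_stab:
  assumes "x \<in> carrier G" "[rho x = 0] (mod int p)"
  shows "sec x (k + rho x) = sec x k" "sec y (k + rho x) = sec y k"
  using assms(2) by (metis add.right_neutral cong_add_lcancel sec_cong)+

lemma sec_mult_stab:
  assumes "x \<in> carrier G" "y \<in> carrier G" "[rho x = 0] (mod int p)"
  shows "sec (x \<otimes> y) k = sec x k \<otimes> sec y k"
  using sec_mult[OF assms(1,2), of k] sec_shift_stab[OF assms(1,3)] by simp

lemma sec_pow_stab:
  assumes "x \<in> carrier G" "[rho x = 0] (mod int p)"
  shows "sec (x [^] (n::nat)) k = sec x k [^] n"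
proof (induction n)
  case (Suc n)
  have "[rho (x [^] n) = 0] (mod int p)"
    using cong_trans[OF rho_pow[OF assms(1)] cong_mult[OF cong_refl assms(2)]] by simp
  then show ?case
    using Suc assms by (simp add: sec_mult_stab)
qed simp

text \<open>Conjugation by \<open>h\<close> shifts the coordinates of an element of the first level stabilizer and
  conjugates each of them.\<close>

lemma sec_conj:
  assumes "g \<in> carrier G" "h \<in> carrier G" "[rho g = 0] (mod int p)"
  shows "sec (inv h \<otimes> g \<otimes> h) (k + rho h) = inv (sec h k) \<otimes> sec g k \<otimes> sec h k"
    and "[rho (inv h \<otimes> g \<otimes> h) = 0] (mod int p)"
proof -
  have "sec (inv h \<otimes> g \<otimes> h) (k + rho h) = sec (inv h) (k + rho h) \<otimes> sec (g \<otimes> h) (k + rho h + rho (inv h))"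
    using assms by (simp add: m_assoc sec_mult)
  also have "sec (g \<otimes> h) (k + rho h + rho (inv h)) = sec (g \<otimes> h) k"
  proof (rule sec_cong)
    have "[k + rho h + rho (inv h) = k + rho h + - rho h] (mod int p)"
      using rho_inv[OF assms(2)] by (intro cong_add) auto
    then show "[k + rho h + rho (inv h) = k] (mod int p)" by simp
  qed
  finally show "sec (inv h \<otimes> g \<otimes> h) (k + rho h) = inv (sec h k) \<otimes> sec g k \<otimes> sec h k"
    using assms by (simp add: sec_inv sec_mult_stab m_assoc)
  have "[rho (inv h \<otimes> g \<otimes> h) = rho (inv h \<otimes> g) + rho h] (mod int p)"
    using assms by (intro rho_mult) auto
  also have "[rho (inv h \<otimes> g) + rho h = (rho (inv h) + rho g) + rho h] (mod int p)"
    using assms by (intro cong_add rho_mult) auto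
  also have "[(rho (inv h) + rho g) + rho h = (- rho h + 0) + rho h] (mod int p)"
    using assms by (intro cong_add rho_inv) auto
  finally show "[rho (inv h \<otimes> g \<otimes> h) = 0] (mod int p)" by simp
qed

text \<open>The section of \<open>x\<^sup>n\<close> at \<open>k\<close> is the product of the sections of \<open>x\<close> along the orbit of \<open>k\<close>, so an
  additive function turns it into a sum. The set \<open>S\<close> allows for functions that are additive on a
  submonoid only, as \<open>gamma\<close> below.\<close>

lemma orbit_sum:
  assumes x: "x \<in> carrier G" and S: "\<And>k. sec x k \<in> S" "\<one> \<in> S"
    and hom: "\<And>g h. \<lbrakk>g \<in> S; h \<in> S\<rbrakk> \<Longrightarrow> g \<otimes> h \<in> S \<and> [\<phi> (g \<otimes> h) = \<phi> g + \<phi> h] (mod int p)"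
  shows "sec (x [^] n) k \<in> S \<and>
    [\<phi> (sec (x [^] n) k) = (\<Sum>j<n. \<phi> (sec x (k + int j * rho x)))] (mod int p)"
proof (induction n)
  case 0
  have "[\<phi> \<one> + 0 = \<phi> \<one> + \<phi> \<one>] (mod int p)"
    using hom[OF S(2) S(2)] by simp
  then have "[0 = \<phi> \<one>] (mod int p)"
    by (simp only: cong_add_lcancel)
  then show ?case using S by (simp add: cong_sym)
next
  case (Suc n)
  have "sec (x [^] Suc n) k = sec (x [^] n) k \<otimes> sec x (k + rho (x [^] n))"
    using x by (simp add: sec_mult)
  also have "sec x (k + rho (x [^] n)) = sec x (k + int n * rho x)"
    using rho_pow[OF x] by (intro sec_cong cong_add) auto
  finally have eq: "sec (x [^] Suc n) k = sec (x [^] n) k \<otimes> sec x (k + int n * rho x)" .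
  have "[\<phi> (sec (x [^] n) k \<otimes> sec x (k + int n * rho x))
      = \<phi> (sec (x [^] n) k) + \<phi> (sec x (k + int n * rho x))] (mod int p)"
    using hom Suc.IH S(1) by blast
  also have "[\<phi> (sec (x [^] n) k) + \<phi> (sec x (k + int n * rho x))
      = (\<Sum>j<n. \<phi> (sec x (k + int j * rho x))) + \<phi> (sec x (k + int n * rho x))] (mod int p)"
    using Suc.IH by (intro cong_add) auto
  finally show ?case
    unfolding eq sum.lessThan_Suc using hom Suc.IH S(1) by blast
qed

lemma mod_periodic_sec: "mod_periodic p (\<lambda>k. f (sec x k))"
  unfolding mod_periodic_def using sec_cong cong_refl by metis

lemma sum_lessThan_int: "(\<Sum>j<n. f (int j)) = (\<Sum>j\<in>{0..<int n}. f j)"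
proof -
  have "(\<Sum>j\<in>{0..<int n}. f j) = (\<Sum>j\<in>int ` {0..<n}. f j)"
    by (simp add: image_int_atLeastLessThan)
  also have "\<dots> = (\<Sum>j<n. f (int j))"
    by (subst sum.reindex) (auto simp: atLeast0LessThan)
  finally show ?thesis by simp
qed

text \<open>If \<open>x\<close> moves the first level, the orbit is the whole level.\<close>

lemma orbit_sum_full:
  assumes x: "x \<in> carrier G" "\<not> [rho x = 0] (mod int p)" and S: "\<And>k. sec x k \<in> S" "\<one> \<in> S"
    and hom: "\<And>g h. \<lbrakk>g \<in> S; h \<in> S\<rbrakk> \<Longrightarrow> g \<otimes> h \<in> S \<and> [\<phi> (g \<otimes> h) = \<phi> g + \<phi> h] (mod int p)"
  shows "[\<phi> (sec (x [^] p) k) = (\<Sum>j\<in>{0..<int p}. \<phi> (sec x j))] (mod int p)"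
proof -
  have "[\<phi> (sec (x [^] p) k) = (\<Sum>j<p. \<phi> (sec x (k + int j * rho x)))] (mod int p)"
    using orbit_sum[where S=S] assms by blast
  also have "(\<Sum>j<p. \<phi> (sec x (k + int j * rho x))) = (\<Sum>j\<in>{0..<int p}. \<phi> (sec x (k + j * rho x)))"
    by (rule sum_lessThan_int)
  also have "[\<dots> = (\<Sum>j\<in>{0..<int p}. \<phi> (sec x j))] (mod int p)"
    by (rule sum_affine[OF mod_periodic_sec[of \<phi> x] coprime_p[OF x(2)] p_pos])
  finally show ?thesis .
qed

lemma orbit_sum_stab:
  assumes x: "x \<in> carrier G" "[rho x = 0] (mod int p)" and S: "\<And>k. sec x k \<in> S" "\<one> \<in> S"
    and hom: "\<And>g h. \<lbrakk>g \<in> S; h \<in> S\<rbrakk> \<Longrightarrow> g \<otimes> h \<in> S \<and> [\<phi> (g \<otimes> h) = \<phi> g + \<phi> h] (mod int p)"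
  shows "[\<phi> (sec (x [^] n) k) = int n * \<phi> (sec x k)] (mod int p)"
proof -
  have "sec x (k + int j * rho x) = sec x k" for j
    using cong_add[OF cong_refl cong_mult[OF cong_refl x(2)], of k "int j"] by (intro sec_cong) simp
  then show ?thesis
    using orbit_sum[of x S \<phi> n k] assms by simp
qed


subsection \<open>Level stabilizers\<close>

primrec St :: "nat \<Rightarrow> 'a set" where
  "St 0 = carrier G"
| "St (Suc n) = {x \<in> carrier G. [rho x = 0] (mod int p) \<and> (\<forall>k. sec x k \<in> St n)}"

lemma St_carrier: "x \<in> St n \<Longrightarrow> x \<in> carrier G"
  by (cases n) auto

lemma one_St: "\<one> \<in> St n"
  by (induction n) (auto simp: rho_one)

lemma St_Suc_subset: "St (Suc n) \<subseteq> St n"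
  by (induction n) auto

lemma St_antimono: "m \<le> n \<Longrightarrow> St n \<subseteq> St m"
  by (rule lift_Suc_antimono_le[of St]) (use St_Suc_subset in auto)

lemma St_mult: "\<lbrakk>x \<in> St n; y \<in> St n\<rbrakk> \<Longrightarrow> x \<otimes> y \<in> St n"
proof (induction n arbitrary: x y)
  case (Suc n)
  then have "[rho (x \<otimes> y) = 0 + 0] (mod int p)"
    by (intro cong_trans[OF rho_mult] cong_add) auto
  with Suc show ?case by (auto simp: sec_mult)
qed simp

lemma St_inv: "x \<in> St n \<Longrightarrow> inv x \<in> St n"
proof (induction n arbitrary: x)
  case (Suc n)
  then have x: "x \<in> carrier G" "[rho x = 0] (mod int p)" by auto
  have "[rho (inv x) = - 0] (mod int p)"
    using cong_trans[OF rho_inv[OF x(1)]] x(2) cong_minus_minus_iff by blast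
  moreover have "sec (inv x) k = inv (sec x k)" for k
    using sec_inv[OF x(1), of k] sec_shift_stab(2)[OF x] by simp
  ultimately show ?case using Suc x by simp
qed simp

lemma St_conj: "\<lbrakk>x \<in> St n; h \<in> carrier G\<rbrakk> \<Longrightarrow> inv h \<otimes> x \<otimes> h \<in> St n"
proof (induction n arbitrary: x h)
  case (Suc n)
  then have x: "x \<in> carrier G" "[rho x = 0] (mod int p)" by auto
  have "sec (inv h \<otimes> x \<otimes> h) k \<in> St n" for k
  proof -
    have "sec (inv h \<otimes> x \<otimes> h) k = inv (sec h (k - rho h)) \<otimes> sec x (k - rho h) \<otimes> sec h (k - rho h)"
      using sec_conj(1)[OF x(1) Suc.prems(2) x(2), of "k - rho h"] by simp
    then show ?thesis using Suc by auto
  qed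
  then show ?case using x Suc.prems sec_conj(2) by auto
qed simp

lemma St_normal: "St n \<lhd> G"
proof (rule normal_invI)
  show "subgroup (St n) G"
    by (rule subgroupI) (auto intro: St_carrier St_mult St_inv one_St)
  fix x h assume "x \<in> carrier G" "h \<in> St n"
  then show "x \<otimes> h \<otimes> inv x \<in> St n"
    using St_conj[of h n "inv x"] by simp
qed

text \<open>The coset of \<open>x\<close> modulo \<open>St (Suc n)\<close> is determined by \<open>rho x\<close> and by the cosets of
  the \<open>p\<close> sections modulo \<open>St n\<close>.\<close>

lemma finite_Mod_St: "finite (carrier (G Mod St n))"
proof (induction n)
  case 0
  interpret normal "St 0" G by (rule St_normal)
  have "carrier (G Mod St 0) \<subseteq> {St 0}"
    using coset_join2[OF _ is_subgroup] by (auto simp: carrier_FactGroup)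
  then show ?case by (rule finite_subset) simp
next
  case (Suc n)
  note N = St_normal[of n] and M = St_normal[of "Suc n"]
  define F where "F = (\<lambda>x. (rho x mod int p, \<lambda>k\<in>{0..<int p}. St n #> sec x k))"
  have "F ` carrier G \<subseteq> {0..<int p} \<times> (\<Pi>\<^sub>E k\<in>{0..<int p}. carrier (G Mod St n))"
    unfolding F_def using p_pos by (intro image_subsetI SigmaI) (simp_all add: carrier_FactGroup)
  moreover have "finite ({0..<int p} \<times> (\<Pi>\<^sub>E k\<in>{0..<int p}. carrier (G Mod St n)))"
    using Suc by (intro finite_cartesian_product finite_PiE) auto
  ultimately have fin: "finite (F ` carrier G)"
    by (rule finite_subset)
  have key: "St (Suc n) #> x = St (Suc n) #> y"
    if x: "x \<in> carrier G" and y: "y \<in> carrier G" and F: "F x = F y" for x y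
  proof -
    have r: "[rho x = rho y] (mod int p)"
      using F by (simp add: F_def cong_def)
    have s: "St n #> sec x k = St n #> sec y k" for k
    proof -
      have k: "k mod int p \<in> {0..<int p}" using p_pos by simp
      have "(\<lambda>k\<in>{0..<int p}. St n #> sec x k) = (\<lambda>k\<in>{0..<int p}. St n #> sec y k)"
        using F by (simp only: F_def prod.inject)
      from fun_cong[OF this, of "k mod int p"]
      have "St n #> sec x (k mod int p) = St n #> sec y (k mod int p)"
        by (simp only: restrict_apply'[OF k])
      moreover have "sec z (k mod int p) = sec z k" for z
        by (rule sec_cong) simp
      ultimately show ?thesis by simp
    qed
    have "[rho (x \<otimes> inv y) = rho y + - rho y] (mod int p)"
      using cong_trans[OF rho_mult[OF x inv_closed[OF y]] cong_add[OF r rho_inv[OF y]]] .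
    moreover have "sec (x \<otimes> inv y) k \<in> St n" for k
    proof -
      have "sec (inv y) (k + rho x) = sec (inv y) (k + rho y)"
        using r by (intro sec_cong cong_add) auto
      then have "sec (x \<otimes> inv y) k = sec x k \<otimes> inv (sec y k)"
        using sec_mult[OF x inv_closed[OF y], of k] sec_inv[OF y] by simp
      moreover have "sec x k \<in> St n #> sec y k"
        using rcos_self[OF sec_closed[OF x, of k] normal_imp_subgroup[OF N]] by (simp only: s)
      ultimately show ?thesis
        using x y subgroup.rcos_module_imp[OF normal_imp_subgroup[OF N] is_group] by simp
    qed
    ultimately have "x \<otimes> inv y \<in> St (Suc n)"
      using x y by simp
    then have "x \<in> St (Suc n) #> y"
      using subgroup.rcos_module_rev[OF normal_imp_subgroup[OF M] is_group y x] by blast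
    then show ?thesis
      using repr_independence[OF _ y normal_imp_subgroup[OF M]] by blast
  qed
  define c where "c = (\<lambda>f. St (Suc n) #> (SOME x. x \<in> carrier G \<and> F x = f))"
  have "St (Suc n) #> x = c (F x)" if "x \<in> carrier G" for x
  proof -
    have "(SOME y. y \<in> carrier G \<and> F y = F x) \<in> carrier G \<and> F (SOME y. y \<in> carrier G \<and> F y = F x) = F x"
      by (rule someI[of "\<lambda>y. y \<in> carrier G \<and> F y = F x" x]) (use that in simp)
    then show ?thesis
      unfolding c_def using key that by metis
  qed
  then have "carrier (G Mod St (Suc n)) \<subseteq> c ` F ` carrier G"
    unfolding carrier_FactGroup by blast
  then show ?case
    using fin by (meson finite_imageI finite_subset)
qed

end

section \<open>The generators and their orders\<close>

lemma (in group) conj_pow: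
  assumes "x \<in> carrier G" "h \<in> carrier G"
  shows "(inv h \<otimes> x \<otimes> h) [^] (n::nat) = inv h \<otimes> x [^] n \<otimes> h"
proof (induction n)
  case (Suc n)
  have "h \<otimes> (inv h \<otimes> (x \<otimes> h)) = x \<otimes> h"
    using assms by (simp add: m_assoc[symmetric])
  with Suc show ?case
    using assms by (simp add: m_assoc)
qed (use assms in simp)

text \<open>The vertex \<open>p\<close> of the first level, below which \<open>b\<close> acts as itself, has coordinate \<open>0\<close>. The value
  \<open>e 0 = 0\<close> makes \<open>e k\<close> the shift of \<open>sec b k\<close> for all \<open>k\<close>. Faithfulness of the action on the tree is
  the assumption \<open>separated\<close>.\<close>

locale ggs_sections = group_with_sections +
  fixes a b :: 'a and e :: "int \<Rightarrow> int"
  assumes separated: "\<lbrakk>x \<in> carrier G; \<And>n. x \<in> St n\<rbrakk> \<Longrightarrow> x = \<one>"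
    and a_closed [simp]: "a \<in> carrier G" and b_closed [simp]: "b \<in> carrier G"
    and generated: "generate G {a, b} = carrier G"
    and rho_a: "[rho a = 1] (mod int p)" and sec_a [simp]: "sec a k = \<one>"
    and rho_b: "[rho b = 0] (mod int p)"
    and sec_b: "sec b k = (if int p dvd k then b else a [^] e k)"
    and e_0: "e 0 = 0" and e_cong: "[k = l] (mod int p) \<Longrightarrow> e k = e l"
    and e_nonzero: "\<exists>k. \<not> int p dvd e k"
begin

lemma faithful:
  assumes x: "x \<in> carrier G" "[rho x = 0] (mod int p)" "\<And>k. sec x k = \<one>"
  shows "x = \<one>"
proof (rule separated[OF x(1)])
  show "x \<in> St n" for n
    using x by (cases n) (auto simp: one_St)
qed

lemma sec_a_pow [simp]: "sec (a [^] (n::nat)) k = \<one>"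
  by (induction n arbitrary: k) (simp_all add: sec_mult)

lemma rho_a_pow: "[rho (a [^] (n::nat)) = int n] (mod int p)"
  using cong_trans[OF rho_pow[OF a_closed] cong_mult[OF cong_refl rho_a]] by simp

lemma rho_b_pow: "[rho (b [^] (n::nat)) = 0] (mod int p)"
  using cong_trans[OF rho_pow[OF b_closed] cong_mult[OF cong_refl rho_b]] by simp

lemma a_order: "a [^] p = \<one>"
proof (rule faithful)
  show "[rho (a [^] p) = 0] (mod int p)"
    by (rule cong_trans[OF rho_a_pow]) (simp add: cong_def)
qed simp_all

lemma a_int_pow: "a [^] (z::int) = a [^] nat (z mod int p)"
proof -
  have z: "z = int p * (z div int p) + int (nat (z mod int p))"
    using p_pos by simp
  have "a [^] z = a [^] (int p * (z div int p)) \<otimes> a [^] int (nat (z mod int p))"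
    by (subst z, rule int_pow_mult) simp
  also have "a [^] (int p * (z div int p)) = (a [^] int p) [^] (z div int p)"
    by (rule int_pow_pow[symmetric]) simp
  also have "a [^] int p = \<one>"
    using a_order by (simp add: int_pow_int)
  finally show ?thesis
    by (simp add: int_pow_int)
qed

lemma a_int_pow_cong: "[y = z] (mod int p) \<Longrightarrow> a [^] y = a [^] (z::int)"
  using a_int_pow[of y] a_int_pow[of z] by (simp only: cong_def)

text \<open>One section of \<open>b\<^sup>p\<close> is \<open>b\<^sup>p\<close> itself, so that triviality cannot be read off from the sections in one
  step. It follows level by level.\<close>

lemma b_order: "b [^] p = \<one>"
proof (rule separated)
  show "b [^] p \<in> St n" for n
  proof (induction n)
    case (Suc n)
    have "sec (b [^] p) k \<in> St n" for k
    proof (cases "int p dvd k")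
      case True
      then show ?thesis using Suc by (simp add: sec_pow_stab rho_b sec_b)
    next
      case False
      have "(a [^] e k) [^] p = a [^] (e k * int p)"
        using int_pow_pow[OF a_closed, of "e k" "int p"] by (simp only: int_pow_int)
      also have "\<dots> = \<one>"
        using a_int_pow_cong[of "e k * int p" 0] by (simp add: cong_def)
      finally show ?thesis using False by (simp add: sec_pow_stab rho_b sec_b one_St)
    qed
    then show ?case using rho_b_pow by simp
  qed simp
qed simp

text \<open>As the generators have finite order, induction over products reaches their inverses too.\<close>

lemma carrier_induct [consumes 1, case_names one a b mult]:
  assumes "x \<in> carrier G" and one: "P \<one>" and a: "P a" and b: "P b"
    and mult: "\<And>x y. \<lbrakk>x \<in> carrier G; y \<in> carrier G; P x; P y\<rbrakk> \<Longrightarrow> P (x \<otimes> y)"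
  shows "P x"
proof -
  have pow: "P (y [^] (n::nat))" if "y \<in> carrier G" "P y" for y n
    using that by (induction n) (auto intro: one mult)
  have inverse: "inv y = y [^] (p - 1)" if "y \<in> carrier G" "y [^] p = \<one>" for y
  proof -
    have "y [^] (p - 1) \<otimes> y = \<one>"
      using that p_pos by (simp add: nat_pow_Suc[symmetric] del: nat_pow_Suc)
    then show ?thesis using that by (metis inv_equality nat_pow_closed)
  qed
  have "x \<in> generate G {a, b}"
    using assms(1) generated by simp
  then have "x \<in> carrier G \<and> P x"
  proof (induction rule: generate.induct)
    case (inv h)
    then show ?case
      using inverse[of h] pow[of h "p - 1"] a b a_order b_order
      by auto
  qed (auto intro: one a b mult)
  then show ?thesis ..
qed

text \<open>Commuting \<open>x\<close> with \<open>x\<^sup>p\<close> shows that the sections of \<open>x\<^sup>p\<close> along an orbit of \<open>x\<close> are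
  conjugate.\<close>

lemma sec_p_power_next:
  assumes x: "x \<in> carrier G"
  shows "sec x k \<otimes> sec (x [^] p) (k + rho x) = sec (x [^] p) k \<otimes> sec x k"
    and "[rho (x [^] p) = 0] (mod int p)"
proof -
  show r: "[rho (x [^] p) = 0] (mod int p)"
    using rho_pow[OF x, of p] by (simp add: cong_def)
  have "x \<otimes> x [^] p = x [^] p \<otimes> x"
    using x by (metis nat_pow_Suc nat_pow_Suc2)
  then have "sec (x \<otimes> x [^] p) k = sec (x [^] p \<otimes> x) k"
    by simp
  then show "sec x k \<otimes> sec (x [^] p) (k + rho x) = sec (x [^] p) k \<otimes> sec x k"
    using sec_mult_stab[OF _ x r] x by (simp add: sec_mult)
qed

lemma sec_p_power_order:
  assumes x: "x \<in> carrier G" "\<not> [rho x = 0] (mod int p)" and k: "sec (x [^] p) k [^] n = \<one>"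
  shows "sec (x [^] p) l [^] (n::nat) = \<one>"
proof -
  have step: "sec (x [^] p) (k + int j * rho x) [^] n = \<one>" for j
  proof (induction j)
    case (Suc j)
    let ?k = "k + int j * rho x"
    have "sec (x [^] p) (?k + rho x) = inv (sec x ?k) \<otimes> sec (x [^] p) ?k \<otimes> sec x ?k"
      using sec_p_power_next(1)[OF x(1), of ?k] x(1)
      by (metis inv_solve_left m_assoc inv_closed m_closed nat_pow_closed sec_closed)
    with Suc x(1) show ?case
      by (simp add: conj_pow algebra_simps)
  qed (use k in simp)
  have "l mod int p \<in> (\<lambda>j. (k + j * rho x) mod int p) ` {0..<int p}"
    using affine_bij_mod[OF coprime_p[OF x(2)] p_pos, of k] p_pos by (simp add: bij_betw_def)
  then obtain j where j: "j \<in> {0..<int p}" "[l = k + j * rho x] (mod int p)"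
    by (auto simp: cong_def)
  have "sec (x [^] p) l = sec (x [^] p) (k + int (nat j) * rho x)"
    using j by (intro sec_cong) simp
  then show ?thesis using step[of "nat j"] by (simp only:)
qed

text \<open>Starting at the coordinate where the section of \<open>a\<^sup>t b\<^sup>u\<close> is \<open>b\<^sup>u\<close>, the orbit meets every
  power \<open>a\<^bsup>u e k\<^esup>\<close> once.\<close>

lemma sec_p_power_generators:
  fixes t u :: nat
  assumes t: "\<not> p dvd t"
  defines "x \<equiv> a [^] t \<otimes> b [^] u"
  shows "sec (x [^] p) (- int t) = b [^] u \<otimes> a [^] (int u * (\<Sum>j\<in>{0..<int p}. e j))"
proof -
  have x: "x \<in> carrier G" by (simp add: x_def)
  have rx: "[rho x = int t] (mod int p)"
    using cong_trans[OF rho_mult cong_add[OF rho_a_pow rho_b_pow], of t u] by (simp add: x_def)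
  have sx: "sec x k = sec b (k + int t) [^] u" for k
  proof -
    have "sec (b [^] u) (k + rho (a [^] t)) = sec (b [^] u) (k + int t)"
      using rho_a_pow by (intro sec_cong cong_add) auto
    then show ?thesis
      by (simp add: x_def sec_mult sec_pow_stab rho_b)
  qed
  have "sec (x [^] Suc n) (- int t) = b [^] u \<otimes> a [^] (int u * (\<Sum>j\<in>{1..n}. e (int j * int t)))"
    if "n < p" for n
    using that
  proof (induction n)
    case 0
    then show ?case using sx[of "- int t"] x by (simp add: sec_b)
  next
    case (Suc n)
    have "\<not> p dvd Suc n * t"
      using t Suc.prems prime_dvd_mult_iff[OF prime_p, of "Suc n" t] nat_dvd_not_less[of "Suc n" p]
      by (simp del: mult_Suc)
    then have nd: "\<not> int p dvd int (Suc n) * int t"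
      by (metis int_dvd_int_iff of_nat_mult)
    have "sec (x [^] Suc (Suc n)) (- int t)
        = sec (x [^] Suc n) (- int t) \<otimes> sec x (- int t + rho (x [^] Suc n))"
      using x by (simp only: nat_pow_Suc sec_mult m_closed nat_pow_closed)
    also have "sec x (- int t + rho (x [^] Suc n)) = sec x (- int t + int (Suc n) * int t)"
      by (intro sec_cong cong_add cong_refl cong_trans[OF rho_pow[OF x]] cong_mult rx)
    also have "\<dots> = (a [^] e (int (Suc n) * int t)) [^] u"
      using nd by (simp only: sx sec_b) simp
    also have "\<dots> = a [^] (int u * e (int (Suc n) * int t))"
      using int_pow_pow[OF a_closed, of _ "int u"] by (simp only: int_pow_int mult.commute)
    finally show ?case
      using Suc by (simp add: m_assoc int_pow_mult distrib_left)
  qed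
  from this[of "p - 1"]
  have "sec (x [^] p) (- int t) = b [^] u \<otimes> a [^] (int u * (\<Sum>j\<in>{1..p - 1}. e (int j * int t)))"
    using p_pos by simp
  also have "(\<Sum>j\<in>{1..p - 1}. e (int j * int t)) = (\<Sum>j<p. e (int j * int t))"
    by (rule sum.mono_neutral_left) (use e_0 in \<open>auto simp: not_le Suc_le_eq\<close>)
  also have "a [^] (int u * (\<Sum>j<p. e (int j * int t))) = a [^] (int u * (\<Sum>j\<in>{0..<int p}. e j))"
  proof (rule a_int_pow_cong, rule cong_mult[OF cong_refl])
    have "coprime (int t) (int p)"
      using t coprime_p[of "int t"] by (simp add: cong_0_iff)
    moreover have "mod_periodic p e"
      unfolding mod_periodic_def using e_cong cong_refl by metis
    ultimately show "[(\<Sum>j<p. e (int j * int t)) = (\<Sum>j\<in>{0..<int p}. e j)] (mod int p)"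
      using sum_affine[of p e "int t" 0] p_pos by (simp add: sum_lessThan_int[where f = "\<lambda>j. e (j * int t)"])
  qed
  finally show ?thesis .
qed

text \<open>If \<open>\<sigma>\<close> is the sum of the \<open>e k\<close>, then \<open>(a\<^sup>t b)\<^sup>p\<close> has a section conjugate to
  \<open>a\<^sup>\<sigma> b\<close>. So if \<open>\<sigma>\<close> is non-zero, a relation \<open>(a\<^sup>t b)\<^sup>K = 1\<close> would lead to ever
  shorter ones.\<close>

lemma infinite_order:
  assumes sum: "\<not> [(\<Sum>j\<in>{0..<int p}. e j) = 0] (mod int p)"
    and "\<not> p dvd t" "K > 0"
  shows "(a [^] t \<otimes> b) [^] (K::nat) \<noteq> \<one>"
  using assms(2,3)
proof (induction K arbitrary: t rule: less_induct)
  case (less K)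
  let ?x = "a [^] t \<otimes> b"
  show ?case
  proof
    assume K: "?x [^] K = \<one>"
    have rx: "[rho ?x = int t] (mod int p)"
      using cong_trans[OF rho_mult cong_add[OF rho_a_pow rho_b], of t] by simp
    have "[int K * int t = int K * rho ?x] (mod int p)"
      using rx by (intro cong_mult) (auto intro: cong_sym)
    also have "[int K * rho ?x = rho (?x [^] K)] (mod int p)"
      by (rule cong_sym[OF rho_pow]) simp
    also have "[rho (?x [^] K) = 0] (mod int p)"
      using K rho_one by simp
    finally have "p dvd K * t"
      by (simp add: cong_0_iff) (metis int_dvd_int_iff of_nat_mult)
    then have "p dvd K"
      using less.prems prime_p prime_dvd_mult_iff by blast
    then obtain L where L: "K = p * L" ..
    define s where "s = nat ((\<Sum>j\<in>{0..<int p}. e j) mod int p)"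
    have s: "\<not> p dvd s"
    proof
      assume "p dvd s"
      moreover have "s < p" using p_pos by (simp add: s_def nat_less_iff)
      ultimately have "s = 0" using nat_dvd_not_less by blast
      then have "(\<Sum>j\<in>{0..<int p}. e j) mod int p = 0"
        using p_pos pos_mod_sign[of "int p" "\<Sum>j\<in>{0..<int p}. e j"]
        by (metis nat_0_iff of_nat_0_less_iff order_antisym s_def)
      then show False using sum by (simp add: cong_def)
    qed
    have "sec (?x [^] p) (- int t) = b \<otimes> a [^] s"
      using sec_p_power_generators[OF less.prems(1), of 1] a_int_pow by (simp add: s_def)
    moreover have "sec ((?x [^] p) [^] L) (- int t) = sec (?x [^] p) (- int t) [^] L"
      by (intro sec_pow_stab sec_p_power_next) auto
    moreover have "(?x [^] p) [^] L = \<one>"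
      using K L by (simp add: nat_pow_pow)
    ultimately have 1: "(b \<otimes> a [^] s) [^] L = \<one>"
      by simp
    have "inv (a [^] s) \<otimes> (a [^] s \<otimes> b) \<otimes> a [^] s = b \<otimes> a [^] s"
      by (simp add: m_assoc[symmetric])
    then have "inv (a [^] s) \<otimes> (a [^] s \<otimes> b) [^] L \<otimes> a [^] s = \<one>"
      using 1 conj_pow[of "a [^] s \<otimes> b" "a [^] s" L] by simp
    then have "(a [^] s \<otimes> b) [^] L = \<one>"
      by (metis a_closed b_closed inv_closed inv_equality inv_inv m_assoc m_closed nat_pow_closed r_inv r_one)
    moreover have "L < K" "L > 0"
      using L less.prems(2) prime_gt_1_nat[OF prime_p] by auto
    ultimately show False using less.IH s by blast
  qed
qed

lemma periodic_imp_sum_0: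
  assumes "\<And>x. x \<in> carrier G \<Longrightarrow> \<exists>k::nat. k > 0 \<and> x [^] k = \<one>"
  shows "[(\<Sum>j\<in>{0..<int p}. e j) = 0] (mod int p)"
  using infinite_order[of 1] assms[of "a \<otimes> b"] prime_gt_1_nat[OF prime_p] by fastforce

end

section \<open>A quotient of Heisenberg type\<close>

text \<open>Taking differences along the shift by \<open>s\<close> lowers the order of vanishing by one. Conversely, if the
  first \<open>d\<close> moments of the difference \<open>w\<close> vanish, then the first \<open>d - 1\<close> moments of \<open>v\<close> do, and the next
  one is determined by \<open>w\<close>. The condition \<open>d < p\<close> makes the factors \<open>1, \<dots>, d\<close> invertible.\<close>

lemma moment_of_difference:
  assumes p: "Factorial_Ring.prime p" and v: "mod_periodic p v" and s: "\<not> [s = 0] (mod int p)"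
    and diff: "\<And>k. [v (k + s) = v k + w k] (mod int p)"
    and w: "\<And>i. i < d \<Longrightarrow> [moment p i w = 0] (mod int p)" and d: "0 < d" "d < p"
  shows "\<And>j. j < d - 1 \<Longrightarrow> [moment p j v = 0] (mod int p)"
    and "[- (int d * s * moment p (d - 1) v) = moment p d w] (mod int p)"
proof -
  have p0: "p > 0" using d by simp
  have step: "[- (int (Suc j) * s * moment p j v) = moment p (Suc j) w] (mod int p)"
    if "\<And>i. i < j \<Longrightarrow> [moment p i v = 0] (mod int p)" for j
  proof -
    have "[moment p (Suc j) (\<lambda>k. v (k + s)) = moment p (Suc j) v - int (Suc j) * s * moment p j v] (mod int p)"
      by (rule moment_shift_subleading[OF v p0 that])
    moreover have "[moment p (Suc j) (\<lambda>k. v (k + s)) = moment p (Suc j) v + moment p (Suc j) w] (mod int p)"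
      using moment_cong[where v = "\<lambda>k. v (k + s)" and w = "\<lambda>k. v k + w k"] diff
      by (simp add: moment_add)
    ultimately have "[moment p (Suc j) v - int (Suc j) * s * moment p j v
        = moment p (Suc j) v + moment p (Suc j) w] (mod int p)"
      using cong_trans cong_sym by blast
    then show ?thesis
      by (metis cong_add_lcancel add_uminus_conv_diff)
  qed
  show zero: "[moment p j v = 0] (mod int p)" if "j < d - 1" for j
    using that
  proof (induction j rule: less_induct)
    case (less j)
    then have "[- (int (Suc j) * s * moment p j v) = moment p (Suc j) w] (mod int p)"
      by (intro step) auto
    also have "[moment p (Suc j) w = 0] (mod int p)"
      using less.prems by (intro w) simp
    finally have "int p dvd int (Suc j) * s * moment p j v"
      by (simp only: cong_0_iff dvd_minus_iff)
    moreover have "\<not> int p dvd int (Suc j)"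
      using less.prems d(2) by (intro zdvd_not_zless) auto
    ultimately show ?case
      using p s by (simp only: cong_0_iff prime_dvd_mult_iff prime_int_nat_transfer[symmetric] prime_nat_int_transfer) simp
  qed
  show "[- (int d * s * moment p (d - 1) v) = moment p d w] (mod int p)"
    using step[of "d - 1"] zero d(1) by simp
qed

locale zero_sum_ggs_sections = ggs_sections +
  assumes e_sum: "[(\<Sum>j\<in>{0..<int p}. e j) = 0] (mod int p)"
begin

text \<open>The vectors of shifts \<open>k \<mapsto> rho (sec x k)\<close> of all \<open>x\<close> span the ideal generated by \<open>e\<close> in the group ring
  of \<open>\<int>/p\<close> over \<open>\<int>/p\<close>, and \<open>deg\<close> is the order of vanishing of \<open>e\<close>.\<close>

definition deg :: nat where
  "deg = (LEAST i. \<not> [moment p i e = 0] (mod int p))"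

definition beta :: "'a \<Rightarrow> int" where
  "beta x = moment p deg (\<lambda>k. rho (sec x k))"

definition gamma :: "'a \<Rightarrow> int" where
  "gamma x = moment p (Suc deg) (\<lambda>k. rho (sec x k))"

lemma moment_e_lt_deg: "i < deg \<Longrightarrow> [moment p i e = 0] (mod int p)"
  unfolding deg_def using not_less_Least by blast

lemma deg_bounds: "\<not> [moment p deg e = 0] (mod int p)" "0 < deg" "Suc deg < p"
proof -
  obtain k where "\<not> int p dvd e k" using e_nonzero ..
  moreover have "mod_periodic p e"
    unfolding mod_periodic_def using e_cong cong_refl by metis
  ultimately obtain i where i: "i \<le> p - 2" "\<not> [moment p i e = 0] (mod int p)"
    using moment_nonzero_exists[where v = e, OF prime_p _ e_0] by blast
  then show nz: "\<not> [moment p deg e = 0] (mod int p)"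
    unfolding deg_def by (metis (mono_tags, lifting) LeastI)
  have "deg \<noteq> 0"
  proof
    assume "deg = 0"
    then have "moment p deg e = (\<Sum>j\<in>{0..<int p}. e j)"
      by (simp only: moment_0)
    with nz e_sum show False by simp
  qed
  then show "0 < deg" by simp
  have "deg \<le> i"
    unfolding deg_def using i(2) by (rule Least_le)
  with i \<open>0 < deg\<close> show "Suc deg < p" by simp
qed

lemma rho_a_int_pow: "[rho (a [^] (z::int)) = z] (mod int p)"
proof -
  have "[rho (a [^] nat (z mod int p)) = int (nat (z mod int p))] (mod int p)"
    by (rule rho_a_pow)
  then show ?thesis
    using p_pos by (simp only: a_int_pow[of z]) (simp add: cong_def)
qed

lemma rho_sec_b: "[rho (sec b k) = e k] (mod int p)"
proof (cases "int p dvd k")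
  case True
  then have "e k = 0"
    using e_cong[of k 0] e_0 by (simp add: cong_0_iff)
  then show ?thesis using True rho_b by (simp add: sec_b)
next
  case False
  then show ?thesis using rho_a_int_pow by (simp add: sec_b)
qed

lemma rho_sec_mult:
  "\<lbrakk>x \<in> carrier G; y \<in> carrier G\<rbrakk> \<Longrightarrow>
    [rho (sec (x \<otimes> y) k) = rho (sec x k) + rho (sec y (k + rho x))] (mod int p)"
  by (simp add: sec_mult rho_mult)

lemma moment_rho_sec_mult:
  assumes "x \<in> carrier G" "y \<in> carrier G"
  shows "[moment p i (\<lambda>k. rho (sec (x \<otimes> y) k)) =
    moment p i (\<lambda>k. rho (sec x k)) + moment p i (\<lambda>k. rho (sec y (k + rho x)))] (mod int p)"
  unfolding moment_add[symmetric] by (rule moment_cong) (rule rho_sec_mult[OF assms])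

lemma moment_zero: "(\<And>k. [v k = 0] (mod int p)) \<Longrightarrow> [moment p i v = 0] (mod int p)"
  using moment_cong[of v "\<lambda>k. 0" p i] by (simp add: moment_def)

text \<open>Vectors with vanishing moments below \<open>deg\<close> are closed under shifts and sums, and the vectors of
  the generators are \<open>0\<close> and \<open>e\<close>.\<close>

lemma moment_rho_sec_lt_deg:
  "x \<in> carrier G \<Longrightarrow> i < deg \<Longrightarrow> [moment p i (\<lambda>k. rho (sec x k)) = 0] (mod int p)"
proof (induction arbitrary: i rule: carrier_induct)
  case (mult x y)
  have "[moment p i (\<lambda>k. rho (sec y (k + rho x))) = moment p i (\<lambda>k. rho (sec y k))] (mod int p)"
    using mult by (intro moment_shift_leading mod_periodic_sec p_pos) auto
  then have "[moment p i (\<lambda>k. rho (sec x k)) + moment p i (\<lambda>k. rho (sec y (k + rho x))) = 0 + 0] (mod int p)"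
    using mult by (intro cong_add) (auto intro: cong_trans)
  then show ?case
    using moment_rho_sec_mult[OF mult.hyps(1,2), of i] by (auto intro: cong_trans)
next
  case b
  have "[moment p i (\<lambda>k. rho (sec b k)) = moment p i e] (mod int p)"
    by (rule moment_cong) (rule rho_sec_b)
  then show ?case
    using moment_e_lt_deg[OF b] by (rule cong_trans)
qed (auto intro!: moment_zero simp: rho_one)

lemma beta_mult:
  assumes "x \<in> carrier G" "y \<in> carrier G"
  shows "[beta (x \<otimes> y) = beta x + beta y] (mod int p)"
proof -
  have "[moment p deg (\<lambda>k. rho (sec y (k + rho x))) = beta y] (mod int p)"
    unfolding beta_def using assms
    by (intro moment_shift_leading mod_periodic_sec p_pos moment_rho_sec_lt_deg) auto
  then show ?thesis
    using cong_trans[OF moment_rho_sec_mult[OF assms] cong_add[OF cong_refl]]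
    by (simp add: beta_def)
qed

text \<open>Together with the additivity of \<open>rho\<close> and \<open>beta\<close>, this is the multiplication of a Heisenberg
  group modulo \<open>p\<close>. It is non-abelian since \<open>deg + 1 < p\<close>.\<close>

lemma gamma_mult:
  assumes "x \<in> carrier G" "y \<in> carrier G"
  shows "[gamma (x \<otimes> y) = gamma x + gamma y - int (Suc deg) * rho x * beta y] (mod int p)"
proof -
  have "[moment p (Suc deg) (\<lambda>k. rho (sec y (k + rho x))) = gamma y - int (Suc deg) * rho x * beta y] (mod int p)"
    unfolding beta_def gamma_def using assms
    by (intro moment_shift_subleading mod_periodic_sec p_pos moment_rho_sec_lt_deg) auto
  from cong_trans[OF moment_rho_sec_mult[OF assms] cong_add[OF cong_refl this]]
  show ?thesis
    by (simp only: gamma_def add_diff_eq)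
qed

lemma beta_one: "[beta \<one> = 0] (mod int p)"
  unfolding beta_def by (rule moment_zero) (simp add: rho_one)

lemma gamma_one: "[gamma \<one> = 0] (mod int p)"
  unfolding gamma_def by (rule moment_zero) (simp add: rho_one)

lemma beta_a: "[beta a = 0] (mod int p)"
  unfolding beta_def by (rule moment_zero) (simp add: rho_one)

lemma beta_b: "\<not> [beta b = 0] (mod int p)"
proof
  assume "[beta b = 0] (mod int p)"
  moreover have "[moment p deg e = beta b] (mod int p)"
    unfolding beta_def by (rule moment_cong) (rule cong_sym[OF rho_sec_b])
  ultimately show False
    using deg_bounds(1) cong_trans by blast
qed

lemma beta_pow: "x \<in> carrier G \<Longrightarrow> [beta (x [^] (n::nat)) = int n * beta x] (mod int p)"
proof (induction n)
  case 0
  then show ?case using beta_one by simp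
next
  case (Suc n)
  have "[beta (x [^] n \<otimes> x) = beta (x [^] n) + beta x] (mod int p)"
    using Suc.prems by (intro beta_mult) auto
  also have "[beta (x [^] n) + beta x = int n * beta x + beta x] (mod int p)"
    using Suc by (intro cong_add) auto
  finally show ?case by (simp add: algebra_simps)
qed

lemma beta_sec_b: "[beta (sec b k) = (if int p dvd k then beta b else 0)] (mod int p)"
proof (cases "int p dvd k")
  case False
  have "[beta (a [^] nat (e k mod int p)) = int (nat (e k mod int p)) * 0] (mod int p)"
    using beta_a by (intro cong_trans[OF beta_pow] cong_mult) auto
  moreover have "sec b k = a [^] nat (e k mod int p)"
    using False by (simp only: sec_b if_False a_int_pow[of "e k"])
  ultimately show ?thesis using False by simp
qed (simp add: sec_b)

text \<open>Both sides are homomorphisms to \<open>\<int>/p\<close> that agree on \<open>a\<close> and on \<open>b\<close>, whose only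
  section with non-zero \<open>beta\<close> is \<open>b\<close> itself.\<close>

lemma sum_beta_sec: "x \<in> carrier G \<Longrightarrow> [(\<Sum>k\<in>{0..<int p}. beta (sec x k)) = beta x] (mod int p)"
proof (induction rule: carrier_induct)
  case one
  have "[(\<Sum>k\<in>{0..<int p}. beta (sec \<one> k)) = (\<Sum>k\<in>{0..<int p}. 0)] (mod int p)"
    by (intro cong_sum) (simp add: beta_one)
  then show ?case using beta_one by (auto intro: cong_trans cong_sym)
next
  case a
  have "[(\<Sum>k\<in>{0..<int p}. beta (sec a k)) = (\<Sum>k\<in>{0..<int p}. 0)] (mod int p)"
    by (intro cong_sum) (simp add: beta_one)
  then show ?case using beta_a by (auto intro: cong_trans cong_sym)
next
  case b
  have "[beta (sec b k) = (if k = 0 then beta b else 0)] (mod int p)" if "k \<in> {0..<int p}" for k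
  proof -
    have "int p dvd k \<longleftrightarrow> k = 0" using that by (auto dest: zdvd_imp_le)
    then show ?thesis using beta_sec_b[of k] by simp
  qed
  then have "[(\<Sum>k\<in>{0..<int p}. beta (sec b k)) = (\<Sum>k\<in>{0..<int p}. if k = 0 then beta b else 0)] (mod int p)"
    by (rule cong_sum)
  then show ?case using p_pos by simp
next
  case (mult x y)
  have "[(\<Sum>k\<in>{0..<int p}. beta (sec (x \<otimes> y) k)) =
      (\<Sum>k\<in>{0..<int p}. beta (sec x k) + beta (sec y (k + rho x)))] (mod int p)"
    using mult by (intro cong_sum) (simp add: sec_mult beta_mult)
  also have "(\<Sum>k\<in>{0..<int p}. beta (sec x k) + beta (sec y (k + rho x)))
      = (\<Sum>k\<in>{0..<int p}. beta (sec x k)) + (\<Sum>k\<in>{0..<int p}. beta (sec y (k + rho x)))"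
    by (rule sum.distrib)
  also have "[\<dots> = beta x + beta y] (mod int p)"
    by (intro cong_add mult cong_trans[OF sum_shift[OF mod_periodic_sec[of beta y] p_pos]])
  also have "[beta x + beta y = beta (x \<otimes> y)] (mod int p)"
    using mult by (intro cong_sym[OF beta_mult])
  finally show ?case .
qed

lemma additive_conj:
  assumes "\<And>x y. \<lbrakk>x \<in> carrier G; y \<in> carrier G\<rbrakk> \<Longrightarrow> [\<phi> (x \<otimes> y) = \<phi> x + \<phi> y] (mod int p)"
    and x: "x \<in> carrier G" and h: "h \<in> carrier G"
  shows "[\<phi> (inv h \<otimes> x \<otimes> h) = \<phi> x] (mod int p)"
proof -
  have "h \<otimes> (inv h \<otimes> x \<otimes> h) = x \<otimes> h"
    using x h by (simp add: m_assoc[symmetric])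
  then have "[\<phi> h + \<phi> (inv h \<otimes> x \<otimes> h) = \<phi> x + \<phi> h] (mod int p)"
    using assms(1)[of h "inv h \<otimes> x \<otimes> h"] assms(1)[OF x h] x h
    by (metis cong_sym cong_trans inv_closed m_closed)
  then show ?thesis
    by (metis add.commute cong_add_lcancel)
qed

lemma gamma_conj:
  assumes x: "x \<in> carrier G" and h: "h \<in> carrier G" and r: "[rho x = 0] (mod int p)"
  shows "[gamma (inv h \<otimes> x \<otimes> h) = gamma x + int (Suc deg) * rho h * beta x] (mod int p)"
proof -
  let ?c = "inv h \<otimes> x \<otimes> h" and ?d = "int (Suc deg)"
  have c: "?c \<in> carrier G" using x h by simp
  have eq: "h \<otimes> ?c = x \<otimes> h"
    using x h by (simp add: m_assoc[symmetric])
  have "[gamma h + gamma ?c - ?d * rho h * beta ?c = gamma (h \<otimes> ?c)] (mod int p)"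
    by (rule cong_sym[OF gamma_mult[OF h c]])
  also have "[gamma (h \<otimes> ?c) = gamma x + gamma h - ?d * rho x * beta h] (mod int p)"
    unfolding eq by (rule gamma_mult[OF x h])
  also have "[gamma x + gamma h - ?d * rho x * beta h = gamma x + gamma h - ?d * 0 * beta h] (mod int p)"
    by (intro cong_diff cong_mult cong_refl r)
  finally have 1: "[gamma h + gamma ?c - ?d * rho h * beta ?c = gamma x + gamma h] (mod int p)"
    by simp
  have "[?d * rho h * beta ?c = ?d * rho h * beta x] (mod int p)"
    by (intro cong_mult cong_refl additive_conj beta_mult x h)
  from cong_add[OF 1 cong_diff[OF this cong_refl[of "gamma h"]]] show ?thesis
    by (simp add: algebra_simps)
qed

lemma gamma_mult_stab:
  assumes "x \<in> carrier G" "y \<in> carrier G" "[rho x = 0] (mod int p)"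
  shows "[gamma (x \<otimes> y) = gamma x + gamma y] (mod int p)"
proof -
  have "[gamma x + gamma y - int (Suc deg) * rho x * beta y = gamma x + gamma y - int (Suc deg) * 0 * beta y] (mod int p)"
    by (intro cong_diff cong_mult cong_refl assms)
  then show ?thesis
    using cong_trans[OF gamma_mult[OF assms(1,2)]] by simp
qed

lemma gamma_additive_stab:
  assumes "g \<in> {x \<in> carrier G. [rho x = 0] (mod int p)}" "h \<in> {x \<in> carrier G. [rho x = 0] (mod int p)}"
  shows "g \<otimes> h \<in> {x \<in> carrier G. [rho x = 0] (mod int p)} \<and>
    [gamma (g \<otimes> h) = gamma g + gamma h] (mod int p)"
proof -
  have "[rho (g \<otimes> h) = 0 + 0] (mod int p)"
    using assms by (intro cong_trans[OF rho_mult] cong_add) auto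
  then show ?thesis using assms gamma_mult_stab by auto
qed

lemma St_2_trivial:
  assumes "z \<in> St 2"
  shows "[rho z = 0] (mod int p)" "[beta z = 0] (mod int p)" "[gamma z = 0] (mod int p)"
proof -
  have z: "z \<in> carrier G" "[rho z = 0] (mod int p)" "\<And>k. [rho (sec z k) = 0] (mod int p)"
    using assms by (auto simp: numeral_2_eq_2)
  then show "[rho z = 0] (mod int p)" "[beta z = 0] (mod int p)" "[gamma z = 0] (mod int p)"
    unfolding beta_def gamma_def by (auto intro: moment_zero)
qed

text \<open>The values \<open>rho\<close>, \<open>beta\<close> and \<open>gamma\<close> depend only on the action on two levels, so on sections
  they are insensitive to factors from the stabilizer of level 3.\<close>

lemma sec_mult_St_3:
  assumes g: "g \<in> carrier G" and z: "z \<in> St 3"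
  shows "[rho (sec (g \<otimes> z) k) = rho (sec g k)] (mod int p)"
    and "[beta (sec (g \<otimes> z) k) = beta (sec g k)] (mod int p)"
    and "[gamma (sec (g \<otimes> z) k) = gamma (sec g k)] (mod int p)"
proof -
  have zc: "z \<in> carrier G" using z St_carrier by blast
  let ?z = "sec z (k + rho g)"
  have "?z \<in> St 2"
    using z by (simp add: numeral_3_eq_3 numeral_2_eq_2)
  note t = St_2_trivial[OF this] and c = sec_closed[OF g, of k] sec_closed[OF zc, of "k + rho g"]
  have eq: "sec (g \<otimes> z) k = sec g k \<otimes> ?z"
    by (rule sec_mult[OF g zc])
  show "[rho (sec (g \<otimes> z) k) = rho (sec g k)] (mod int p)"
    using cong_trans[OF rho_mult[OF c] cong_add[OF cong_refl t(1)]] by (simp add: eq)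
  show "[beta (sec (g \<otimes> z) k) = beta (sec g k)] (mod int p)"
    using cong_trans[OF beta_mult[OF c] cong_add[OF cong_refl t(2)]] by (simp add: eq)
  have "[gamma (sec g k \<otimes> ?z) = gamma (sec g k) + 0 - int (Suc deg) * rho (sec g k) * 0] (mod int p)"
    by (intro cong_trans[OF gamma_mult[OF c]] cong_diff cong_add cong_mult cong_refl t)
  then show "[gamma (sec (g \<otimes> z) k) = gamma (sec g k)] (mod int p)"
    by (simp add: eq)
qed


section \<open>An invariant of \<open>p\<close>-th powers\<close>

text \<open>The shape of the \<open>p\<close>-th power of an element that moves the first level: modulo the kernel of the
  Heisenberg quotient its sections differ only by central factors, and \<open>gamma\<close> records these.\<close>

definition flat :: "'a \<Rightarrow> int \<Rightarrow> bool" where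
  "flat g c \<longleftrightarrow> g \<in> carrier G \<and> [rho g = 0] (mod int p) \<and>
    (\<forall>k. [rho (sec g k) = 0] (mod int p) \<and> [beta (sec g k) = c] (mod int p)) \<and>
    (\<forall>j < deg - 1. [moment p j (\<lambda>k. gamma (sec g k)) = 0] (mod int p))"

definition theta :: "'a \<Rightarrow> int" where
  "theta g = moment p (deg - 1) (\<lambda>k. gamma (sec g k))"

text \<open>Because \<open>x\<close> commutes with \<open>x\<^sup>p\<close>, passing from the section of \<open>x\<^sup>p\<close> at \<open>k\<close> to the one at \<open>k + rho x\<close>
  is conjugation by \<open>sec x k\<close>. In the Heisenberg quotient this changes \<open>gamma\<close> by a multiple of the
  shift of \<open>sec x k\<close>. So the vector of values \<open>gamma\<close> is obtained by summing up the vector of shifts of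
  \<open>x\<close>, whose leading moment is \<open>beta x\<close>; this accounts for the square.\<close>

lemma p_power_flat:
  assumes x: "x \<in> carrier G" and s: "\<not> [rho x = 0] (mod int p)"
  shows "flat (x [^] p) (beta x)"
    and "[- (int deg * rho x * theta (x [^] p)) = int (Suc deg) * beta x * beta x] (mod int p)"
proof -
  let ?g = "x [^] p" and ?d = "int (Suc deg)"
  have g: "?g \<in> carrier G" using x by simp
  note next1 = sec_p_power_next[OF x]
  have r: "[rho (sec ?g k) = 0] (mod int p)" for k
  proof -
    have "[rho (sec ?g k) = (\<Sum>j\<in>{0..<int p}. rho (sec x j))] (mod int p)"
      by (rule orbit_sum_full[where S = "carrier G"]) (auto simp: x s rho_mult)
    then show ?thesis
      using moment_rho_sec_lt_deg[OF x deg_bounds(2)] by (auto simp: moment_0 intro: cong_trans)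
  qed
  have b: "[beta (sec ?g k) = beta x] (mod int p)" for k
  proof -
    have "[beta (sec ?g k) = (\<Sum>j\<in>{0..<int p}. beta (sec x j))] (mod int p)"
      by (rule orbit_sum_full[where S = "carrier G"]) (auto simp: x s beta_mult)
    then show ?thesis using sum_beta_sec[OF x] by (auto intro: cong_trans)
  qed
  have c: "[gamma (sec ?g (k + rho x)) = gamma (sec ?g k) + ?d * beta x * rho (sec x k)] (mod int p)" for k
  proof -
    let ?x = "sec x k" and ?g' = "sec ?g (k + rho x)"
    have "[gamma ?x + gamma ?g' - ?d * rho ?x * beta ?g' = gamma (?x \<otimes> ?g')] (mod int p)"
      using x by (intro cong_sym[OF gamma_mult]) auto
    also have "[gamma (?x \<otimes> ?g') = gamma (sec ?g k) + gamma ?x] (mod int p)"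
      unfolding next1(1) using x r by (intro gamma_mult_stab) auto
    finally have 1: "[gamma ?x + gamma ?g' - ?d * rho ?x * beta ?g' = gamma (sec ?g k) + gamma ?x] (mod int p)" .
    have "[?d * rho ?x * beta ?g' = ?d * rho ?x * beta x] (mod int p)"
      by (intro cong_mult cong_refl b)
    from cong_add[OF 1 cong_diff[OF this cong_refl[of "gamma ?x"]]] show ?thesis
      by (simp add: algebra_simps)
  qed
  have w: "[moment p i (\<lambda>k. ?d * beta x * rho (sec x k)) = 0] (mod int p)" if "i < deg" for i
    using cong_mult[OF cong_refl moment_rho_sec_lt_deg[OF x that], of "?d * beta x"]
    by (simp only: moment_scale mult_zero_right)
  note m = moment_of_difference[OF prime_p mod_periodic_sec[of gamma ?g] s c w deg_bounds(2)]
  show "flat ?g (beta x)"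
    using g next1(2) r b m(1) deg_bounds(3) by (simp add: flat_def)
  show "[- (int deg * rho x * theta ?g) = ?d * beta x * beta x] (mod int p)"
    using m(2) deg_bounds(3) by (simp only: theta_def moment_scale beta_def)
qed

lemma flat_pow:
  assumes "flat g c"
  shows "[beta (sec (g [^] n) k) = int n * c] (mod int p)" "[theta (g [^] n) = int n * theta g] (mod int p)"
proof -
  note g = assms[unfolded flat_def]
  have "[beta (sec (g [^] n) k) = int n * beta (sec g k)] (mod int p)"
    using g by (intro orbit_sum_stab[where S = "carrier G"]) (auto simp: beta_mult)
  also have "[int n * beta (sec g k) = int n * c] (mod int p)"
    using g by (intro cong_mult) auto
  finally show "[beta (sec (g [^] n) k) = int n * c] (mod int p)" .
  have "[gamma (sec (g [^] n) k) = int n * gamma (sec g k)] (mod int p)" for k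
    using g rho_one gamma_additive_stab
    by (intro orbit_sum_stab[where S = "{x \<in> carrier G. [rho x = 0] (mod int p)}"]) auto
  then have "[theta (g [^] n) = moment p (deg - 1) (\<lambda>k. int n * gamma (sec g k))] (mod int p)"
    unfolding theta_def by (rule moment_cong)
  then show "[theta (g [^] n) = int n * theta g] (mod int p)"
    by (simp add: theta_def moment_scale)
qed

lemma flat_pow_flat:
  assumes "flat g c"
  shows "flat (g [^] n) (int n * c)"
proof -
  note g = assms[unfolded flat_def]
  have "[rho (g [^] n) = int n * 0] (mod int p)"
    using g by (intro cong_trans[OF rho_pow] cong_mult) auto
  moreover have "[rho (sec (g [^] n) k) = int n * 0] (mod int p)" for k
  proof -
    have "[rho (sec (g [^] n) k) = int n * rho (sec g k)] (mod int p)"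
      using g by (intro orbit_sum_stab[where S = "carrier G"]) (auto simp: rho_mult)
    also have "[int n * rho (sec g k) = int n * 0] (mod int p)"
      using g by (intro cong_mult) auto
    finally show ?thesis .
  qed
  moreover have "[moment p j (\<lambda>k. gamma (sec (g [^] n) k)) = 0] (mod int p)" if "j < deg - 1" for j
  proof -
    have "[gamma (sec (g [^] n) k) = int n * gamma (sec g k)] (mod int p)" for k
      using g rho_one gamma_additive_stab
      by (intro orbit_sum_stab[where S = "{x \<in> carrier G. [rho x = 0] (mod int p)}"]) auto
    then have "[moment p j (\<lambda>k. gamma (sec (g [^] n) k)) = moment p j (\<lambda>k. int n * gamma (sec g k))] (mod int p)"
      by (rule moment_cong)
    also have "[moment p j (\<lambda>k. int n * gamma (sec g k)) = int n * 0] (mod int p)"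
      unfolding moment_scale using g that by (intro cong_mult) auto
    finally show ?thesis by simp
  qed
  ultimately show ?thesis
    using g flat_pow(1)[OF assms] by (simp add: flat_def)
qed

text \<open>Conjugation by \<open>h\<close> shifts the vector of the values \<open>gamma\<close> and adds a multiple of
  \<open>k \<mapsto> rho (sec h k)\<close>, whose moments of degree less than \<open>deg\<close> vanish.\<close>

lemma theta_conj:
  assumes flat: "flat g c" and h: "h \<in> carrier G"
  shows "[theta (inv h \<otimes> g \<otimes> h) = theta g] (mod int p)"
    and "[beta (sec (inv h \<otimes> g \<otimes> h) k) = c] (mod int p)"
proof -
  note g = flat[unfolded flat_def]
  let ?c = "inv h \<otimes> g \<otimes> h" and ?r = "rho h" and ?d = "int (Suc deg)"
  have s: "sec ?c (k + ?r) = inv (sec h k) \<otimes> sec g k \<otimes> sec h k" for k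
    using g h sec_conj(1) by blast
  have bb: "[beta (sec ?c (k + ?r)) = c] (mod int p)" for k
    unfolding s using g h by (intro cong_trans[OF additive_conj[of beta]] beta_mult) auto
  show "[beta (sec ?c k) = c] (mod int p)"
    using bb[of "k - ?r"] by simp
  have gg: "[gamma (sec ?c (k + ?r)) = gamma (sec g k) + ?d * c * rho (sec h k)] (mod int p)" for k
  proof -
    have "[gamma (sec ?c (k + ?r)) = gamma (sec g k) + ?d * rho (sec h k) * beta (sec g k)] (mod int p)"
      unfolding s using g h by (intro gamma_conj) auto
    also have "[gamma (sec g k) + ?d * rho (sec h k) * beta (sec g k)
        = gamma (sec g k) + ?d * rho (sec h k) * c] (mod int p)"
      using g by (intro cong_add cong_mult) auto
    finally show ?thesis by (simp add: mult_ac)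
  qed
  \<comment> \<open>Only moments up to degree \<open>deg - 1\<close> matter, and for these the added vector contributes nothing.\<close>
  have mm: "[moment p j (\<lambda>k. gamma (sec ?c (k + ?r))) = moment p j (\<lambda>k. gamma (sec g k))] (mod int p)"
    if "j < deg" for j
  proof -
    have "[moment p j (\<lambda>k. gamma (sec ?c (k + ?r)))
        = moment p j (\<lambda>k. gamma (sec g k) + ?d * c * rho (sec h k))] (mod int p)"
      by (rule moment_cong[OF gg])
    also have "moment p j (\<lambda>k. gamma (sec g k) + ?d * c * rho (sec h k))
        = moment p j (\<lambda>k. gamma (sec g k)) + ?d * c * moment p j (\<lambda>k. rho (sec h k))"
      by (simp only: moment_add moment_scale)
    also have "[\<dots> = moment p j (\<lambda>k. gamma (sec g k)) + ?d * c * 0] (mod int p)"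
      by (intro cong_add cong_mult cong_refl moment_rho_sec_lt_deg h that)
    finally show ?thesis by simp
  qed
  have "[moment p (deg - 1) (\<lambda>k. gamma (sec ?c (k + - ?r + ?r)))
      = moment p (deg - 1) (\<lambda>k. gamma (sec ?c (k + ?r)))] (mod int p)"
  proof (rule moment_shift_leading[OF _ p_pos])
    show "mod_periodic p (\<lambda>k. gamma (sec ?c (k + ?r)))"
      using mod_periodic_sec[of gamma ?c] by (auto simp: mod_periodic_def cong_add)
    show "[moment p j (\<lambda>k. gamma (sec ?c (k + ?r))) = 0] (mod int p)" if "j < deg - 1" for j
      using cong_trans[OF mm[of j]] g that by simp
  qed
  also have "[moment p (deg - 1) (\<lambda>k. gamma (sec ?c (k + ?r))) = theta g] (mod int p)"
    unfolding theta_def using deg_bounds(2) by (intro mm) simp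
  finally show "[theta ?c = theta g] (mod int p)"
    by (simp add: theta_def)
qed

text \<open>If the two powers were conjugate, then \<open>m beta x = n beta y\<close> by comparing \<open>beta\<close>, and
  \<open>m (beta x)\<^sup>2 / rho x = n (beta y)\<^sup>2 / rho y\<close> by comparing \<open>theta\<close>. Unless both sides vanish, dividing
  yields equal slopes.\<close>

lemma p_power_separation:
  assumes x: "x \<in> carrier G" "\<not> [rho x = 0] (mod int p)" "\<not> [beta x = 0] (mod int p)"
    and y: "y \<in> carrier G" "\<not> [rho y = 0] (mod int p)"
    and slope: "\<not> [beta x * rho y = beta y * rho x] (mod int p)"
    and h: "h \<in> carrier G" and z: "z \<in> St 3"
    and eq: "inv h \<otimes> (x [^] p) [^] (m::nat) \<otimes> h = (y [^] p) [^] (n::nat) \<otimes> z"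
  shows "p dvd m"
proof -
  let ?g = "x [^] p" and ?f = "y [^] p" and ?d = "int (Suc deg)"
  note gx = p_power_flat[OF x(1,2)] and gy = p_power_flat[OF y]
  have f: "?f [^] n \<in> carrier G" using y(1) by simp
  have "[int m * beta x = beta (sec (inv h \<otimes> ?g [^] m \<otimes> h) 0)] (mod int p)"
    by (rule cong_sym[OF theta_conj(2)[OF flat_pow_flat[OF gx(1)] h]])
  also have "[beta (sec (inv h \<otimes> ?g [^] m \<otimes> h) 0) = beta (sec (?f [^] n) 0)] (mod int p)"
    unfolding eq by (rule sec_mult_St_3(2)[OF f z])
  also have "[beta (sec (?f [^] n) 0) = int n * beta y] (mod int p)"
    by (rule flat_pow(1)[OF gy(1)])
  finally have B: "[int m * beta x = int n * beta y] (mod int p)" .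
  have "[int m * theta ?g = theta (?g [^] m)] (mod int p)"
    by (rule cong_sym[OF flat_pow(2)[OF gx(1)]])
  also have "[theta (?g [^] m) = theta (inv h \<otimes> ?g [^] m \<otimes> h)] (mod int p)"
    by (rule cong_sym[OF theta_conj(1)[OF flat_pow_flat[OF gx(1)] h]])
  also have "[theta (inv h \<otimes> ?g [^] m \<otimes> h) = theta (?f [^] n)] (mod int p)"
    unfolding eq theta_def by (rule moment_cong) (rule sec_mult_St_3(3)[OF f z])
  also have "[theta (?f [^] n) = int n * theta ?f] (mod int p)"
    by (rule flat_pow(2)[OF gy(1)])
  finally have T: "[int m * theta ?g = int n * theta ?f] (mod int p)" .
  \<comment> \<open>Both values of \<open>theta\<close> are replaced by squares, with the denominators cleared.\<close>
  have "[int m * rho y * (?d * beta x * beta x) = int m * rho y * - (int deg * rho x * theta ?g)] (mod int p)"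
    by (intro cong_mult cong_refl cong_sym[OF gx(2)])
  also have "int m * rho y * - (int deg * rho x * theta ?g) = - (int deg * rho x * rho y) * (int m * theta ?g)"
    by simp
  also have "[\<dots> = - (int deg * rho x * rho y) * (int n * theta ?f)] (mod int p)"
    by (intro cong_mult cong_refl T)
  also have "- (int deg * rho x * rho y) * (int n * theta ?f) = int n * rho x * - (int deg * rho y * theta ?f)"
    by simp
  also have "[\<dots> = int n * rho x * (?d * beta y * beta y)] (mod int p)"
    by (intro cong_mult cong_refl gy(2))
  also have "int n * rho x * (?d * beta y * beta y) = ?d * beta y * rho x * (int n * beta y)"
    by simp
  also have "[\<dots> = ?d * beta y * rho x * (int m * beta x)] (mod int p)"
    by (intro cong_mult cong_refl cong_sym[OF B])
  finally have "int p dvd int m * rho y * (?d * beta x * beta x) - ?d * beta y * rho x * (int m * beta x)"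
    by (simp only: cong_iff_dvd_diff)
  also have "\<dots> = int m * ?d * beta x * (beta x * rho y - beta y * rho x)"
    by (simp add: algebra_simps)
  finally have "[int m * ?d * beta x * (beta x * rho y - beta y * rho x) = 0] (mod int p)"
    by (simp only: cong_0_iff)
  moreover have "\<not> [beta x * rho y - beta y * rho x = 0] (mod int p)"
    using slope by (simp add: cong_iff_dvd_diff)
  moreover have "\<not> [?d = 0] (mod int p)"
    unfolding cong_0_iff using deg_bounds(3) by (intro zdvd_not_zless) auto
  ultimately have "[int m = 0] (mod int p)"
    using x(3) by (simp only: cong_mult_0_iff) blast
  then show ?thesis by (simp add: cong_0_iff)
qed

end

section \<open>Beauville structures on quotients\<close>

lemma Sigma_set_FactGroup:
  fixes G (structure)
  assumes N: "N \<lhd> G" and fin: "finite (carrier (G Mod N))"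
    and x: "x \<in> carrier G" and y: "y \<in> carrier G"
    and t: "t \<in> Sigma_set (G Mod N) (N #> x) (N #> y)"
  obtains u i g where "u \<in> {x, y, x \<otimes> y}" "g \<in> carrier G"
    "t = N #> (inv g \<otimes> u [^] (i::nat) \<otimes> g)"
proof -
  interpret normal N G by (rule N)
  interpret Q: group "G Mod N" by (rule factorgroup_is_group)
  let ?q = "\<lambda>x. N #> x"
  have mult: "?q g \<otimes>\<^bsub>G Mod N\<^esub> ?q h = ?q (g \<otimes> h)" if "g \<in> carrier G" "h \<in> carrier G" for g h
    using that rcos_sum by simp
  have closed: "?q g \<in> carrier (G Mod N)" if "g \<in> carrier G" for g
    using that by (simp add: carrier_FactGroup)
  from t obtain c where c: "c \<in> carrier (G Mod N)" and
    "t \<in> conj_set (G Mod N) (generate (G Mod N) {?q x}) c \<or>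
     t \<in> conj_set (G Mod N) (generate (G Mod N) {?q y}) c \<or>
     t \<in> conj_set (G Mod N) (generate (G Mod N) {?q (x \<otimes> y)}) c"
    unfolding Sigma_set_def mult[OF x y] by blast
  then obtain u where u: "u \<in> {x, y, x \<otimes> y}" and "t \<in> conj_set (G Mod N) (generate (G Mod N) {?q u}) c"
    by blast
  then obtain s where s: "s \<in> generate (G Mod N) {?q u}"
    and t: "t = inv\<^bsub>G Mod N\<^esub> c \<otimes>\<^bsub>G Mod N\<^esub> s \<otimes>\<^bsub>G Mod N\<^esub> c"
    unfolding conj_set_def by blast
  have uc: "u \<in> carrier G" using u x y by auto
  obtain i :: nat where "s = ?q u [^]\<^bsub>G Mod N\<^esub> i"
    using s Q.generate_pow_on_finite_carrier[OF fin closed[OF uc]] by blast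
  then have s: "s = ?q (u [^] i)"
    using FactGroup_pow uc by simp
  obtain g where g: "g \<in> carrier G" "c = ?q g"
    using c by (auto simp: carrier_FactGroup)
  have "inv\<^bsub>G Mod N\<^esub> c = ?q (inv g)"
    using c g inv_FactGroup rcos_inv by simp
  then have "t = ?q (inv g \<otimes> u [^] i \<otimes> g)"
    unfolding t s g(2) using g(1) uc by (simp only: mult inv_closed m_closed nat_pow_closed)
  then show ?thesis using that u g(1) by blast
qed

lemma generate_FactGroup:
  fixes G (structure)
  assumes N: "N \<lhd> G" and x: "x \<in> carrier G" "y \<in> carrier G" and gen: "generate G {x, y} = carrier G"
  shows "generate (G Mod N) {N #> x, N #> y} = carrier (G Mod N)"
proof -
  interpret normal N G by (rule N)
  interpret Q: group "G Mod N" by (rule factorgroup_is_group)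
  interpret h: group_hom G "G Mod N" "\<lambda>x. N #> x"
    by unfold_locales (rule r_coset_hom_Mod)
  have "(\<lambda>x. N #> x) ` generate G {x, y} = generate (G Mod N) ((\<lambda>x. N #> x) ` {x, y})"
    using x by (intro h.generate_img[symmetric]) auto
  then show ?thesis
    by (simp add: gen carrier_FactGroup)
qed

text \<open>A common element of the two sets is the image of a conjugate of a power \<open>u\<^sup>i\<close> and of a conjugate of
  a power \<open>v\<^sup>j\<close>. Moving both conjugations to the side of \<open>u\<close> leaves the equation in \<open>sep\<close>, so all
  computations can be done in \<open>G\<close> itself.\<close>

lemma beauville_group_FactGroupI:
  fixes G (structure)
  assumes N: "N \<lhd> G" and fin: "finite (carrier (G Mod N))"
    and x: "x\<^sub>1 \<in> carrier G" "y\<^sub>1 \<in> carrier G" "x\<^sub>2 \<in> carrier G" "y\<^sub>2 \<in> carrier G"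
    and gen: "generate G {x\<^sub>1, y\<^sub>1} = carrier G" "generate G {x\<^sub>2, y\<^sub>2} = carrier G"
    and sep: "\<And>u v g z i j. \<lbrakk>u \<in> {x\<^sub>1, y\<^sub>1, x\<^sub>1 \<otimes> y\<^sub>1}; v \<in> {x\<^sub>2, y\<^sub>2, x\<^sub>2 \<otimes> y\<^sub>2};
        g \<in> carrier G; z \<in> N;
        inv g \<otimes> u [^] (i::nat) \<otimes> g = v [^] (j::nat) \<otimes> z\<rbrakk>
        \<Longrightarrow> u [^] i \<in> N"
  shows "beauville_group (G Mod N)"
proof -
  interpret normal N G by (rule N)
  interpret Q: group "G Mod N" by (rule factorgroup_is_group)
  let ?q = "\<lambda>x. N #> x"
  have closed: "?q g \<in> carrier (G Mod N)" if "g \<in> carrier G" for g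
    using that by (simp add: carrier_FactGroup)
  have "t = N" if t1: "t \<in> Sigma_set (G Mod N) (?q x\<^sub>1) (?q y\<^sub>1)"
    and t2: "t \<in> Sigma_set (G Mod N) (?q x\<^sub>2) (?q y\<^sub>2)" for t
  proof -
    obtain u i g where u: "u \<in> {x\<^sub>1, y\<^sub>1, x\<^sub>1 \<otimes> y\<^sub>1}" and g: "g \<in> carrier G"
      and tu: "t = ?q (inv g \<otimes> u [^] (i::nat) \<otimes> g)"
      by (rule Sigma_set_FactGroup[OF N fin x(1,2) t1])
    obtain v j h where v: "v \<in> {x\<^sub>2, y\<^sub>2, x\<^sub>2 \<otimes> y\<^sub>2}" and h: "h \<in> carrier G"
      and tv: "t = ?q (inv h \<otimes> v [^] (j::nat) \<otimes> h)"
      by (rule Sigma_set_FactGroup[OF N fin x(3,4) t2])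
    have uc: "u [^] i \<in> carrier G" and vc: "v [^] j \<in> carrier G"
      using u v x by auto
    let ?l = "inv g \<otimes> u [^] i \<otimes> g" and ?r = "inv h \<otimes> v [^] j \<otimes> h"
    have l: "?l \<in> carrier G" and r: "?r \<in> carrier G"
      using g h uc vc by simp_all
    have "?l \<in> ?q ?r"
      using rcos_self[OF l is_subgroup] tu tv by simp
    then obtain n where n: "n \<in> N" "?l = n \<otimes> ?r"
      by (auto simp: r_coset_def)
    have nc: "n \<in> carrier G" using n(1) by (rule mem_carrier)
    define k where "k = g \<otimes> inv h"
    define z where "z = inv (v [^] j) \<otimes> (h \<otimes> n \<otimes> inv h) \<otimes> v [^] j"
    have k: "k \<in> carrier G" using g h by (simp add: k_def)
    have z: "z \<in> N"
      unfolding z_def using inv_op_closed1[OF vc] inv_op_closed2[OF h n(1)] by simp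
    have "inv k \<otimes> u [^] i \<otimes> k = h \<otimes> ?l \<otimes> inv h"
      using g h uc by (simp add: k_def inv_mult_group m_assoc)
    also have "\<dots> = h \<otimes> n \<otimes> inv h \<otimes> v [^] j"
      unfolding n(2) using h nc vc by (simp add: m_assoc)
    also have "\<dots> = v [^] j \<otimes> z"
      using h nc vc by (simp add: z_def m_assoc[symmetric])
    finally have "u [^] i \<in> N"
      using sep[OF u v k z] by blast
    then have "?l \<in> N"
      using inv_op_closed1[OF g] by blast
    then show "t = N"
      unfolding tu using l by (simp add: coset_join2 is_subgroup)
  qed
  moreover have "N \<in> Sigma_set (G Mod N) (?q x) (?q y)" if "x \<in> carrier G" "y \<in> carrier G" for x y
  proof -
    have "\<one>\<^bsub>G Mod N\<^esub> = inv\<^bsub>G Mod N\<^esub> \<one>\<^bsub>G Mod N\<^esub> \<otimes>\<^bsub>G Mod N\<^esub> \<one>\<^bsub>G Mod N\<^esub> \<otimes>\<^bsub>G Mod N\<^esub> \<one>\<^bsub>G Mod N\<^esub>"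
      by (simp only: Q.inv_one Q.l_one Q.one_closed)
    then have "N \<in> conj_set (G Mod N) (generate (G Mod N) {?q x}) \<one>\<^bsub>G Mod N\<^esub>"
      unfolding conj_set_def by (metis (mono_tags, lifting) generate.one mem_Collect_eq one_FactGroup)
    then show ?thesis
      unfolding Sigma_set_def using Q.one_closed by blast
  qed
  ultimately have "Sigma_set (G Mod N) (?q x\<^sub>1) (?q y\<^sub>1) \<inter> Sigma_set (G Mod N) (?q x\<^sub>2) (?q y\<^sub>2) = {\<one>\<^bsub>G Mod N\<^esub>}"
    using x by auto
  then show ?thesis
    unfolding beauville_group_def
    using Q.is_group fin closed x generate_FactGroup[OF N x(1,2) gen(1)] generate_FactGroup[OF N x(3,4) gen(2)]
    by blast
qed


section \<open>Separating elements from the powers of the generators and their product\<close>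

context zero_sum_ggs_sections
begin

lemma not_cong_0_of_nat: "0 < k \<Longrightarrow> k < p \<Longrightarrow> \<not> [int k = 0] (mod int p)"
  by (auto simp: cong_0_iff dest: dvd_imp_le)

lemma not_cong_0_trans: "[x = y] (mod int p) \<Longrightarrow> \<not> [y = 0] (mod int p) \<Longrightarrow> \<not> [x = 0] (mod int p)"
  by (simp add: cong_def)

lemma not_cong_1_0: "\<not> [1 = 0] (mod int p)"
  using not_cong_0_of_nat[of 1] prime_gt_1_nat[OF prime_p] by simp

lemma pow_multiple_order:
  assumes "x \<in> carrier G" "x [^] (n::nat) = \<one>" "n dvd i"
  shows "x [^] i = \<one>"
  using assms by (metis dvdE nat_pow_one nat_pow_pow)

text \<open>As the sum of the \<open>e k\<close> vanishes, some section of \<open>(a b\<^sup>u)\<^sup>p\<close> is \<open>b\<^sup>u\<close>, and all the others are conjugate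
  to it.\<close>

lemma ab_pow_order:
  shows "(a \<otimes> b [^] (u::nat)) [^] (p * p) = \<one>"
proof -
  let ?x = "a \<otimes> b [^] u"
  have x: "?x \<in> carrier G" by simp
  have r: "\<not> [rho ?x = 0] (mod int p)"
  proof -
    have "[rho ?x = 1 + 0] (mod int p)"
      by (intro cong_trans[OF rho_mult] cong_add rho_a rho_b_pow) auto
    then show ?thesis
      using not_cong_0_trans[OF _ not_cong_1_0] by simp
  qed
  have "\<not> p dvd 1" using prime_gt_1_nat[OF prime_p] by simp
  from sec_p_power_generators[OF this, of u]
  have "sec (?x [^] p) (- 1) = b [^] u \<otimes> a [^] (int u * (\<Sum>j\<in>{0..<int p}. e j))"
    by simp
  also have "a [^] (int u * (\<Sum>j\<in>{0..<int p}. e j)) = a [^] (0::int)"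
    using cong_mult[OF cong_refl e_sum, of "int u"] by (intro a_int_pow_cong) simp
  finally have "sec (?x [^] p) (- 1) = b [^] u" by simp
  moreover have "(b [^] u) [^] p = \<one>"
    using b_order by (metis b_closed mult.commute nat_pow_one nat_pow_pow)
  ultimately have "sec (?x [^] p) (- 1) [^] p = \<one>"
    by simp
  then have "sec (?x [^] p) k [^] p = \<one>" for k
    by (rule sec_p_power_order[OF x r])
  then have "sec ((?x [^] p) [^] p) k = \<one>" for k
    using sec_pow_stab[OF nat_pow_closed[OF x] sec_p_power_next(2)[OF x]] by simp
  moreover have "[rho ((?x [^] p) [^] p) = 0] (mod int p)"
    by (rule cong_trans[OF rho_pow]) (simp_all add: cong_def)
  ultimately have "(?x [^] p) [^] p = \<one>"
    using faithful[of "(?x [^] p) [^] p"] by simp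
  then show ?thesis by (simp add: nat_pow_pow)
qed

lemma conj_pow_rho_beta:
  assumes "u \<in> carrier G" "v \<in> carrier G" "g \<in> carrier G" "z \<in> St 2"
    and eq: "inv g \<otimes> u [^] (i::nat) \<otimes> g = v [^] (j::nat) \<otimes> z"
  shows "[int i * rho u = int j * rho v] (mod int p)" "[int i * beta u = int j * beta v] (mod int p)"
proof -
  have z: "z \<in> carrier G" using assms(4) St_carrier by blast
  have *: "[int i * \<phi> u = int j * \<phi> v] (mod int p)"
    if hom: "\<And>x y. \<lbrakk>x \<in> carrier G; y \<in> carrier G\<rbrakk> \<Longrightarrow> [\<phi> (x \<otimes> y) = \<phi> x + \<phi> y] (mod int p)"
      and pow: "\<And>x n. x \<in> carrier G \<Longrightarrow> [\<phi> (x [^] (n::nat)) = int n * \<phi> x] (mod int p)"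
      and 0: "[\<phi> z = 0] (mod int p)" for \<phi>
  proof -
    have "[int i * \<phi> u = \<phi> (u [^] i)] (mod int p)"
      by (rule cong_sym[OF pow[OF assms(1)]])
    also have "[\<phi> (u [^] i) = \<phi> (inv g \<otimes> u [^] i \<otimes> g)] (mod int p)"
      using assms(1,3) by (intro cong_sym[OF additive_conj] hom) auto
    also have "[\<phi> (inv g \<otimes> u [^] i \<otimes> g) = \<phi> (v [^] j) + \<phi> z] (mod int p)"
      unfolding eq using assms(2) z by (intro hom) auto
    also have "[\<phi> (v [^] j) + \<phi> z = int j * \<phi> v + 0] (mod int p)"
      by (intro cong_add pow assms(2) 0)
    finally show ?thesis by simp
  qed
  show "[int i * rho u = int j * rho v] (mod int p)"
    by (rule *) (auto intro: rho_mult rho_pow St_2_trivial assms)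
  show "[int i * beta u = int j * beta v] (mod int p)"
    by (rule *) (auto intro: beta_mult beta_pow St_2_trivial assms)
qed

lemma rho_ab: "[rho (a \<otimes> b) = 1] (mod int p)" and beta_ab: "[beta (a \<otimes> b) = beta b] (mod int p)"
  using cong_trans[OF rho_mult[OF a_closed b_closed] cong_add[OF rho_a rho_b]]
    cong_trans[OF beta_mult[OF a_closed b_closed] cong_add[OF beta_a cong_refl[of "beta b"]]] by simp_all

text \<open>The hypotheses \<open>lines\<close> say that in the plane with coordinates \<open>rho\<close> and \<open>beta\<close> the element \<open>v\<close> lies on
  none of the lines spanned by \<open>a\<close>, \<open>b\<close> and \<open>a \<otimes> b\<close>. So both exponents are multiples of \<open>p\<close>. This
  finishes the cases of \<open>a\<close> and \<open>b\<close>; for \<open>a \<otimes> b\<close> the \<open>p\<close>-th powers are separated by their slopes.\<close>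

lemma separate_off_lines:
  assumes u: "u \<in> {a, b, a \<otimes> b}" and v: "v \<in> carrier G"
    and lines: "\<not> [rho v = 0] (mod int p)" "\<not> [beta v = 0] (mod int p)" "\<not> [beta v = rho v * beta b] (mod int p)"
    and g: "g \<in> carrier G" and z: "z \<in> St 2" and eq: "inv g \<otimes> u [^] (i::nat) \<otimes> g = v [^] (j::nat) \<otimes> z"
  shows "u [^] i \<in> St 2" "z \<in> St 3 \<Longrightarrow> u [^] i = \<one>"
proof -
  have uc: "u \<in> carrier G" using u by auto
  note rb = conj_pow_rho_beta[OF uc v g z eq]
  have ij: "p dvd i" "p dvd j"
  proof -
    consider "u = a" | "u = b" | "u = a \<otimes> b" using u by blast
    then have "[int i = 0] (mod int p) \<and> [int j = 0] (mod int p)"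
    proof cases
      case 1
      have "[int j * beta v = int i * beta u] (mod int p)"
        by (rule cong_sym[OF rb(2)])
      also have "[int i * beta u = int i * 0] (mod int p)"
        unfolding 1 by (intro cong_mult cong_refl beta_a)
      finally have "[int j * beta v = int i * 0] (mod int p)" .
      then have j: "[int j = 0] (mod int p)"
        using lines(2) by (simp add: cong_mult_0_iff)
      have "[int i * 1 = int i * rho a] (mod int p)"
        by (intro cong_mult cong_refl cong_sym[OF rho_a])
      also have "[int i * rho a = int j * rho v] (mod int p)"
        using rb(1) 1 by simp
      also have "[int j * rho v = 0] (mod int p)"
        using j by (simp add: cong_mult_0_iff)
      finally show ?thesis using j by simp
    next
      case 2
      have "[int j * rho v = int i * rho u] (mod int p)"
        by (rule cong_sym[OF rb(1)])
      also have "[int i * rho u = int i * 0] (mod int p)"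
        unfolding 2 by (intro cong_mult cong_refl rho_b)
      finally have "[int j * rho v = int i * 0] (mod int p)" .
      then have j: "[int j = 0] (mod int p)"
        using lines(1) by (simp add: cong_mult_0_iff)
      have "[int i * beta b = int j * beta v] (mod int p)"
        using rb(2) 2 by simp
      also have "[int j * beta v = 0] (mod int p)"
        using j by (simp add: cong_mult_0_iff)
      finally show ?thesis using j beta_b by (simp add: cong_mult_0_iff)
    next
      case 3
      have "[int i * 1 = int i * rho u] (mod int p)"
        unfolding 3 by (intro cong_mult cong_refl cong_sym[OF rho_ab])
      then have i: "[int i = int j * rho v] (mod int p)"
        using cong_trans[OF _ rb(1)] by (simp only: mult_1_right)
      have "[int j * beta v = int i * beta u] (mod int p)"
        by (rule cong_sym[OF rb(2)])
      also have "[int i * beta u = int i * beta b] (mod int p)"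
        unfolding 3 by (intro cong_mult cong_refl beta_ab)
      also have "[int i * beta b = int j * rho v * beta b] (mod int p)"
        by (intro cong_mult cong_refl i)
      finally have "[int j * (beta v - rho v * beta b) = 0] (mod int p)"
        by (simp add: cong_iff_dvd_diff algebra_simps)
      moreover have "\<not> [beta v - rho v * beta b = 0] (mod int p)"
        using lines(3) by (simp add: cong_iff_dvd_diff)
      ultimately have j: "[int j = 0] (mod int p)"
        by (simp add: cong_mult_0_iff)
      have "[int j * rho v = 0] (mod int p)"
        using j by (simp add: cong_mult_0_iff)
      with i j show ?thesis by (simp add: cong_def)
    qed
    then show "p dvd i" "p dvd j" by (simp_all add: cong_0_iff)
  qed
  obtain m n where mn: "i = p * m" "j = p * n"
    using ij by (auto elim!: dvdE)
  consider "u [^] i = \<one>" | "u = a \<otimes> b"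
    using u ij(1) pow_multiple_order[OF a_closed a_order] pow_multiple_order[OF b_closed b_order] by auto
  then have "u [^] i \<in> St 2 \<and> (z \<in> St 3 \<longrightarrow> u [^] i = \<one>)"
  proof cases
    case 1
    then show ?thesis using one_St[of 2] by simp
  next
    case 2
    have ru: "\<not> [rho u = 0] (mod int p)"
      unfolding 2 by (rule not_cong_0_trans[OF rho_ab not_cong_1_0])
    have "flat (u [^] p) (beta u)"
      by (rule p_power_flat(1)[OF uc ru])
    then have "u [^] p \<in> St 2"
      by (simp add: flat_def numeral_2_eq_2)
    then have "(u [^] p) [^] m \<in> St 2"
      by (induction m) (auto intro: St_mult one_St)
    moreover have "u [^] i = \<one>" if "z \<in> St 3"
    proof -
      have "p dvd m"
      proof (rule p_power_separation[OF uc ru _ v lines(1) _ g that])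
        show "\<not> [beta u = 0] (mod int p)"
          unfolding 2 by (rule not_cong_0_trans[OF beta_ab beta_b])
        show "\<not> [beta u * rho v = beta v * rho u] (mod int p)"
        proof
          assume "[beta u * rho v = beta v * rho u] (mod int p)"
          moreover have "[beta b * rho v = beta u * rho v] (mod int p)"
            unfolding 2 by (intro cong_mult cong_refl cong_sym[OF beta_ab])
          moreover have "[beta v * rho u = beta v * 1] (mod int p)"
            unfolding 2 by (intro cong_mult cong_refl rho_ab)
          ultimately have "[beta b * rho v = beta v * 1] (mod int p)"
            by (simp add: cong_def)
          then show False
            using lines(3) by (simp add: cong_sym_eq mult.commute)
        qed
        show "inv g \<otimes> (u [^] p) [^] m \<otimes> g = (v [^] p) [^] n \<otimes> z"
          using eq uc v by (simp add: mn nat_pow_pow)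
      qed
      then have "p * p dvd i" by (simp add: mn)
      then show ?thesis
        using pow_multiple_order[of "a \<otimes> b" "p * p" i] ab_pow_order[of 1] 2 by simp
    qed
    ultimately show ?thesis using uc by (simp add: mn nat_pow_pow)
  qed
  then show "u [^] i \<in> St 2" "z \<in> St 3 \<Longrightarrow> u [^] i = \<one>" by auto
qed

lemma generateI_ab:
  assumes "H = generate G S" "S \<subseteq> carrier G" "a \<in> H" "b \<in> H"
  shows "H = carrier G"
proof
  show "H \<subseteq> carrier G" using assms(1,2) generate_incl by simp
  have "generate G {a, b} \<subseteq> H"
    using assms generate_subgroup_incl[OF _ generate_is_subgroup] by simp
  then show "carrier G \<subseteq> H" using generated by simp
qed

lemma subgroup_pow_closed: "subgroup H G \<Longrightarrow> x \<in> H \<Longrightarrow> x [^] (n::nat) \<in> H"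
  by (induction n) (auto intro: subgroup.one_closed subgroup.m_closed)

lemma off_lines:
  assumes r: "[rho v = r] (mod int p)" and c: "[beta v = c * beta b] (mod int p)"
    and nz: "\<not> [r = 0] (mod int p)" "\<not> [c = 0] (mod int p)" "\<not> [c - r = 0] (mod int p)"
  shows "\<not> [rho v = 0] (mod int p)" "\<not> [beta v = 0] (mod int p)" "\<not> [beta v = rho v * beta b] (mod int p)"
proof -
  show "\<not> [rho v = 0] (mod int p)"
    by (rule not_cong_0_trans[OF r nz(1)])
  have "\<not> [c * beta b = 0] (mod int p)"
    using nz(2) beta_b by (simp add: cong_mult_0_iff)
  then show "\<not> [beta v = 0] (mod int p)"
    by (rule not_cong_0_trans[OF c])
  have "[beta v - rho v * beta b = c * beta b - r * beta b] (mod int p)"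
    by (intro cong_diff cong_mult cong_refl r c)
  moreover have "\<not> [c * beta b - r * beta b = 0] (mod int p)"
    using nz(3) beta_b cong_mult_0_iff[of "c - r" "beta b"] by (simp add: left_diff_distrib)
  ultimately have "\<not> [beta v - rho v * beta b = 0] (mod int p)"
    by (rule not_cong_0_trans)
  then show "\<not> [beta v = rho v * beta b] (mod int p)"
    by (simp add: cong_iff_dvd_diff)
qed

lemma rho_beta_ab_pow:
  "[rho (a \<otimes> b [^] (u::nat)) = 1] (mod int p)" "[beta (a \<otimes> b [^] u) = int u * beta b] (mod int p)"
  using cong_trans[OF rho_mult[of a "b [^] u"] cong_add[OF rho_a rho_b_pow[of u]]]
    cong_trans[OF beta_mult[of a "b [^] u"] cong_add[OF beta_a beta_pow[of b u]]] by simp_all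


section \<open>Primes greater than three\<close>

theorem beauville_group_ge_5:
  assumes p: "p \<ge> 5" and n: "n \<ge> 2"
  shows "beauville_group (G Mod St n)"
proof (rule beauville_group_FactGroupI[OF St_normal finite_Mod_St])
  let ?x = "a \<otimes> b [^] (2::nat)" and ?y = "a \<otimes> b [^] (4::nat)"
  show "a \<in> carrier G" "b \<in> carrier G" "?x \<in> carrier G" "?y \<in> carrier G"
    by simp_all
  show "generate G {a, b} = carrier G" by (rule generated)
  define H where "H = generate G {?x, ?y}"
  have H: "subgroup H G" unfolding H_def by (rule generate_is_subgroup) auto
  have x: "?x \<in> H" and y: "?y \<in> H" unfolding H_def by (auto intro: generate.incl)
  have "?y = ?x \<otimes> b [^] (2::nat)"
    by (simp add: m_assoc nat_pow_mult)
  moreover have "inv x \<otimes> (x \<otimes> y) = y" if "x \<in> carrier G" "y \<in> carrier G" for x y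
    using that by (simp add: m_assoc[symmetric])
  ultimately have "inv ?x \<otimes> ?y = b [^] (2::nat)"
    by simp
  then have b2: "b [^] (2::nat) \<in> H"
    using subgroup.m_closed[OF H subgroup.m_inv_closed[OF H x] y] by simp
  have "odd p" using p prime_p prime_odd_nat by simp
  then have p': "2 * ((p + 1) div 2) = p + 1" by simp
  have "(b [^] (2::nat)) [^] ((p + 1) div 2) = b [^] (p + 1)"
    by (simp only: nat_pow_pow[OF b_closed] p')
  also have "\<dots> = b" using b_order by simp
  finally have bH: "b \<in> H"
    using subgroup_pow_closed[OF H b2] by metis
  have "?x \<otimes> inv (b [^] (2::nat)) = a"
    by (simp add: m_assoc)
  then have aH: "a \<in> H"
    using subgroup.m_closed[OF H x subgroup.m_inv_closed[OF H b2]] by simp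
  show "generate G {?x, ?y} = carrier G"
    using generateI_ab[OF H_def _ aH bH] H_def by simp
  fix u v g z and i j :: nat
  assume u: "u \<in> {a, b, a \<otimes> b}" and v: "v \<in> {?x, ?y, ?x \<otimes> ?y}" and g: "g \<in> carrier G"
    and z: "z \<in> St n" and eq: "inv g \<otimes> u [^] i \<otimes> g = v [^] j \<otimes> z"
  have vc: "v \<in> carrier G" using v by auto
  \<comment> \<open>In units of \<open>beta b\<close> the coordinates of \<open>v\<close> are \<open>(1, 2)\<close>, \<open>(1, 4)\<close> and \<open>(2, 6)\<close>. These numbers and the differences
    1, 3 and 4 have to be invertible modulo \<open>p\<close>.\<close>
  have nd: "\<not> [1 = 0] (mod int p)" "\<not> [2 = 0] (mod int p)" "\<not> [3 = 0] (mod int p)" "\<not> [4 = 0] (mod int p)"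
    using not_cong_0_of_nat[of 1] not_cong_0_of_nat[of 2] not_cong_0_of_nat[of 3] not_cong_0_of_nat[of 4] p
    by simp_all
  have nd6: "\<not> [6 = 0] (mod int p)"
    using nd(2,3) cong_mult_0_iff[of 2 3] by simp
  have lines: "\<not> [rho v = 0] (mod int p) \<and> \<not> [beta v = 0] (mod int p) \<and> \<not> [beta v = rho v * beta b] (mod int p)"
  proof -
    consider "v = ?x" | "v = ?y" | "v = ?x \<otimes> ?y" using v by blast
    then show ?thesis
    proof cases
      case 1
      then show ?thesis using off_lines[of v 1 2] rho_beta_ab_pow[of 2] nd by simp
    next
      case 2
      then show ?thesis using off_lines[of v 1 4] rho_beta_ab_pow[of 4] nd by simp
    next
      case 3
      have "[rho v = 1 + 1] (mod int p)"
        unfolding 3 by (intro cong_trans[OF rho_mult] cong_add rho_beta_ab_pow) auto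
      moreover have "[beta v = int 2 * beta b + int 4 * beta b] (mod int p)"
        unfolding 3 by (intro cong_trans[OF beta_mult] cong_add rho_beta_ab_pow) auto
      ultimately show ?thesis using off_lines[of v 2 6] nd nd6 by simp
    qed
  qed
  have "z \<in> St 2" using z n St_antimono[of 2 n] by auto
  note sep = separate_off_lines[OF u vc _ _ _ g this eq]
  show "u [^] i \<in> St n"
  proof (cases "n = 2")
    case True
    then show ?thesis using sep(1) lines by blast
  next
    case False
    then have "z \<in> St 3" using z n St_antimono[of 3 n] by auto
    then have "u [^] i = \<one>" using sep(2) lines by blast
    then show ?thesis using one_St by simp
  qed
qed


section \<open>The prime three\<close>

context
  assumes p3: "p = 3"
begin

text \<open>The element \<open>cub\<close> has trivial image in the abelianization, so \<open>x\<^sub>2\<close> and \<open>y\<^sub>2\<close> lie on the lines of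
  \<open>a\<close> and \<open>b\<close>. It is chosen as a power of \<open>a b\<^sup>2\<close>, which has order dividing 9, so that the group
  generated by \<open>x\<^sub>2\<close> and \<open>y\<^sub>2\<close> contains \<open>a b\<^sup>2\<close>, a power of \<open>x\<^sub>2 y\<^sub>2 = (a b\<^sup>2)\<^sup>7\<close>.\<close>

definition ab2 :: 'a where "ab2 = a \<otimes> b [^] (2::nat)"
definition cub :: 'a where "cub = ab2 [^] p"
definition x\<^sub>2 :: 'a where "x\<^sub>2 = cub \<otimes> a"
definition y\<^sub>2 :: 'a where "y\<^sub>2 = b [^] (2::nat) \<otimes> cub"

lemma closed_p3 [simp]: "ab2 \<in> carrier G" "cub \<in> carrier G" "x\<^sub>2 \<in> carrier G" "y\<^sub>2 \<in> carrier G"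
  by (simp_all add: ab2_def cub_def x\<^sub>2_def y\<^sub>2_def)

lemma cub_eq: "cub = ab2 [^] (3::nat)"
  unfolding cub_def by (simp only: p3)

lemma deg_3: "deg = 1"
  using deg_bounds p3 by simp

lemma cong_3: "[3 * k = 0] (mod int p)"
  by (simp add: p3 cong_def)

lemma rho_ab2: "[rho ab2 = 1] (mod int p)" and beta_ab2: "[beta ab2 = 2 * beta b] (mod int p)"
  using rho_beta_ab_pow[of 2] by (simp_all add: ab2_def)

lemma rho_ab2_nonzero: "\<not> [rho ab2 = 0] (mod int p)"
  by (rule not_cong_0_trans[OF rho_ab2 not_cong_1_0])

lemma flat_cub: "flat cub (beta ab2)"
  using p_power_flat(1)[OF closed_p3(1) rho_ab2_nonzero] by (simp add: cub_def)

lemma theta_cub: "\<not> [theta cub = 0] (mod int p)"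
proof
  assume 0: "[theta cub = 0] (mod int p)"
  have "[2 * beta ab2 * beta ab2 = - (rho ab2 * theta cub)] (mod int p)"
    using p_power_flat(2)[OF closed_p3(1) rho_ab2_nonzero] by (simp add: cub_def deg_3 cong_sym_eq)
  also have "[- (rho ab2 * theta cub) = - (rho ab2 * 0)] (mod int p)"
    using 0 by (simp add: cong_0_iff)
  finally have "[2 * beta ab2 * beta ab2 = 0] (mod int p)" by simp
  moreover have "\<not> [2 = 0] (mod int p)" by (simp add: p3 cong_def)
  moreover have "\<not> [beta ab2 = 0] (mod int p)"
    using not_cong_0_trans[OF beta_ab2] calculation(2) beta_b by (simp add: cong_mult_0_iff)
  ultimately show False by (simp add: cong_mult_0_iff)
qed

lemma rho_cub: "[rho cub = 0] (mod int p)"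
  using flat_cub by (simp add: flat_def)

lemma beta_cub: "[beta cub = 0] (mod int p)"
  using beta_pow[OF closed_p3(1), of p] by (simp add: cub_def cong_def)

lemma rho_x\<^sub>2: "[rho x\<^sub>2 = 1] (mod int p)" and beta_x\<^sub>2: "[beta x\<^sub>2 = 0] (mod int p)"
  using cong_trans[OF rho_mult[OF closed_p3(2) a_closed] cong_add[OF rho_cub rho_a]]
    cong_trans[OF beta_mult[OF closed_p3(2) a_closed] cong_add[OF beta_cub beta_a]]
  by (simp_all add: x\<^sub>2_def)

lemma rho_y\<^sub>2: "[rho y\<^sub>2 = 0] (mod int p)" and beta_y\<^sub>2: "[beta y\<^sub>2 = 2 * beta b] (mod int p)"
  using cong_trans[OF rho_mult[of "b [^] (2::nat)" cub] cong_add[OF rho_b_pow[of 2] rho_cub]]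
    cong_trans[OF beta_mult[of "b [^] (2::nat)" cub] cong_add[OF beta_pow[of b 2] beta_cub]]
  by (simp_all add: y\<^sub>2_def)

lemma x\<^sub>2_y\<^sub>2: "x\<^sub>2 \<otimes> y\<^sub>2 = ab2 [^] (7::nat)"
proof -
  have "x\<^sub>2 \<otimes> y\<^sub>2 = ab2 [^] (3::nat) \<otimes> ab2 \<otimes> ab2 [^] (3::nat)"
    unfolding x\<^sub>2_def y\<^sub>2_def cub_eq by (simp add: ab2_def m_assoc)
  also have "\<dots> = ab2 [^] (4::nat) \<otimes> ab2 [^] (3::nat)"
    using nat_pow_Suc[of ab2 3, symmetric] by simp
  also have "\<dots> = ab2 [^] (7::nat)"
    by (simp add: nat_pow_mult)
  finally show ?thesis .
qed

lemma generate_x\<^sub>2_y\<^sub>2: "generate G {x\<^sub>2, y\<^sub>2} = carrier G"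
proof -
  define H where "H = generate G {x\<^sub>2, y\<^sub>2}"
  have H: "subgroup H G" unfolding H_def by (rule generate_is_subgroup) auto
  have x: "x\<^sub>2 \<in> H" and y: "y\<^sub>2 \<in> H" unfolding H_def by (auto intro: generate.incl)
  have w9: "ab2 [^] (9::nat) = \<one>" using ab_pow_order[of 2] by (simp add: ab2_def p3)
  \<comment> \<open>Modulo 9 the inverse of 7 is 4.\<close>
  have "(ab2 [^] (7::nat)) [^] (4::nat) = ab2 [^] (27 + 1 :: nat)"
    by (simp add: nat_pow_pow)
  also have "\<dots> = ab2 [^] (27::nat) \<otimes> ab2"
    by (simp only: nat_pow_mult[symmetric, OF closed_p3(1)] nat_pow_eone[OF closed_p3(1)])
  also have "ab2 [^] (27::nat) = \<one>"
    by (rule pow_multiple_order[OF closed_p3(1) w9]) simp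
  finally have "(ab2 [^] (7::nat)) [^] (4::nat) = ab2" by simp
  then have wH: "ab2 \<in> H"
    using subgroup_pow_closed[OF H subgroup.m_closed[OF H x y], of 4] by (simp add: x\<^sub>2_y\<^sub>2)
  then have cH: "cub \<in> H" unfolding cub_def by (rule subgroup_pow_closed[OF H])
  note icH = subgroup.m_inv_closed[OF H cH]
  have "inv cub \<otimes> x\<^sub>2 = a" by (simp add: x\<^sub>2_def m_assoc[symmetric])
  then have aH: "a \<in> H" using subgroup.m_closed[OF H icH x] by simp
  have "y\<^sub>2 \<otimes> inv cub = b [^] (2::nat)" by (simp add: y\<^sub>2_def m_assoc)
  then have b2: "b [^] (2::nat) \<in> H" using subgroup.m_closed[OF H y icH] by simp
  have "(b [^] (2::nat)) [^] (2::nat) = b [^] (3 + 1 :: nat)" by (simp add: nat_pow_pow)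
  also have "\<dots> = b [^] (3::nat) \<otimes> b"
    by (simp only: nat_pow_mult[symmetric, OF b_closed] nat_pow_eone[OF b_closed])
  also have "\<dots> = b" using b_order by (simp add: p3)
  finally have bH: "b \<in> H" using subgroup_pow_closed[OF H b2, of 2] by simp
  show ?thesis using generateI_ab[OF H_def _ aH bH] by (simp add: H_def)
qed

lemma sec_x\<^sub>2: "sec x\<^sub>2 k = sec cub k"
  by (simp add: x\<^sub>2_def sec_mult_stab rho_cub)

lemma theta_cub_sum: "theta cub = (\<Sum>k\<in>{0..<int p}. gamma (sec cub k))"
  unfolding theta_def deg_3 by (simp add: moment_0)

text \<open>For \<open>p = 3\<close> the invariant \<open>theta\<close> is the plain sum of the values \<open>gamma\<close> of the sections. The sections of
  \<open>x\<^sub>2\<close> are those of \<open>cub\<close> and have shift \<open>0\<close>, so \<open>gamma\<close> is additive on their products.\<close>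

lemma sum_gamma_x\<^sub>2_pow:
  "[(\<Sum>k\<in>{0..<int p}. gamma (sec (x\<^sub>2 [^] (j::nat)) k)) = int j * theta cub] (mod int p)"
  "[rho (sec (x\<^sub>2 [^] j) k) = 0] (mod int p)"
proof -
  let ?S = "{x \<in> carrier G. [rho x = 0] (mod int p)}"
  have cub: "[rho (sec cub k) = 0] (mod int p)" for k
    using flat_cub by (simp add: flat_def)
  have orb: "sec (x\<^sub>2 [^] j) k \<in> ?S \<and>
      [gamma (sec (x\<^sub>2 [^] j) k) = (\<Sum>l<j. gamma (sec x\<^sub>2 (k + int l * rho x\<^sub>2)))] (mod int p)" for k
    by (rule orbit_sum[OF closed_p3(3) _ _ gamma_additive_stab]) (simp_all add: sec_x\<^sub>2 cub rho_one)
  then show "[rho (sec (x\<^sub>2 [^] j) k) = 0] (mod int p)" by blast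
  have "[(\<Sum>k\<in>{0..<int p}. gamma (sec (x\<^sub>2 [^] j) k))
      = (\<Sum>k\<in>{0..<int p}. \<Sum>l<j. gamma (sec cub (k + int l * rho x\<^sub>2)))] (mod int p)"
    using orb by (intro cong_sum) (simp add: sec_x\<^sub>2)
  also have "(\<Sum>k\<in>{0..<int p}. \<Sum>l<j. gamma (sec cub (k + int l * rho x\<^sub>2)))
      = (\<Sum>l<j. \<Sum>k\<in>{0..<int p}. gamma (sec cub (k + int l * rho x\<^sub>2)))"
    by (rule sum.swap)
  also have "[\<dots> = (\<Sum>l<j. theta cub)] (mod int p)"
    unfolding theta_cub_sum by (intro cong_sum sum_shift mod_periodic_sec p_pos)
  finally show "[(\<Sum>k\<in>{0..<int p}. gamma (sec (x\<^sub>2 [^] j) k)) = int j * theta cub] (mod int p)"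
    by simp
qed

text \<open>The sections of \<open>((a b)\<^sup>p)\<^sup>m\<close> have \<open>beta\<close> equal to \<open>m beta b\<close>, which conjugation preserves.\<close>

lemma ab_p_power_beta:
  assumes g: "g \<in> carrier G" and eq: "inv g \<otimes> (a \<otimes> b) [^] (p * m) \<otimes> g = t"
    and t: "[beta (sec t 0) = 0] (mod int p)"
  shows "(a \<otimes> b) [^] (p * m) = \<one>"
proof -
  let ?u = "a \<otimes> b"
  have u: "?u \<in> carrier G" by simp
  have ru: "\<not> [rho ?u = 0] (mod int p)"
    by (rule not_cong_0_trans[OF rho_ab not_cong_1_0])
  note f = flat_pow_flat[OF p_power_flat(1)[OF u ru], of m]
  have "[int m * beta ?u = beta (sec t 0)] (mod int p)"
    using theta_conj(2)[OF f g, of 0] eq by (simp add: nat_pow_pow cong_sym_eq)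
  then have "[int m * beta ?u = 0] (mod int p)"
    using t by (rule cong_trans)
  then have "p dvd m"
    using not_cong_0_trans[OF beta_ab beta_b] by (simp add: cong_mult_0_iff) (simp add: cong_0_iff)
  then have "p * p dvd p * m" by simp
  then show ?thesis
    using pow_multiple_order[OF u, of "p * p" "p * m"] ab_pow_order[of 1] by simp
qed

text \<open>On the line of \<open>a\<close> the elements are distinguished by their cubes: those of conjugates of powers of \<open>a\<close>
  are trivial, while \<open>gamma\<close> on the sections of the cube of \<open>x\<^sub>2\<^sup>j\<close> is \<open>j theta cub\<close>.
  The lines of \<open>b\<close> and \<open>a b\<close> do not contain \<open>x\<^sub>2\<close>, and \<open>x\<^sub>2\<^sup>3\<close> has \<open>beta = 0\<close> on all sections.\<close>

lemma separate_x\<^sub>2: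
  assumes u: "u \<in> {a, b, a \<otimes> b}" and g: "g \<in> carrier G" and z: "z \<in> St 3"
    and eq: "inv g \<otimes> u [^] (i::nat) \<otimes> g = x\<^sub>2 [^] (j::nat) \<otimes> z"
  shows "u [^] i = \<one>"
proof -
  have uc: "u \<in> carrier G" using u by auto
  have z2: "z \<in> St 2" using z St_antimono[of 2 3] by auto
  have zc: "z \<in> carrier G" using z by (rule St_carrier)
  note rb = conj_pow_rho_beta[OF uc closed_p3(3) g z2 eq]
  have i_j: "[int i * rho u = int j] (mod int p)"
    using cong_trans[OF rb(1) cong_mult[OF cong_refl rho_x\<^sub>2]] by simp
  have i_0: "[int i * beta u = 0] (mod int p)"
    using cong_trans[OF rb(2) cong_mult[OF cong_refl beta_x\<^sub>2]] by simp
  consider "u = a" | "u = b" | "u = a \<otimes> b" using u by blast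
  then show ?thesis
  proof cases
    case 1
    let ?t = "x\<^sub>2 [^] j \<otimes> z"
    have t: "?t \<in> carrier G" using zc by simp
    have "[int i * 1 = int i * rho a] (mod int p)"
      by (intro cong_mult cong_refl cong_sym[OF rho_a])
    then have ij: "[int i = int j] (mod int p)"
      using i_j 1 by (simp add: cong_def)
    have "p dvd i"
    proof (rule ccontr)
      assume "\<not> p dvd i"
      then have i0: "\<not> [int i = 0] (mod int p)" by (simp add: cong_0_iff)
      then have j0: "\<not> [int j = 0] (mod int p)" using ij by (simp add: cong_def)
      have "[rho ?t = int j * 1 + 0] (mod int p)"
        using zc by (intro cong_trans[OF rho_mult] cong_add cong_trans[OF rho_pow]
            cong_mult cong_refl rho_x\<^sub>2 St_2_trivial(1)[OF z2]) auto
      then have rt: "\<not> [rho ?t = 0] (mod int p)"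
        using not_cong_0_trans[OF _ j0] by simp
      have "[rho (sec ?t k) = 0] (mod int p)" for k
        using cong_trans[OF sec_mult_St_3(1)[OF _ z] sum_gamma_x\<^sub>2_pow(2)] by simp
      then have "[gamma (sec (?t [^] p) 0) = (\<Sum>k\<in>{0..<int p}. gamma (sec ?t k))] (mod int p)"
        by (intro orbit_sum_full[OF t rt _ _ gamma_additive_stab]) (simp_all add: t rho_one)
      also have "[(\<Sum>k\<in>{0..<int p}. gamma (sec ?t k)) = (\<Sum>k\<in>{0..<int p}. gamma (sec (x\<^sub>2 [^] j) k))] (mod int p)"
        by (intro cong_sum sec_mult_St_3(3)[OF _ z]) simp
      also have "[(\<Sum>k\<in>{0..<int p}. gamma (sec (x\<^sub>2 [^] j) k)) = int j * theta cub] (mod int p)"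
        by (rule sum_gamma_x\<^sub>2_pow(1))
      finally have "[gamma (sec (?t [^] p) 0) = int j * theta cub] (mod int p)" .
      moreover have "?t [^] p = \<one>"
      proof -
        have "(a [^] i) [^] p = \<one>"
          using a_order by (simp add: nat_pow_pow pow_multiple_order[of a p])
        then show ?thesis
          using conj_pow[of "a [^] i" g p] g eq 1 by simp
      qed
      ultimately have "[int j * theta cub = 0] (mod int p)"
        using gamma_one by (simp add: cong_def)
      then show False using j0 theta_cub by (simp add: cong_mult_0_iff)
    qed
    then show ?thesis using pow_multiple_order[OF a_closed a_order] 1 by simp
  next
    case 2
    then have "p dvd i" using i_0 beta_b by (simp add: cong_mult_0_iff) (simp add: cong_0_iff)
    then show ?thesis using pow_multiple_order[OF b_closed b_order] 2 by simp
  next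
    case 3
    then have i: "[int i = 0] (mod int p)"
      using i_0 not_cong_0_trans[OF beta_ab beta_b] by (simp add: cong_mult_0_iff)
    have "[int i * rho u = 0] (mod int p)" using i by (simp add: cong_mult_0_iff)
    then have "[int j = 0] (mod int p)" using i_j by (simp add: cong_def)
    with i obtain m n where mn: "i = p * m" "j = p * n"
      by (auto simp: cong_0_iff elim!: dvdE)
    have rx: "\<not> [rho x\<^sub>2 = 0] (mod int p)"
      by (rule not_cong_0_trans[OF rho_x\<^sub>2 not_cong_1_0])
    have "[beta (sec (x\<^sub>2 [^] j \<otimes> z) 0) = beta (sec (x\<^sub>2 [^] j) 0)] (mod int p)"
      by (rule sec_mult_St_3(2)[OF _ z]) simp
    also have "[beta (sec (x\<^sub>2 [^] j) 0) = int n * beta x\<^sub>2] (mod int p)"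
      using flat_pow(1)[OF p_power_flat(1)[OF closed_p3(3) rx]] by (simp add: mn nat_pow_pow)
    also have "[int n * beta x\<^sub>2 = int n * 0] (mod int p)"
      by (intro cong_mult cong_refl beta_x\<^sub>2)
    finally show ?thesis
      using ab_p_power_beta[OF g] eq by (simp add: 3 mn)
  qed
qed

lemma beta_sec_y\<^sub>2:
  "[beta (sec y\<^sub>2 k) = 2 * (if int p dvd k then beta b else 0) + 2 * beta b] (mod int p)"
proof -
  have "sec y\<^sub>2 k = sec b k [^] (2::nat) \<otimes> sec cub k"
    by (simp add: y\<^sub>2_def sec_mult_stab rho_b_pow sec_pow_stab rho_b)
  moreover have "[beta (sec b k [^] (2::nat) \<otimes> sec cub k) = beta (sec b k [^] (2::nat)) + beta (sec cub k)] (mod int p)"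
    by (intro beta_mult) auto
  moreover have "[beta (sec b k [^] (2::nat)) = int 2 * (if int p dvd k then beta b else 0)] (mod int p)"
    by (intro cong_trans[OF beta_pow] cong_mult cong_refl beta_sec_b) auto
  moreover have "[beta (sec cub k) = beta ab2] (mod int p)"
    using flat_cub by (simp add: flat_def)
  ultimately show ?thesis
    using cong_trans[OF _ cong_add[OF _ cong_trans[OF _ beta_ab2]]] by simp
qed

text \<open>On the line of \<open>b\<close> the sum of the squares of \<open>beta\<close> over the sections is a conjugacy
  invariant. In units of \<open>beta b\<close> the values on the sections are 1, 0, 0 for \<open>b\<close> and 4, 2, 2 for \<open>y\<^sub>2\<close>, so the
  sums are 1 and 24, and the latter is 0 modulo 3.\<close>

lemma separate_y\<^sub>2:
  assumes u: "u \<in> {a, b, a \<otimes> b}" and g: "g \<in> carrier G" and z: "z \<in> St 3"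
    and eq: "inv g \<otimes> u [^] (i::nat) \<otimes> g = y\<^sub>2 [^] (j::nat) \<otimes> z"
  shows "u [^] i = \<one>"
proof -
  have uc: "u \<in> carrier G" using u by auto
  have z2: "z \<in> St 2" using z St_antimono[of 2 3] by auto
  note rb = conj_pow_rho_beta[OF uc closed_p3(4) g z2 eq]
  have i_0: "[int i * rho u = 0] (mod int p)"
    using cong_trans[OF rb(1) cong_mult[OF cong_refl rho_y\<^sub>2]] by simp
  have sec_y: "[beta (sec (y\<^sub>2 [^] j \<otimes> z) k) = int j * beta (sec y\<^sub>2 k)] (mod int p)" for k
  proof -
    have "[beta (sec (y\<^sub>2 [^] j \<otimes> z) k) = beta (sec (y\<^sub>2 [^] j) k)] (mod int p)"
      by (rule sec_mult_St_3(2)[OF _ z]) simp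
    also have "[beta (sec (y\<^sub>2 [^] j) k) = int j * beta (sec y\<^sub>2 k)] (mod int p)"
      using beta_pow[of "sec y\<^sub>2 k" j] by (simp add: sec_pow_stab rho_y\<^sub>2)
    finally show ?thesis .
  qed
  consider "u = a" | "u = b" | "u = a \<otimes> b" using u by blast
  then show ?thesis
  proof cases
    case 1
    have "p dvd i"
      using i_0 not_cong_0_trans[OF rho_a not_cong_1_0] 1 by (simp add: cong_mult_0_iff) (simp add: cong_0_iff)
    then show ?thesis using pow_multiple_order[OF a_closed a_order] 1 by simp
  next
    case 2
    let ?t = "y\<^sub>2 [^] j \<otimes> z" and ?q = "\<lambda>x. beta x * beta x"
    have three: "{0..<int p} = {0, 1, 2}" by (auto simp: p3)
    have nd: "\<not> int p dvd 1" "\<not> int p dvd 2" by (simp_all add: p3)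
    have "[?q (sec ?t (k + rho g)) = ?q (sec (b [^] i) k)] (mod int p)" for k
    proof -
      have "sec ?t (k + rho g) = inv (sec g k) \<otimes> sec (b [^] i) k \<otimes> sec g k"
        using sec_conj(1)[OF _ g rho_b_pow] eq 2 by (metis b_closed nat_pow_closed)
      then have "[beta (sec ?t (k + rho g)) = beta (sec (b [^] i) k)] (mod int p)"
        using additive_conj[of beta "sec (b [^] i) k" "sec g k"] beta_mult g by simp
      then show ?thesis by (intro cong_mult)
    qed
    then have "[(\<Sum>k\<in>{0..<int p}. ?q (sec ?t (k + rho g))) = (\<Sum>k\<in>{0..<int p}. ?q (sec (b [^] i) k))] (mod int p)"
      by (rule cong_sum)
    moreover have "[(\<Sum>k\<in>{0..<int p}. ?q (sec ?t (k + rho g))) = (\<Sum>k\<in>{0..<int p}. ?q (sec ?t k))] (mod int p)"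
      by (rule sum_shift[OF mod_periodic_sec p_pos])
    moreover have "[(\<Sum>k\<in>{0..<int p}. ?q (sec (b [^] i) k)) = int i * beta b * (int i * beta b)] (mod int p)"
    proof -
      have "[beta (sec (b [^] i) k) = int i * (if int p dvd k then beta b else 0)] (mod int p)" for k
        using cong_trans[OF beta_pow[of "sec b k" i] cong_mult[OF cong_refl beta_sec_b]]
        by (simp add: sec_pow_stab rho_b)
      then have "[(\<Sum>k\<in>{0..<int p}. ?q (sec (b [^] i) k)) = (\<Sum>k\<in>{0..<int p}.
          (int i * (if int p dvd k then beta b else 0)) * (int i * (if int p dvd k then beta b else 0)))] (mod int p)"
        by (intro cong_sum cong_mult)
      then show ?thesis using nd by (simp add: three)
    qed
    moreover have "[(\<Sum>k\<in>{0..<int p}. ?q (sec ?t k)) = 0] (mod int p)"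
    proof -
      have "[beta (sec ?t k) = int j * (2 * (if int p dvd k then beta b else 0) + 2 * beta b)] (mod int p)" for k
        using cong_trans[OF sec_y cong_mult[OF cong_refl beta_sec_y\<^sub>2]] .
      then have "[(\<Sum>k\<in>{0..<int p}. ?q (sec ?t k)) = (\<Sum>k\<in>{0..<int p}.
          (int j * (2 * (if int p dvd k then beta b else 0) + 2 * beta b)) *
          (int j * (2 * (if int p dvd k then beta b else 0) + 2 * beta b)))] (mod int p)"
        by (intro cong_sum cong_mult)
      also have "(\<Sum>k\<in>{0..<int p}.
          (int j * (2 * (if int p dvd k then beta b else 0) + 2 * beta b)) *
          (int j * (2 * (if int p dvd k then beta b else 0) + 2 * beta b))) = 3 * (8 * int j * int j * beta b * beta b)"
        using nd by (simp add: three algebra_simps)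
      also have "[\<dots> = 0] (mod int p)" by (rule cong_3)
      finally show ?thesis .
    qed
    ultimately have "[int i * beta b * (int i * beta b) = 0] (mod int p)"
      by (simp add: cong_def)
    then have "p dvd i" using beta_b by (simp add: cong_mult_0_iff) (simp add: cong_0_iff)
    then show ?thesis using pow_multiple_order[OF b_closed b_order] 2 by simp
  next
    case 3
    have i: "[int i = 0] (mod int p)"
      using i_0 not_cong_0_trans[OF rho_ab not_cong_1_0] 3 by (simp add: cong_mult_0_iff)
    have "[int j * (2 * beta b) = int j * beta y\<^sub>2] (mod int p)"
      by (intro cong_mult cong_refl cong_sym[OF beta_y\<^sub>2])
    also have "[int j * beta y\<^sub>2 = int i * beta u] (mod int p)"
      by (rule cong_sym[OF rb(2)])
    also have "[int i * beta u = 0] (mod int p)"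
      using i by (simp add: cong_mult_0_iff)
    finally have j: "[int j = 0] (mod int p)"
      using beta_b by (simp add: cong_mult_0_iff) (simp add: p3 cong_def)
    obtain m where m: "i = p * m" using i by (auto simp: cong_0_iff elim!: dvdE)
    have "[int j * beta (sec y\<^sub>2 0) = 0] (mod int p)"
      using j by (simp add: cong_mult_0_iff)
    then have "[beta (sec (y\<^sub>2 [^] j \<otimes> z) 0) = 0] (mod int p)"
      by (rule cong_trans[OF sec_y])
    then show ?thesis
      using ab_p_power_beta[OF g] eq by (simp add: 3 m)
  qed
qed

theorem beauville_group_3:
  assumes n: "n \<ge> 3"
  shows "beauville_group (G Mod St n)"
proof (rule beauville_group_FactGroupI[OF St_normal finite_Mod_St a_closed b_closed closed_p3(3,4)
      generated generate_x\<^sub>2_y\<^sub>2])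
  fix u v g z and i j :: nat
  assume u: "u \<in> {a, b, a \<otimes> b}" and v: "v \<in> {x\<^sub>2, y\<^sub>2, x\<^sub>2 \<otimes> y\<^sub>2}" and g: "g \<in> carrier G"
    and "z \<in> St n" and eq: "inv g \<otimes> u [^] i \<otimes> g = v [^] j \<otimes> z"
  then have z: "z \<in> St 3" using n St_antimono[of 3 n] by auto
  then have z2: "z \<in> St 2" using St_antimono[of 2 3] by auto
  have "u [^] i = \<one>"
  proof -
    consider "v = x\<^sub>2" | "v = y\<^sub>2" | "v = ab2 [^] (7::nat)" using v by (auto simp: x\<^sub>2_y\<^sub>2)
    then show ?thesis
    proof cases
      case 1
      then show ?thesis using separate_x\<^sub>2[OF u g z] eq by simp
    next
      case 2
      then show ?thesis using separate_y\<^sub>2[OF u g z] eq by simp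
    next
      case 3
      have r: "[rho v = int 7 * 1] (mod int p)"
        unfolding 3 by (intro cong_trans[OF rho_pow] cong_mult cong_refl rho_ab2) simp
      have b: "[beta v = int 7 * (2 * beta b)] (mod int p)"
        unfolding 3 by (intro cong_trans[OF beta_pow] cong_mult cong_refl beta_ab2) simp
      have "v \<in> carrier G" using 3 by simp
      have "\<not> [7 = 0] (mod int p)" "\<not> [14 = 0] (mod int p)" by (simp_all add: p3 cong_def)
      then have "\<not> [rho v = 0] (mod int p)" "\<not> [beta v = 0] (mod int p)"
        "\<not> [beta v = rho v * beta b] (mod int p)"
        using off_lines[of v 7 14] r b by simp_all
      then show ?thesis
        using separate_off_lines(2)[OF u \<open>v \<in> carrier G\<close> _ _ _ g z2 eq z] by blast
    qed
  qed
  then show "u [^] i \<in> St n" using one_St by simp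
qed

end

end

section \<open>The sections of a tree automorphism\<close>

text \<open>The representative of \<open>k\<close> in \<open>{1..p}\<close>. In particular the coordinate \<open>0\<close> is represented by \<open>p\<close>, the letter at
  which \<open>b\<close> repeats itself.\<close>

definition letter :: "nat \<Rightarrow> int \<Rightarrow> nat" where
  "letter p k = Suc (nat ((k - 1) mod int p))"

text \<open>As the letter \<open>p\<close> has coordinate \<open>0\<close>, its image is the amount of the shift.\<close>

definition root_shift :: "nat \<Rightarrow> (nat list \<Rightarrow> nat list) \<Rightarrow> int" where
  "root_shift p g = int (hd (g [p]))"

definition tree_section :: "nat \<Rightarrow> (nat list \<Rightarrow> nat list) \<Rightarrow> int \<Rightarrow> nat list \<Rightarrow> nat list" where
  "tree_section p g k = psi p g (letter p k)"

definition acts_by_shift :: "nat \<Rightarrow> (nat list \<Rightarrow> nat list) \<Rightarrow> int \<Rightarrow> bool" where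
  "acts_by_shift p g r \<longleftrightarrow>
     (\<forall>k\<in>{1..p}. \<forall>w\<in>vertices p. g (k # w) = letter p (int k + r) # psi p g k w)"

lemma letter_range: "p > 0 \<Longrightarrow> letter p k \<in> {1..p}"
  by (simp add: letter_def Suc_le_eq nat_less_iff)

lemma int_letter: "p > 0 \<Longrightarrow> int (letter p k) = (k - 1) mod int p + 1"
  by (simp add: letter_def)

lemma letter_cong: "[k = l] (mod int p) \<Longrightarrow> letter p k = letter p l"
  unfolding letter_def by (metis cong_def mod_diff_left_eq)

lemma cong_letter: "p > 0 \<Longrightarrow> [int (letter p k) = k] (mod int p)"
  unfolding int_letter cong_def by (metis diff_add_cancel mod_add_left_eq)

lemma letter_id: "k \<in> {1..p} \<Longrightarrow> letter p (int k) = k"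
proof -
  assume k: "k \<in> {1..p}"
  then have "(int k - 1) mod int p = int k - 1"
    by (intro mod_pos_pos_trivial) auto
  then show ?thesis using k by (simp add: letter_def nat_diff_distrib)
qed

lemma letter_letter_add: "p > 0 \<Longrightarrow> letter p (int (letter p k) + r) = letter p (k + r)"
  by (intro letter_cong cong_add cong_letter) auto

lemma psi_extensional: "psi p g k \<in> extensional (vertices p)"
  by (simp add: psi_def)

lemma tree_automorphism_extensional: "g \<in> tree_automorphisms p \<Longrightarrow> g \<in> extensional (vertices p)"
  by (simp add: tree_automorphisms_def)

lemma aut_mult_apply: "v \<in> vertices p \<Longrightarrow> (f \<otimes>\<^bsub>aut_tree p\<^esub> g) v = g (f v)"
  by (simp add: mult_aut_tree compose_eq)

lemma acts_by_shift_cong: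
  "\<lbrakk>acts_by_shift p g r; [r = s] (mod int p)\<rbrakk> \<Longrightarrow> acts_by_shift p g s"
  unfolding acts_by_shift_def by (metis cong_add_lcancel letter_cong)

lemma root_shift_cong:
  assumes "p > 0" "acts_by_shift p g r"
  shows "[root_shift p g = r] (mod int p)"
proof -
  have "g [p] = letter p (int p + r) # psi p g p []"
    using assms by (simp add: acts_by_shift_def)
  then have "root_shift p g = int (letter p (int p + r))"
    by (simp add: root_shift_def)
  also have "[int (letter p (int p + r)) = int p + r] (mod int p)"
    by (rule cong_letter[OF assms(1)])
  also have "[int p + r = r] (mod int p)"
    by (simp add: cong_def)
  finally show ?thesis .
qed

lemma acts_by_shift_mult:
  assumes p: "p > 0" and g: "acts_by_shift p g r" "\<forall>k\<in>{1..p}. psi p g k \<in> tree_automorphisms p"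
    and h: "acts_by_shift p h s"
  shows "acts_by_shift p (g \<otimes>\<^bsub>aut_tree p\<^esub> h) (r + s)"
    and "k \<in> {1..p} \<Longrightarrow>
      psi p (g \<otimes>\<^bsub>aut_tree p\<^esub> h) k = psi p g k \<otimes>\<^bsub>aut_tree p\<^esub> psi p h (letter p (int k + r))"
proof -
  have *: "(g \<otimes>\<^bsub>aut_tree p\<^esub> h) (k # w) =
      letter p (int k + (r + s)) # psi p h (letter p (int k + r)) (psi p g k w)"
    if "k \<in> {1..p}" "w \<in> vertices p" for k w
  proof -
    have "psi p g k w \<in> vertices p"
      using g(2)[rule_format, OF that(1)] that(2) by (rule tree_automorphism_closed)
    moreover have "(g \<otimes>\<^bsub>aut_tree p\<^esub> h) (k # w) = h (letter p (int k + r) # psi p g k w)"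
      using that g(1) by (simp add: aut_mult_apply acts_by_shift_def)
    ultimately have "(g \<otimes>\<^bsub>aut_tree p\<^esub> h) (k # w) =
        letter p (int (letter p (int k + r)) + s) # psi p h (letter p (int k + r)) (psi p g k w)"
      using h letter_range[OF p, of "int k + r"] unfolding acts_by_shift_def by simp
    then show ?thesis by (simp only: letter_letter_add[OF p] add.assoc)
  qed
  show psi: "psi p (g \<otimes>\<^bsub>aut_tree p\<^esub> h) k = psi p g k \<otimes>\<^bsub>aut_tree p\<^esub> psi p h (letter p (int k + r))"
    if "k \<in> {1..p}" for k
  proof (rule extensionalityI[of _ "vertices p"])
    show "psi p (g \<otimes>\<^bsub>aut_tree p\<^esub> h) k \<in> extensional (vertices p)"
      by (rule psi_extensional)
    show "psi p g k \<otimes>\<^bsub>aut_tree p\<^esub> psi p h (letter p (int k + r)) \<in> extensional (vertices p)"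
      by (simp add: mult_aut_tree)
    fix w assume w: "w \<in> vertices p"
    show "psi p (g \<otimes>\<^bsub>aut_tree p\<^esub> h) k w =
        (psi p g k \<otimes>\<^bsub>aut_tree p\<^esub> psi p h (letter p (int k + r))) w"
      unfolding aut_mult_apply[OF w] using *[OF that w] w by (simp add: psi_def[of p "g \<otimes>\<^bsub>aut_tree p\<^esub> h"])
  qed
  show "acts_by_shift p (g \<otimes>\<^bsub>aut_tree p\<^esub> h) (r + s)"
    unfolding acts_by_shift_def using * psi by (simp add: aut_mult_apply)
qed

lemma aut_inv_apply:
  assumes "g \<in> tree_automorphisms p" "v \<in> vertices p"
  shows "(inv\<^bsub>aut_tree p\<^esub> g) (g v) = v" "g ((inv\<^bsub>aut_tree p\<^esub> g) v) = v"
    "(inv\<^bsub>aut_tree p\<^esub> g) v \<in> vertices p"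
proof -
  interpret A: group "aut_tree p" by (rule group_aut_tree)
  have g: "g \<in> carrier (aut_tree p)" using assms(1) by simp
  show "(inv\<^bsub>aut_tree p\<^esub> g) (g v) = v"
    using fun_cong[OF A.r_inv[OF g], of v] assms(2) by (simp add: aut_mult_apply one_aut_tree)
  show "g ((inv\<^bsub>aut_tree p\<^esub> g) v) = v"
    using fun_cong[OF A.l_inv[OF g], of v] assms(2) by (simp add: aut_mult_apply one_aut_tree)
  have "inv\<^bsub>aut_tree p\<^esub> g \<in> tree_automorphisms p"
    using A.inv_closed[OF g] by simp
  then show "(inv\<^bsub>aut_tree p\<^esub> g) v \<in> vertices p"
    using assms(2) by (rule tree_automorphism_closed)
qed

lemma acts_by_shift_inv:
  assumes p: "p > 0" and gc: "g \<in> tree_automorphisms p"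
    and g: "acts_by_shift p g r" "\<forall>k\<in>{1..p}. psi p g k \<in> tree_automorphisms p"
  shows "acts_by_shift p (inv\<^bsub>aut_tree p\<^esub> g) (- r)"
    and "k \<in> {1..p} \<Longrightarrow> psi p (inv\<^bsub>aut_tree p\<^esub> g) k = inv\<^bsub>aut_tree p\<^esub> (psi p g (letter p (int k - r)))"
proof -
  interpret A: group "aut_tree p" by (rule group_aut_tree)
  have *: "(inv\<^bsub>aut_tree p\<^esub> g) (k # w) =
      letter p (int k - r) # (inv\<^bsub>aut_tree p\<^esub> (psi p g (letter p (int k - r)))) w"
    if k: "k \<in> {1..p}" and w: "w \<in> vertices p" for k w
  proof -
    let ?k = "letter p (int k - r)"
    let ?w = "(inv\<^bsub>aut_tree p\<^esub> (psi p g ?k)) w"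
    have k': "?k \<in> {1..p}" by (rule letter_range[OF p])
    note i = aut_inv_apply[OF g(2)[rule_format, OF k'] w]
    have "g (?k # ?w) = letter p (int ?k + r) # psi p g ?k ?w"
      using g(1) k' i(3) unfolding acts_by_shift_def by blast
    also have "\<dots> = k # w"
      using letter_letter_add[OF p, of "int k - r" r] letter_id[OF k] i(2) by simp
    finally have "(inv\<^bsub>aut_tree p\<^esub> g) (g (?k # ?w)) = (inv\<^bsub>aut_tree p\<^esub> g) (k # w)" by simp
    then show ?thesis
      using aut_inv_apply(1)[OF gc, of "?k # ?w"] k' i(3) by simp
  qed
  show psi: "psi p (inv\<^bsub>aut_tree p\<^esub> g) k = inv\<^bsub>aut_tree p\<^esub> (psi p g (letter p (int k - r)))"
    if "k \<in> {1..p}" for k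
  proof (rule extensionalityI[of _ "vertices p"])
    show "psi p (inv\<^bsub>aut_tree p\<^esub> g) k \<in> extensional (vertices p)"
      by (rule psi_extensional)
    have "inv\<^bsub>aut_tree p\<^esub> (psi p g (letter p (int k - r))) \<in> tree_automorphisms p"
      using A.inv_closed g(2)[rule_format, OF letter_range[OF p]] by simp
    then show "inv\<^bsub>aut_tree p\<^esub> (psi p g (letter p (int k - r))) \<in> extensional (vertices p)"
      by (rule tree_automorphism_extensional)
    fix w assume w: "w \<in> vertices p"
    show "psi p (inv\<^bsub>aut_tree p\<^esub> g) k w = (inv\<^bsub>aut_tree p\<^esub> (psi p g (letter p (int k - r)))) w"
      using *[OF that w] w by (simp add: psi_def[of p "inv\<^bsub>aut_tree p\<^esub> g"])
  qed
  show "acts_by_shift p (inv\<^bsub>aut_tree p\<^esub> g) (- r)"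
    unfolding acts_by_shift_def using * psi by simp
qed

lemma acts_by_shift_one:
  "acts_by_shift p \<one>\<^bsub>aut_tree p\<^esub> 0" "k \<in> {1..p} \<Longrightarrow> psi p \<one>\<^bsub>aut_tree p\<^esub> k = \<one>\<^bsub>aut_tree p\<^esub>"
proof -
  show psi: "psi p \<one>\<^bsub>aut_tree p\<^esub> k = \<one>\<^bsub>aut_tree p\<^esub>" if "k \<in> {1..p}" for k
    using that by (auto simp: psi_def one_aut_tree restrict_def)
  show "acts_by_shift p \<one>\<^bsub>aut_tree p\<^esub> 0"
    unfolding acts_by_shift_def using psi letter_id by (simp add: one_aut_tree)
qed

lemma acts_by_shift_a:
  assumes p: "p > 0"
  shows "acts_by_shift p (ggs_a p) 1" "k \<in> {1..p} \<Longrightarrow> psi p (ggs_a p) k = \<one>\<^bsub>aut_tree p\<^esub>"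
proof -
  show psi: "psi p (ggs_a p) k = \<one>\<^bsub>aut_tree p\<^esub>" if "k \<in> {1..p}" for k
    using that by (auto simp: psi_def one_aut_tree restrict_def ggs_a_def)
  have "letter p (int k + 1) = (if k = p then 1 else Suc k)" if "k \<in> {1..p}" for k
    using that by (simp add: letter_def)
  moreover have "psi p (ggs_a p) k w = w" if "k \<in> {1..p}" "w \<in> vertices p" for k w
    using that by (simp add: psi one_aut_tree)
  moreover have "ggs_a p (k # w) = (if k = p then 1 else Suc k) # w"
    if "k \<in> {1..p}" "w \<in> vertices p" for k w
    using that by (simp add: ggs_a_def)
  ultimately show "acts_by_shift p (ggs_a p) 1"
    unfolding acts_by_shift_def by simp
qed

lemma acts_by_shift_b:
  assumes p: "p > 0"
  shows "acts_by_shift p (ggs_b p e) 0"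
    "k \<in> {1..<p} \<Longrightarrow> psi p (ggs_b p e) k = ggs_a p [^]\<^bsub>aut_tree p\<^esub> e k"
    "psi p (ggs_b p e) p = ggs_b p e"
proof -
  show "k \<in> {1..<p} \<Longrightarrow> psi p (ggs_b p e) k = ggs_a p [^]\<^bsub>aut_tree p\<^esub> e k"
    and "psi p (ggs_b p e) p = ggs_b p e"
    using ggs_b_iff[OF p, of "ggs_b p e" e] by blast+
  show "acts_by_shift p (ggs_b p e) 0"
    unfolding acts_by_shift_def using letter_id by (auto simp: psi_def ggs_b_def)
qed


section \<open>A GGS-group as a group with sections\<close>

lemma ggs_generators: "{ggs_a p, ggs_b p e} \<subseteq> carrier (aut_tree p)"
  using ggs_a_aut ggs_b_aut by simp

lemma subgroup_ggs: "subgroup (carrier (ggs_group p e)) (aut_tree p)"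
  using group.generate_is_subgroup[OF group_aut_tree ggs_generators] by (simp add: ggs_group_def)

lemma ggs_group_simps [simp]:
  "x \<otimes>\<^bsub>ggs_group p e\<^esub> y = x \<otimes>\<^bsub>aut_tree p\<^esub> y" "\<one>\<^bsub>ggs_group p e\<^esub> = \<one>\<^bsub>aut_tree p\<^esub>"
  by (simp_all add: ggs_group_def)

lemma ggs_group_carrier_upd: "ggs_group p e = (aut_tree p)\<lparr>carrier := carrier (ggs_group p e)\<rparr>"
  by (simp add: ggs_group_def)

lemma group_ggs: "group (ggs_group p e)"
  using group.subgroup_imp_group[OF group_aut_tree subgroup_ggs] ggs_group_carrier_upd by metis

lemma ggs_group_aut: "g \<in> carrier (ggs_group p e) \<Longrightarrow> g \<in> tree_automorphisms p"
  using subgroup.mem_carrier[OF subgroup_ggs] by simp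

text \<open>The elements with these two properties form a subgroup, and the generators have them by definition.\<close>

lemma ggs_group_self_similar:
  assumes p: "p > 0" and "g \<in> carrier (ggs_group p e)"
  shows "(\<exists>r. acts_by_shift p g r) \<and> (\<forall>k\<in>{1..p}. psi p g k \<in> carrier (ggs_group p e))"
proof -
  interpret A: group "aut_tree p" by (rule group_aut_tree)
  let ?H = "generate (aut_tree p) {ggs_a p, ggs_b p e}"
  have H: "subgroup ?H (aut_tree p)"
    using A.generate_is_subgroup[OF ggs_generators] .
  have aut: "x \<in> tree_automorphisms p" if "x \<in> ?H" for x
    using subgroup.mem_carrier[OF H that] by simp
  have gens: "ggs_a p \<in> ?H" "ggs_b p e \<in> ?H"
    by (auto intro: generate.incl)
  have gen: "(\<exists>r. acts_by_shift p h r) \<and> (\<forall>k\<in>{1..p}. psi p h k \<in> ?H)"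
    if "h \<in> {ggs_a p, ggs_b p e}" for h
  proof (cases "h = ggs_a p")
    case True
    then show ?thesis using acts_by_shift_a[OF p] subgroup.one_closed[OF H] by auto
  next
    case False
    then have h: "h = ggs_b p e" using that by simp
    have "psi p h k \<in> ?H" if "k \<in> {1..p}" for k
    proof (cases "k = p")
      case True
      then show ?thesis using acts_by_shift_b(3)[OF p] gens h by simp
    next
      case False
      then show ?thesis
        using acts_by_shift_b(2)[OF p, of k] A.subgroup_int_pow_closed[OF H gens(1)] h that by simp
    qed
    then show ?thesis using acts_by_shift_b(1)[OF p] h by blast
  qed
  have "g \<in> ?H" using assms(2) by (simp add: ggs_group_def)
  then have "g \<in> ?H \<and> (\<exists>r. acts_by_shift p g r) \<and> (\<forall>k\<in>{1..p}. psi p g k \<in> ?H)"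
  proof (induction rule: generate.induct)
    case one
    then show ?case using acts_by_shift_one subgroup.one_closed[OF H] by auto
  next
    case (incl h)
    then show ?case using gen[OF incl] generate.incl[OF incl] by blast
  next
    case (inv h)
    then have hH: "h \<in> ?H" by (rule generate.incl)
    obtain r where r: "acts_by_shift p h r" and s: "\<forall>k\<in>{1..p}. psi p h k \<in> ?H"
      using gen[OF inv] by blast
    have s': "\<forall>k\<in>{1..p}. psi p h k \<in> tree_automorphisms p"
      using s aut by blast
    note i = acts_by_shift_inv[OF p aut[OF hH] r s']
    have "psi p (inv\<^bsub>aut_tree p\<^esub> h) k \<in> ?H" if "k \<in> {1..p}" for k
      unfolding i(2)[OF that] using s letter_range[OF p] subgroup.m_inv_closed[OF H] by blast
    then show ?case using i(1) subgroup.m_inv_closed[OF H hH] by blast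
  next
    case (eng g h)
    then obtain r s where r: "acts_by_shift p g r" and s: "acts_by_shift p h s" by blast
    have sg: "\<forall>k\<in>{1..p}. psi p g k \<in> tree_automorphisms p"
      using eng aut by blast
    note i = acts_by_shift_mult[OF p r sg s]
    have "psi p (g \<otimes>\<^bsub>aut_tree p\<^esub> h) k \<in> ?H" if "k \<in> {1..p}" for k
      unfolding i(2)[OF that] using eng that letter_range[OF p] subgroup.m_closed[OF H] by blast
    then show ?case using i(1) eng subgroup.m_closed[OF H] by blast
  qed
  then show ?thesis by (simp add: ggs_group_def)
qed

lemma ggs_group_acts_by_shift:
  assumes "p > 0" "g \<in> carrier (ggs_group p e)"
  shows "acts_by_shift p g (root_shift p g)"
  using ggs_group_self_similar[OF assms] root_shift_cong[OF assms(1)] acts_by_shift_cong cong_sym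
  by metis

lemma group_with_sections_ggs:
  assumes "Factorial_Ring.prime p"
  shows "group_with_sections (ggs_group p e) p (root_shift p) (tree_section p)"
proof -
  have p: "p > 0" using assms prime_gt_0_nat by blast
  interpret group "ggs_group p e" by (rule group_ggs)
  have sec: "psi p g k \<in> carrier (ggs_group p e)" if "g \<in> carrier (ggs_group p e)" "k \<in> {1..p}" for g k
    using ggs_group_self_similar[OF p that(1)] that(2) by blast
  note shift = ggs_group_acts_by_shift[OF p]
  show ?thesis
  proof unfold_locales
    show "Factorial_Ring.prime p" by (rule assms)
    show "tree_section p x k \<in> carrier (ggs_group p e)" if "x \<in> carrier (ggs_group p e)" for x k
      using sec[OF that letter_range[OF p]] by (simp add: tree_section_def)
    show "tree_section p x k = tree_section p x l" if "[k = l] (mod int p)" for x k l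
      unfolding tree_section_def letter_cong[OF that] ..
    fix x y assume x: "x \<in> carrier (ggs_group p e)" and y: "y \<in> carrier (ggs_group p e)"
    have s: "\<forall>k\<in>{1..p}. psi p x k \<in> tree_automorphisms p"
      using ggs_group_aut sec[OF x] by blast
    note m = acts_by_shift_mult[OF p shift[OF x] s shift[OF y]]
    show "[root_shift p (x \<otimes>\<^bsub>ggs_group p e\<^esub> y) = root_shift p x + root_shift p y] (mod int p)"
      using root_shift_cong[OF p m(1)] by simp
    show "tree_section p (x \<otimes>\<^bsub>ggs_group p e\<^esub> y) k =
        tree_section p x k \<otimes>\<^bsub>ggs_group p e\<^esub> tree_section p y (k + root_shift p x)" for k
      using m(2)[OF letter_range[OF p], of k] by (simp add: tree_section_def letter_letter_add[OF p])
  qed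
qed

text \<open>An element fixes a word \<open>k # w\<close> if and only if it fixes the letter \<open>k\<close> and its section at \<open>k\<close> fixes
  \<open>w\<close>, and a shift that fixes one letter is trivial.\<close>

lemma St_ggs_group:
  assumes p: "Factorial_Ring.prime p"
  shows "group_with_sections.St (ggs_group p e) p (root_shift p) (tree_section p) n
    = level_stabilizer_in p (ggs_group p e) n"
proof -
  interpret group_with_sections "ggs_group p e" p "root_shift p" "tree_section p"
    by (rule group_with_sections_ggs[OF p])
  note p0 = p_pos
  have "g \<in> St n \<longleftrightarrow> (\<forall>v\<in>vertices p. length v = n \<longrightarrow> g v = v)"
    if "g \<in> carrier (ggs_group p e)" for g
    using that
  proof (induction n arbitrary: g)
    case 0
    then show ?case using tree_automorphism_root[OF ggs_group_aut[OF "0.prems"]] by simp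
  next
    case (Suc n)
    note g = Suc.prems
    have act: "g (k # w) = letter p (int k + root_shift p g) # tree_section p g (int k) w"
      if "k \<in> {1..p}" "w \<in> vertices p" for k w
      using ggs_group_acts_by_shift[OF p0 g] that letter_id[OF that(1)]
      by (simp add: acts_by_shift_def tree_section_def)
    show ?case
    proof
      assume "g \<in> St (Suc n)"
      then have r: "[root_shift p g = 0] (mod int p)" and s: "\<And>k. tree_section p g k \<in> St n"
        by auto
      show "\<forall>v\<in>vertices p. length v = Suc n \<longrightarrow> g v = v"
      proof (intro ballI impI)
        fix v assume v: "v \<in> vertices p" "length v = Suc n"
        then obtain k w where kw: "v = k # w" by (cases v) auto
        have k: "k \<in> {1..p}" and w: "w \<in> vertices p" "length w = n" using v kw by auto
        have "letter p (int k + root_shift p g) = letter p (int k)"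
          using cong_add[OF cong_refl r, of "int k"] by (intro letter_cong) simp
        moreover have "tree_section p g (int k) w = w"
          using Suc.IH[OF sec_closed[OF g]] s w by blast
        ultimately show "g v = v"
          using act[OF k w(1)] letter_id[OF k] kw by simp
      qed
    next
      assume fixed: "\<forall>v\<in>vertices p. length v = Suc n \<longrightarrow> g v = v"
      have eq: "letter p (int k + root_shift p g) = k \<and> tree_section p g (int k) w = w"
        if "k \<in> {1..p}" "w \<in> vertices p" "length w = n" for k w
      proof -
        have "g (k # w) = k # w" using fixed that by simp
        then show ?thesis using act[OF that(1,2)] by simp
      qed
      have "replicate n 1 \<in> vertices p"
        using p0 by (auto simp: vertices_def)
      then have "letter p (int p + root_shift p g) = p"
        using eq[of p "replicate n 1"] p0 by simp
      then have "[int p = int p + root_shift p g] (mod int p)"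
        using cong_letter[OF p0, of "int p + root_shift p g"] by simp
      then have "[root_shift p g = 0] (mod int p)"
        by (simp add: cong_def)
      moreover have "tree_section p g k \<in> St n" for k
      proof -
        let ?k = "letter p k"
        have "tree_section p g k = tree_section p g (int ?k)"
          by (intro sec_cong cong_sym[OF cong_letter[OF p0]])
        then show ?thesis
          using Suc.IH[OF sec_closed[OF g, of k]] eq[OF letter_range[OF p0]] by metis
      qed
      ultimately show "g \<in> St (Suc n)" using g by simp
    qed
  qed
  then show ?thesis
    unfolding level_stabilizer_in_def level_stabilizer_def carrier_aut_tree
    using St_carrier ggs_group_aut by blast
qed

text \<open>The value at multiples of \<open>p\<close> is the shift of the section \<open>b\<close> of \<open>b\<close>, which is \<open>0\<close>.\<close>

definition periodic_vector :: "nat \<Rightarrow> (nat \<Rightarrow> int) \<Rightarrow> int \<Rightarrow> int" where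
  "periodic_vector p e k = (if int p dvd k then 0 else e (letter p k))"

lemma ggs_sections_ggs_group:
  assumes p: "Factorial_Ring.prime p" and e: "\<exists>i\<in>{1..p - 1}. \<not> int p dvd e i"
  shows "ggs_sections (ggs_group p e) p (root_shift p) (tree_section p)
    (ggs_a p) (ggs_b p e) (periodic_vector p e)"
proof -
  interpret group_with_sections "ggs_group p e" p "root_shift p" "tree_section p"
    by (rule group_with_sections_ggs[OF p])
  interpret A: group "aut_tree p" by (rule group_aut_tree)
  note p0 = p_pos
  have a: "ggs_a p \<in> carrier (ggs_group p e)" and b: "ggs_b p e \<in> carrier (ggs_group p e)"
    by (auto simp: ggs_group_def intro: generate.incl)
  have pow: "ggs_a p [^]\<^bsub>ggs_group p e\<^esub> (z::int) = ggs_a p [^]\<^bsub>aut_tree p\<^esub> z" for z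
    using A.int_pow_consistent[OF subgroup_ggs a] ggs_group_carrier_upd by metis
  show ?thesis
  proof unfold_locales
    show "x = \<one>\<^bsub>ggs_group p e\<^esub>" if x: "x \<in> carrier (ggs_group p e)" "\<And>n. x \<in> St n" for x
    proof (rule extensionalityI[of _ "vertices p"])
      show "x \<in> extensional (vertices p)"
        using ggs_group_aut[OF x(1)] by (rule tree_automorphism_extensional)
      show "\<one>\<^bsub>ggs_group p e\<^esub> \<in> extensional (vertices p)"
        by (simp add: one_aut_tree)
      fix v assume v: "v \<in> vertices p"
      have "x \<in> level_stabilizer_in p (ggs_group p e) (length v)"
        using x(2)[of "length v"] by (simp only: St_ggs_group[OF p])
      then show "x v = \<one>\<^bsub>ggs_group p e\<^esub> v"
        using v by (simp add: level_stabilizer_in_def level_stabilizer_def one_aut_tree)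
    qed
    show "ggs_a p \<in> carrier (ggs_group p e)" "ggs_b p e \<in> carrier (ggs_group p e)"
      by (rule a, rule b)
    have "generate (aut_tree p) {ggs_a p, ggs_b p e} = generate (ggs_group p e) {ggs_a p, ggs_b p e}"
      using A.generate_consistent[OF _ subgroup_ggs, of "{ggs_a p, ggs_b p e}"] a b
        ggs_group_carrier_upd by (metis empty_subsetI insert_subset)
    then show "generate (ggs_group p e) {ggs_a p, ggs_b p e} = carrier (ggs_group p e)"
      by (simp add: ggs_group_def)
    show "[root_shift p (ggs_a p) = 1] (mod int p)" "[root_shift p (ggs_b p e) = 0] (mod int p)"
      using root_shift_cong[OF p0] acts_by_shift_a(1)[OF p0] acts_by_shift_b(1)[OF p0] by blast+
    show "tree_section p (ggs_a p) k = \<one>\<^bsub>ggs_group p e\<^esub>" for k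
      using acts_by_shift_a(2)[OF p0 letter_range[OF p0]] by (simp add: tree_section_def)
    show "tree_section p (ggs_b p e) k = (if int p dvd k then ggs_b p e
        else ggs_a p [^]\<^bsub>ggs_group p e\<^esub> periodic_vector p e k)" for k
    proof (cases "int p dvd k")
      case True
      then have "letter p k = letter p (int p)"
        by (intro letter_cong) (simp add: cong_def mod_eq_0_iff_dvd)
      then have "letter p k = p" using letter_id[of p p] p0 by simp
      then show ?thesis using True acts_by_shift_b(3)[OF p0] by (simp add: tree_section_def)
    next
      case False
      have "letter p k \<noteq> p"
      proof
        assume "letter p k = p"
        then have "[int p = k] (mod int p)" using cong_letter[OF p0, of k] by simp
        then show False using False by (simp add: cong_def mod_eq_0_iff_dvd)
      qed
      then have "letter p k \<in> {1..<p}" using letter_range[OF p0, of k] by simp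
      then show ?thesis
        using False acts_by_shift_b(2)[OF p0] by (simp add: tree_section_def periodic_vector_def pow)
    qed
    show "periodic_vector p e 0 = 0" by (simp add: periodic_vector_def)
    show "periodic_vector p e k = periodic_vector p e l" if "[k = l] (mod int p)" for k l
      using letter_cong[OF that] cong_dvd_iff[OF that] by (simp add: periodic_vector_def)
    obtain i where i: "i \<in> {1..p - 1}" "\<not> int p dvd e i" using e ..
    then have "\<not> int p dvd int i" "letter p (int i) = i"
      using letter_id[of i p] by (auto dest: dvd_imp_le)
    then show "\<exists>k. \<not> int p dvd periodic_vector p e k"
      using i(2) by (intro exI[of _ "int i"]) (simp add: periodic_vector_def)
  qed
qed


section \<open>Quotients of periodic GGS-groups\<close>

theorem theoremA:
  fixes p n :: nat and e :: "nat \<Rightarrow> int"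
  assumes "Factorial_Ring.prime p" and "odd p"
    and "\<forall>i\<in>{1..p - 1}. e i \<in> carrier (residue_ring (int p))"
    and "\<exists>i\<in>{1..p - 1}. e i \<noteq> \<zero>\<^bsub>residue_ring (int p)\<^esub>"
    and "periodic_group (ggs_group p e)"
    and "p \<ge> 5 \<and> n \<ge> 2 \<or> p = 3 \<and> n \<ge> 3"
  shows "beauville_group (ggs_group p e Mod level_stabilizer_in p (ggs_group p e) n)"
proof -
  have "\<exists>i\<in>{1..p - 1}. \<not> int p dvd e i"
  proof -
    obtain i where i: "i \<in> {1..p - 1}" "e i \<noteq> 0"
      using assms(4) by (auto simp: residue_ring_def)
    then have "0 < e i" "e i < int p"
      using assms(3) by (force simp: residue_ring_def)+
    then show ?thesis using i(1) zdvd_not_zless by blast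
  qed
  then interpret ggs_sections "ggs_group p e" p "root_shift p" "tree_section p"
    "ggs_a p" "ggs_b p e" "periodic_vector p e"
    by (rule ggs_sections_ggs_group[OF assms(1)])
  have "[(\<Sum>j\<in>{0..<int p}. periodic_vector p e j) = 0] (mod int p)"
    using assms(5) unfolding periodic_group_def by (intro periodic_imp_sum_0) blast
  then interpret zero_sum_ggs_sections "ggs_group p e" p "root_shift p" "tree_section p"
    "ggs_a p" "ggs_b p e" "periodic_vector p e"
    by unfold_locales
  have "beauville_group (ggs_group p e Mod St n)"
    using assms(6) beauville_group_ge_5 beauville_group_3 by blast
  then show ?thesis
    by (simp only: St_ggs_group[OF assms(1)])
qed

end
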